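(* Let $\mathcal U,\mathcal Y,\mathcal E,\mathcal E'$ be separable Hilbert spaces, let $$\Phi=\begin{bmatrix}\Phi_{11}&\Phi_{12}\\ \Phi_{21}&\Phi_{22}\end{bmatrix}\in S(\mathcal E'\oplus\mathcal U,\ \mathcal E\oplus\mathcal Y),$$ and let $F,G\in S(\mathcal E,\mathcal E')$ be such that $F\stackrel{\infty}{\prec}G$, $\|\Phi_{11}(0)F(0)\|<1$ and $\|\Phi_{11}(0)G(0)\|<1$. Assume that the function $I-\Phi_{11}F$ is boundedly invertible on $\mathbb D$, i.e. $I-\Phi_{11}(\lambda)F(\lambda)$ is invertible for each $\lambda\in\mathbb D$ and $\sup_{\lambda\in\mathbb D}\|(I-\Phi_{11}(\lambda)F(\lambda))^{-1}\|<\infty$. Then $\mathfrak R_\Phi[F]\stackrel{\infty}{\prec}\mathfrak R_\Phi[G]$. In particular, if $\Phi_{11}$ is a strict Schur class function (i.e. $\|\Phi_{11}\|_\infty<1$), then $\mathfrak R_\Phi$ maps $S(\mathcal E,\mathcal E')$ into $S(\mathcal U,\mathcal Y)$ and preserves the pre-order $\stackrel{\infty}{\prec}$.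
   Context: Operators are bounded linear maps between Hilbert spaces; $\mathcal L_1(\mathcal H_1,\mathcal H_2)$ is the set of contractions. For a contraction $C$, $D_C=(I-C^*C)^{1/2}$ and $\mathcal D_C=\overline{\mathrm{Ran}}\,D_C$. For contractions $A,B\in\mathcal L_1(\mathcal H_1,\mathcal H_2)$, $A\prec B$ means $A-B=D_{B^*}XD_B$ for some bounded operator $X:\mathcal D_B\to\mathcal D_{B^*}$; this is a pre-order. The Schur class $S(\mathcal U,\mathcal Y)$ consists of all $\mathcal L_1(\mathcal U,\mathcal Y)$-valued analytic functions on the open unit disc $\mathbb D$; $\|\cdot\|_\infty$ is the supremum norm on $\mathbb D$. For $F\in S(\mathcal U,\mathcal Y)$, $T_F:H^2_{\mathcal U}\to H^2_{\mathcal Y}$, $(T_Fh)(\lambda)=F(\lambda)h(\lambda)$. For $F,G\in S(\mathcal U,\mathcal Y)$ write $F\stackrel{\infty}{\prec}G$ if $T_F\prec T_G$. In the block decomposition, $\Phi_{11}(\lambda):\mathcal E'\to\mathcal E$, $\Phi_{12}(\lambda):\mathcal U\to\mathcal E$, $\Phi_{21}(\lambda):\mathcal E'\to\mathcal Y$, $\Phi_{22}(\lambda):\mathcal U\to\mathcal Y$. The Redheffer map is defined for $F\in S(\mathcal E,\mathcal E')$ with $\|\Phi_{11}(0)F(0)\|<1$ by $$\mathfrak R_\Phi[F](\lambda)=\Phi_{22}(\lambda)+\Phi_{21}(\lambda)F(\lambda)(I-\Phi_{11}(\lambda)F(\lambda))^{-1}\Phi_{12}(\lambda)\quad(\lambda\in\mathbb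 D);$$ it is known that under this condition the inverse exists for every $\lambda\in\mathbb D$ and $\mathfrak R_\Phi[F]\in S(\mathcal U,\mathcal Y)$. *)

theory Defs
  imports "HOL-Complex_Analysis.Complex_Analysis"
begin

section \<open>Complex normed spaces and complex Hilbert spaces\<close>

class complex_normed_vector = real_normed_vector +
  fixes scaleC :: "complex \<Rightarrow> 'a \<Rightarrow> 'a"  (infixr \<open>*\<^sub>C\<close> 75)
  assumes scaleC_add_right: "c *\<^sub>C (x + y) = c *\<^sub>C x + c *\<^sub>C y"
    and scaleC_add_left: "(c + d) *\<^sub>C x = c *\<^sub>C x + d *\<^sub>C x"
    and scaleC_scaleC: "c *\<^sub>C d *\<^sub>C x = (c * d) *\<^sub>C x"
    and scaleR_scaleC: "r *\<^sub>R x = complex_of_real r *\<^sub>C x"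
    and norm_scaleC: "norm (c *\<^sub>C x) = cmod c * norm x"

class complex_inner = complex_normed_vector +
  fixes cinner :: "'a \<Rightarrow> 'a \<Rightarrow> complex"
  assumes cinner_add_left: "cinner (x + y) z = cinner x z + cinner y z"
    and cinner_scaleC_left: "cinner (c *\<^sub>C x) y = c * cinner x y"
    and cinner_commute: "cinner x y = cnj (cinner y x)"
    and cinner_self: "cinner x x = complex_of_real ((norm x)\<^sup>2)"

class complex_hilbert = complex_inner + complete_space
begin
subclass banach ..
end

lemma bounded_linear_scaleC: "bounded_linear (\<lambda>x::'a::complex_normed_vector. c *\<^sub>C x)"
proof (rule bounded_linear_intro[where K = "cmod c"])
  fix r :: real and x :: 'a
  show "c *\<^sub>C (r *\<^sub>R x) = r *\<^sub>R c *\<^sub>C x"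
    by (simp add: scaleR_scaleC scaleC_scaleC mult.commute)
qed (simp_all add: scaleC_add_right norm_scaleC mult.commute)

lemma scaleC_one [simp]: "1 *\<^sub>C x = (x::'a::complex_normed_vector)"
  using scaleR_scaleC[of 1 x] by simp

lemma scaleC_zero_left [simp]: "0 *\<^sub>C x = (0::'a::complex_normed_vector)"
  using scaleR_scaleC[of 0 x] by simp

lemma scaleC_zero_right [simp]: "c *\<^sub>C 0 = (0::'a::complex_normed_vector)"
  by (rule linear_0[OF bounded_linear.linear[OF bounded_linear_scaleC]])

lemma scaleC_minus_right: "c *\<^sub>C (- x) = - (c *\<^sub>C (x::'a::complex_normed_vector))"
  by (rule linear_neg[OF bounded_linear.linear[OF bounded_linear_scaleC]])

lemma scaleC_diff_right: "c *\<^sub>C (x - y) = c *\<^sub>C x - c *\<^sub>C (y::'a::complex_normed_vector)"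
  by (rule linear_diff[OF bounded_linear.linear[OF bounded_linear_scaleC]])

lemma scaleC_of_real: "complex_of_real r *\<^sub>C x = r *\<^sub>R (x::'a::complex_normed_vector)"
  by (simp add: scaleR_scaleC)

instantiation prod :: (complex_normed_vector, complex_normed_vector) complex_normed_vector
begin
definition scaleC_prod :: "complex \<Rightarrow> 'a \<times> 'b \<Rightarrow> 'a \<times> 'b"
  where "scaleC_prod c p = (c *\<^sub>C fst p, c *\<^sub>C snd p)"
instance
proof
  fix c :: complex and x :: "'a \<times> 'b"
  have "sqrt ((cmod c * norm (fst x))\<^sup>2 + (cmod c * norm (snd x))\<^sup>2)
      = sqrt ((cmod c)\<^sup>2 * ((norm (fst x))\<^sup>2 + (norm (snd x))\<^sup>2))"
    by (simp add: power_mult_distrib distrib_left)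
  then show "norm (c *\<^sub>C x) = cmod c * norm x"
    by (simp add: scaleC_prod_def norm_prod_def norm_scaleC real_sqrt_mult)
qed (simp_all add: scaleC_prod_def scaleC_add_left scaleC_add_right scaleC_scaleC
      scaleR_scaleC prod_eq_iff)
end

instantiation prod :: (complex_inner, complex_inner) complex_inner
begin
definition cinner_prod :: "'a \<times> 'b \<Rightarrow> 'a \<times> 'b \<Rightarrow> complex"
  where "cinner_prod p q = cinner (fst p) (fst q) + cinner (snd p) (snd q)"
instance
proof
  fix x y :: "'a \<times> 'b"
  show "cinner x y = cnj (cinner y x)"
    unfolding cinner_prod_def
    by (metis cinner_commute complex_cnj_add)
qed (simp_all add: cinner_prod_def scaleC_prod_def cinner_add_left cinner_scaleC_left
      cinner_self norm_prod_def distrib_left)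
end

instance prod :: (complex_hilbert, complex_hilbert) complex_hilbert ..


section \<open>Bounded operators\<close>

text \<open>The library type of bounded real-linear maps carries the operator norm and the norm
  topology; the operators of complex Hilbert space theory are its complex-linear elements.\<close>

instantiation blinfun :: (real_normed_vector, complex_normed_vector) complex_normed_vector
begin

lift_definition scaleC_blinfun :: "complex \<Rightarrow> 'a \<Rightarrow>\<^sub>L 'b \<Rightarrow> 'a \<Rightarrow>\<^sub>L 'b"
  is "\<lambda>c T x. c *\<^sub>C T x"
  by (rule bounded_linear_compose[OF bounded_linear_scaleC])

instance
proof
  fix c d :: complex and r :: real and T S :: "'a \<Rightarrow>\<^sub>L 'b"
  show "c *\<^sub>C (T + S) = c *\<^sub>C T + c *\<^sub>C S"
    by (transfer, simp add: scaleC_add_right)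
  show "(c + d) *\<^sub>C T = c *\<^sub>C T + d *\<^sub>C T"
    by (transfer, simp add: scaleC_add_left)
  show *: "c *\<^sub>C d *\<^sub>C T = (c * d) *\<^sub>C T" for c d :: complex and T :: "'a \<Rightarrow>\<^sub>L 'b"
    by (transfer, simp add: scaleC_scaleC)
  show "r *\<^sub>R T = complex_of_real r *\<^sub>C T"
    by (transfer, simp add: scaleR_scaleC)
  have le: "norm (c *\<^sub>C T) \<le> cmod c * norm T" for c :: complex and T :: "'a \<Rightarrow>\<^sub>L 'b"
  proof (rule norm_blinfun_bound)
    show "norm (blinfun_apply (c *\<^sub>C T) x) \<le> cmod c * norm T * norm x" for x
      by (simp add: scaleC_blinfun.rep_eq norm_scaleC mult.assoc mult_left_mono norm_blinfun)
  qed simp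
  show "norm (c *\<^sub>C T) = cmod c * norm T"
  proof (cases "c = 0")
    case True
    then show ?thesis using le[of c T] by simp
  next
    case False
    have one: "1 *\<^sub>C T = T" by (transfer, simp)
    have "norm T \<le> cmod (inverse c) * norm (c *\<^sub>C T)"
      using le[of "inverse c" "c *\<^sub>C T"] False by (simp add: * one)
    then have "cmod c * norm T \<le> cmod c * (cmod (inverse c) * norm (c *\<^sub>C T))"
      by (rule mult_left_mono) simp
    also have "\<dots> = norm (c *\<^sub>C T)"
      using False by (simp add: norm_inverse mult.assoc[symmetric] del: inverse_eq_divide)
    finally have "cmod c * norm T \<le> norm (c *\<^sub>C T)" .
    then show ?thesis using le[of c T] by simp
  qed
qed

end

definition clinear_op :: "'a::complex_normed_vector \<Rightarrow>\<^sub>L 'b::complex_normed_vector \<Rightarrow> bool"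
  where "clinear_op T \<longleftrightarrow> (\<forall>c x. T (c *\<^sub>C x) = c *\<^sub>C T x)"

definition contraction :: "'a::complex_hilbert \<Rightarrow>\<^sub>L 'b::complex_hilbert \<Rightarrow> bool"
  where "contraction C \<longleftrightarrow> clinear_op C \<and> norm C \<le> 1"

definition cadj :: "'a::complex_hilbert \<Rightarrow>\<^sub>L 'b::complex_hilbert \<Rightarrow> 'b \<Rightarrow>\<^sub>L 'a"
  where "cadj T = (THE S :: 'b \<Rightarrow>\<^sub>L 'a. \<forall>x y. cinner (T x) y = cinner x (S y))"

definition positive_op :: "'a::complex_hilbert \<Rightarrow>\<^sub>L 'a \<Rightarrow> bool"
  where "positive_op P \<longleftrightarrow>
    clinear_op P \<and> (\<forall>x. cinner (P x) x \<in> \<real> \<and> 0 \<le> Re (cinner (P x) x))"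

definition sqrt_op :: "'a::complex_hilbert \<Rightarrow>\<^sub>L 'a \<Rightarrow> 'a \<Rightarrow>\<^sub>L 'a"
  where "sqrt_op P = (THE S. positive_op S \<and> S o\<^sub>L S = P)"

definition invertible_op :: "'a::real_normed_vector \<Rightarrow>\<^sub>L 'b::real_normed_vector \<Rightarrow> bool"
  where "invertible_op T \<longleftrightarrow> (\<exists>S. S o\<^sub>L T = id_blinfun \<and> T o\<^sub>L S = id_blinfun)"

definition inverse_op :: "'a::real_normed_vector \<Rightarrow>\<^sub>L 'b::real_normed_vector \<Rightarrow> 'b \<Rightarrow>\<^sub>L 'a"
  where "inverse_op T = (THE S. S o\<^sub>L T = id_blinfun \<and> T o\<^sub>L S = id_blinfun)"

definition defect_op :: "'a::complex_hilbert \<Rightarrow>\<^sub>L 'b::complex_hilbert \<Rightarrow> 'a \<Rightarrow>\<^sub>L 'a"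
  where "defect_op C = sqrt_op (id_blinfun - (cadj C o\<^sub>L C))"

definition defect_space :: "'a::complex_hilbert \<Rightarrow>\<^sub>L 'b::complex_hilbert \<Rightarrow> 'a set"
  where "defect_space C = closure (range (defect_op C))"

definition bounded_op_between ::
    "'a::complex_hilbert set \<Rightarrow> 'b::complex_hilbert set \<Rightarrow> ('a \<Rightarrow> 'b) \<Rightarrow> bool"
  where "bounded_op_between M N X \<longleftrightarrow>
    (\<forall>x\<in>M. X x \<in> N) \<and>
    (\<forall>x\<in>M. \<forall>y\<in>M. X (x + y) = X x + X y) \<and>
    (\<forall>c. \<forall>x\<in>M. X (c *\<^sub>C x) = c *\<^sub>C X x) \<and>
    (\<exists>K. \<forall>x\<in>M. norm (X x) \<le> K * norm x)"

definition prec_op ::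
    "'a::complex_hilbert \<Rightarrow>\<^sub>L 'b::complex_hilbert \<Rightarrow> 'a \<Rightarrow>\<^sub>L 'b \<Rightarrow> bool"  (infix \<open>\<prec>\<close> 50)
  where "A \<prec> B \<longleftrightarrow> contraction A \<and> contraction B \<and>
    (\<exists>X. bounded_op_between (defect_space B) (defect_space (cadj B)) X \<and>
         (\<forall>h. (A - B) h = defect_op (cadj B) (X (defect_op B h))))"


section \<open>The vector-valued Hardy space of the disc\<close>

lemma cinner_zero_left [simp]: "cinner 0 y = 0" for y :: "'a::complex_inner"
  using cinner_add_left[of 0 0 y] by simp

lemma cinner_diff_left: "cinner (x - y) z = cinner x z - cinner y z" for x :: "'a::complex_inner"
  using cinner_add_left[of "x - y" y z] by simp

lemma cinner_add_right: "cinner z (x + y) = cinner z x + cinner z y" for x :: "'a::complex_inner"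
  by (metis cinner_add_left cinner_commute complex_cnj_add)

lemma cinner_scaleC_right: "cinner x (c *\<^sub>C y) = cnj c * cinner x y" for x :: "'a::complex_inner"
  by (metis cinner_scaleC_left cinner_commute complex_cnj_mult)

lemma cinner_diff_right: "cinner z (x - y) = cinner z x - cinner z y" for x :: "'a::complex_inner"
  by (metis cinner_diff_left cinner_commute complex_cnj_diff)

lemma cinner_cauchy_schwarz: "cmod (cinner x y) \<le> norm x * norm y" for x y :: "'a::complex_inner"
proof (cases "y = 0")
  case True
  then have "cinner x y = 0"
    by (metis cinner_commute cinner_zero_left complex_cnj_zero)
  then show ?thesis by simp
next
  case False
  define n where "n = complex_of_real ((norm y)\<^sup>2)"
  have n0: "n \<noteq> 0" and cn: "cnj n = n" using False by (simp_all add: n_def)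
  define t where "t = cinner x y / n"
  have yx: "cinner y x = cnj (cinner x y)" by (rule cinner_commute)
  have "complex_of_real ((norm (x - t *\<^sub>C y))\<^sup>2) = cinner (x - t *\<^sub>C y) (x - t *\<^sub>C y)"
    by (simp add: cinner_self)
  also have "\<dots> = cinner x x - cnj t * cinner x y - t * cinner y x + t * cnj t * cinner y y"
    by (simp add: cinner_diff_left cinner_diff_right cinner_scaleC_left cinner_scaleC_right
        algebra_simps)
  also have "\<dots> = complex_of_real ((norm x)\<^sup>2) - cinner x y * cnj (cinner x y) / n"
    using n0 by (simp add: cinner_self yx t_def cn n_def[symmetric] del: of_real_power)
  also have "\<dots> = complex_of_real ((norm x)\<^sup>2 - (cmod (cinner x y))\<^sup>2 / (norm y)\<^sup>2)"
    by (simp add: n_def complex_norm_square[symmetric])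
  finally have "(norm (x - t *\<^sub>C y))\<^sup>2 = (norm x)\<^sup>2 - (cmod (cinner x y))\<^sup>2 / (norm y)\<^sup>2"
    by (simp only: of_real_eq_iff)
  then have "(cmod (cinner x y))\<^sup>2 / (norm y)\<^sup>2 \<le> (norm x)\<^sup>2"
    by (metis diff_ge_0_iff_ge zero_le_power2)
  then have "(cmod (cinner x y))\<^sup>2 \<le> (norm x * norm y)\<^sup>2"
    using False by (simp add: field_simps power_mult_distrib)
  then show ?thesis by (rule power2_le_imp_le) simp
qed

lemma bounded_linear_cinner_left: "bounded_linear (\<lambda>x::'a::complex_inner. cinner x y)"
proof (rule bounded_linear_intro[where K = "norm y"])
  show "cinner (r *\<^sub>R x) y = r *\<^sub>R cinner x y" for r and x :: 'a
    by (simp add: scaleR_scaleC cinner_scaleC_left scaleR_conv_of_real)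
qed (simp_all add: cinner_add_left cinner_cauchy_schwarz)

lemma bounded_linear_scaleC_left: "bounded_linear (\<lambda>c. c *\<^sub>C (x::'a::complex_normed_vector))"
  by (rule bounded_linear_intro[where K = "norm x"])
     (simp_all add: scaleC_add_left norm_scaleC scaleR_scaleC scaleC_scaleC scaleR_conv_of_real)

definition square_summable :: "(nat \<Rightarrow> 'a::real_normed_vector) \<Rightarrow> bool"
  where "square_summable a \<longleftrightarrow> summable (\<lambda>n. (norm (a n))\<^sup>2)"

lemma powser_unique:
  fixes a b :: "nat \<Rightarrow> 'a::complex_inner"
  assumes a: "\<And>z. z \<in> ball 0 1 \<Longrightarrow> (\<lambda>n. z ^ n *\<^sub>C a n) sums f z"
    and b: "\<And>z. z \<in> ball 0 1 \<Longrightarrow> (\<lambda>n. z ^ n *\<^sub>C b n) sums f z"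
  shows "a = b"
proof
  fix m
  define c where "c n = cinner (a n - b n) (a m - b m)" for n
  have s: "(\<lambda>n. c n * (z - 0) ^ n) sums (\<lambda>_. 0) z" if "norm (z - 0) < 1" for z
  proof -
    have "(\<lambda>n. z ^ n *\<^sub>C a n - z ^ n *\<^sub>C b n) sums (f z - f z)"
      using that by (intro sums_diff a b) auto
    from bounded_linear.sums[OF bounded_linear_cinner_left this, of "a m - b m"]
    show ?thesis
      by (simp add: c_def cinner_scaleC_left mult.commute flip: scaleC_diff_right)
  qed
  have "c m = 0"
  proof (rule ccontr)
    assume cm: "c m \<noteq> 0"
    show False
    proof (cases "m = 0")
      case True
      have "(\<lambda>n. c n * 0 ^ n) sums (0::complex)"
        using s[of 0] by simp
      moreover have "(\<lambda>n. c n * 0 ^ n) sums c 0" by (rule powser_sums_zero)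
      ultimately show False using cm True sums_unique2 by blast
    next
      case False
      then have "0 < m" by simp
      show False
      proof (rule powser_0_nonzero[OF zero_less_one s refl cm \<open>0 < m\<close>])
        fix e :: real
        assume "0 < e" and nz: "\<And>z::complex. z \<in> cball 0 e - {0} \<Longrightarrow> (0::complex) \<noteq> 0"
        then show False using nz[of "complex_of_real e"] by simp
      qed
    qed
  qed
  then show "a m = b m" by (simp add: c_def cinner_self)
qed

text \<open>The Hardy space \<open>H\<^sup>2\<close> of analytic functions on the disc with square-summable Taylor
  coefficients. They are extended by zero, so that the values on the disc determine the element
  of the type.\<close>

typedef (overloaded) 'a hardy =
  "{h :: complex \<Rightarrow> 'a::complex_hilbert. \<exists>a. square_summable a \<and>
      (\<forall>z\<in>ball 0 1. (\<lambda>n. z ^ n *\<^sub>C a n) sums h z) \<and> (\<forall>z. z \<notin> ball 0 1 \<longrightarrow> h z = 0)}"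
  morphisms hardy_fun Abs_hardy
  by (rule exI[of _ "\<lambda>_. 0"], rule CollectI, rule exI[of _ "\<lambda>_. 0"])
     (simp add: square_summable_def)

definition hardy_coeff :: "'a::complex_hilbert hardy \<Rightarrow> nat \<Rightarrow> 'a"
  where "hardy_coeff h = (THE a. \<forall>z\<in>ball 0 1. (\<lambda>n. z ^ n *\<^sub>C a n) sums hardy_fun h z)"

lemma hardy_coeff_eqI:
  assumes "\<And>z. z \<in> ball 0 1 \<Longrightarrow> (\<lambda>n. z ^ n *\<^sub>C a n) sums hardy_fun h z"
  shows "hardy_coeff h = a"
  unfolding hardy_coeff_def
proof (rule the_equality)
  show "b = a" if "\<forall>z\<in>ball 0 1. (\<lambda>n. z ^ n *\<^sub>C b n) sums hardy_fun h z" for b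
    using that assms by (intro powser_unique) auto
qed (use assms in auto)

lemma
  shows square_summable_hardy_coeff: "square_summable (hardy_coeff h)"
    and hardy_coeff_sums: "z \<in> ball 0 1 \<Longrightarrow> (\<lambda>n. z ^ n *\<^sub>C hardy_coeff h n) sums hardy_fun h z"
    and hardy_fun_outside: "z \<notin> ball 0 1 \<Longrightarrow> hardy_fun h z = 0"
proof -
  obtain a where a: "square_summable a" "\<And>z. z \<in> ball 0 1 \<Longrightarrow> (\<lambda>n. z ^ n *\<^sub>C a n) sums hardy_fun h z"
    "\<forall>z. z \<notin> ball 0 1 \<longrightarrow> hardy_fun h z = 0"
    using hardy_fun[of h] by blast
  have "hardy_coeff h = a" by (rule hardy_coeff_eqI) (rule a(2))
  then show "square_summable (hardy_coeff h)"
    "z \<in> ball 0 1 \<Longrightarrow> (\<lambda>n. z ^ n *\<^sub>C hardy_coeff h n) sums hardy_fun h z"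
    "z \<notin> ball 0 1 \<Longrightarrow> hardy_fun h z = 0"
    using a by auto
qed

lemma square_summable_add:
  assumes "square_summable a" "square_summable b"
  shows "square_summable (\<lambda>n. a n + b n)"
  unfolding square_summable_def
proof (rule summable_comparison_test')
  show "summable (\<lambda>n. 2 * (norm (a n))\<^sup>2 + 2 * (norm (b n))\<^sup>2)"
    using assms unfolding square_summable_def by (intro summable_add summable_mult)
  fix n
  have "(norm (a n + b n))\<^sup>2 \<le> (norm (a n) + norm (b n))\<^sup>2"
    by (intro power_mono norm_triangle_ineq) simp
  also have "\<dots> \<le> 2 * (norm (a n))\<^sup>2 + 2 * (norm (b n))\<^sup>2"
    using zero_le_power2[of "norm (a n) - norm (b n)"] by (simp add: power2_eq_square algebra_simps)
  finally show "norm ((norm (a n + b n))\<^sup>2) \<le> 2 * (norm (a n))\<^sup>2 + 2 * (norm (b n))\<^sup>2" by simp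
qed

lemma square_summable_scaleC:
  fixes a :: "nat \<Rightarrow> 'a::complex_normed_vector"
  assumes "square_summable a"
  shows "square_summable (\<lambda>n. c *\<^sub>C a n)"
  using assms unfolding square_summable_def
  by (simp add: norm_scaleC power_mult_distrib summable_mult)

lemma mult_le_sum_power2:
  fixes x y :: real
  assumes "0 \<le> x" "0 \<le> y"
  shows "x * y \<le> x\<^sup>2 + y\<^sup>2"
proof -
  have "2 * (x * y) \<le> x\<^sup>2 + y\<^sup>2"
    using sum_squares_bound[of x y] by (simp add: mult.assoc)
  moreover have "0 \<le> x * y" using assms by simp
  ultimately show ?thesis by linarith
qed

lemma square_summable_cinner:
  fixes a b :: "nat \<Rightarrow> 'a::complex_inner"
  assumes "square_summable a" "square_summable b"
  shows "summable (\<lambda>n. cinner (a n) (b n))"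
proof (rule summable_comparison_test')
  show "summable (\<lambda>n. (norm (a n))\<^sup>2 + (norm (b n))\<^sup>2)"
    using assms unfolding square_summable_def by (intro summable_add)
  fix n
  have "norm (cinner (a n) (b n)) \<le> norm (a n) * norm (b n)"
    by (rule cinner_cauchy_schwarz)
  also have "\<dots> \<le> (norm (a n))\<^sup>2 + (norm (b n))\<^sup>2"
    by (intro mult_le_sum_power2) simp_all
  finally show "norm (cinner (a n) (b n)) \<le> (norm (a n))\<^sup>2 + (norm (b n))\<^sup>2" .
qed

lemma summable_powser_square_summable:
  fixes a :: "nat \<Rightarrow> 'a::complex_hilbert"
  assumes "square_summable a" "z \<in> ball 0 1"
  shows "summable (\<lambda>n. z ^ n *\<^sub>C a n)"
proof (rule summable_comparison_test')
  have "norm ((cmod z)\<^sup>2) < 1"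
    using assms(2) by (simp add: abs_square_less_1)
  then show "summable (\<lambda>n. ((cmod z)\<^sup>2) ^ n + (norm (a n))\<^sup>2)"
    using assms(1) unfolding square_summable_def
    by (intro summable_add summable_geometric)
  fix n
  have "norm (z ^ n *\<^sub>C a n) = cmod z ^ n * norm (a n)"
    by (simp add: norm_scaleC norm_power)
  also have "\<dots> \<le> (cmod z ^ n)\<^sup>2 + (norm (a n))\<^sup>2"
    by (intro mult_le_sum_power2) simp_all
  finally show "norm (z ^ n *\<^sub>C a n) \<le> ((cmod z)\<^sup>2) ^ n + (norm (a n))\<^sup>2"
    by (simp add: power_mult[symmetric] mult.commute)
qed

lemma
  fixes a :: "nat \<Rightarrow> 'a::complex_hilbert"
  assumes "square_summable a"
    and "\<And>z. z \<in> ball 0 1 \<Longrightarrow> (\<lambda>n. z ^ n *\<^sub>C a n) sums f z"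
    and "\<And>z. z \<notin> ball 0 1 \<Longrightarrow> f z = 0"
  shows hardy_fun_Abs: "hardy_fun (Abs_hardy f) = f"
    and hardy_coeff_Abs: "hardy_coeff (Abs_hardy f) = a"
proof -
  show "hardy_fun (Abs_hardy f) = f"
    using assms by (intro Abs_hardy_inverse) blast
  then show "hardy_coeff (Abs_hardy f) = a"
    using assms by (intro hardy_coeff_eqI) simp
qed

lemma hardy_exists_coeff:
  fixes a :: "nat \<Rightarrow> 'a::complex_hilbert"
  assumes "square_summable a"
  shows "\<exists>h. hardy_coeff h = a"
proof
  show "hardy_coeff (Abs_hardy (\<lambda>z. if z \<in> ball 0 1 then \<Sum>n. z ^ n *\<^sub>C a n else 0)) = a"
  proof (rule hardy_coeff_Abs[OF assms])
    fix z :: complex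
    assume "z \<in> ball 0 1"
    then show "(\<lambda>n. z ^ n *\<^sub>C a n) sums (if z \<in> ball 0 1 then \<Sum>n. z ^ n *\<^sub>C a n else 0)"
      using summable_powser_square_summable[OF assms] by (simp add: summable_sums)
  qed simp
qed

lemma hardy_eqI: "hardy_coeff h = hardy_coeff g \<Longrightarrow> h = g"
proof -
  assume *: "hardy_coeff h = hardy_coeff g"
  have "hardy_fun h z = hardy_fun g z" for z
  proof (cases "z \<in> ball 0 1")
    case True
    show ?thesis
      using hardy_coeff_sums[OF True, of h] hardy_coeff_sums[OF True, of g]
      unfolding * by (rule sums_unique2)
  next
    case False
    then show ?thesis by (simp add: hardy_fun_outside)
  qed
  then show "h = g" by (metis ext hardy_fun_inject)
qed

instantiation hardy :: (complex_hilbert) complex_inner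
begin

definition zero_hardy :: "'a hardy" where "0 = Abs_hardy (\<lambda>z. 0)"
definition plus_hardy :: "'a hardy \<Rightarrow> 'a hardy \<Rightarrow> 'a hardy"
  where "h + g = Abs_hardy (\<lambda>z. hardy_fun h z + hardy_fun g z)"
definition scaleC_hardy :: "complex \<Rightarrow> 'a hardy \<Rightarrow> 'a hardy"
  where "c *\<^sub>C h = Abs_hardy (\<lambda>z. c *\<^sub>C hardy_fun h z)"
definition uminus_hardy :: "'a hardy \<Rightarrow> 'a hardy" where "- h = (-1) *\<^sub>C (h :: 'a hardy)"
definition minus_hardy :: "'a hardy \<Rightarrow> 'a hardy \<Rightarrow> 'a hardy" where "h - g = h + - (g :: 'a hardy)"
definition scaleR_hardy :: "real \<Rightarrow> 'a hardy \<Rightarrow> 'a hardy"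
  where "r *\<^sub>R h = complex_of_real r *\<^sub>C (h :: 'a hardy)"
definition cinner_hardy :: "'a hardy \<Rightarrow> 'a hardy \<Rightarrow> complex"
  where "cinner h g = (\<Sum>n. cinner (hardy_coeff h n) (hardy_coeff g n))"
definition norm_hardy :: "'a hardy \<Rightarrow> real"
  where "norm h = sqrt (\<Sum>n. (norm (hardy_coeff h n))\<^sup>2)"
definition dist_hardy :: "'a hardy \<Rightarrow> 'a hardy \<Rightarrow> real" where "dist h g = norm (h - g :: 'a hardy)"
definition sgn_hardy :: "'a hardy \<Rightarrow> 'a hardy" where "sgn h = inverse (norm h) *\<^sub>R (h :: 'a hardy)"
definition uniformity_hardy :: "('a hardy \<times> 'a hardy) filter"
  where "uniformity_hardy = (INF e\<in>{0 <..}. principal {(x, y). dist x y < e})"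
definition open_hardy :: "'a hardy set \<Rightarrow> bool"
  where "open_hardy U \<longleftrightarrow> (\<forall>x\<in>U. eventually (\<lambda>(x', y). x' = x \<longrightarrow> y \<in> U) uniformity)"

lemma hardy_coeff_zero: "hardy_coeff (0 :: 'a hardy) = (\<lambda>n. 0)"
  unfolding zero_hardy_def by (rule hardy_coeff_Abs) (simp_all add: square_summable_def)

lemma
  shows hardy_fun_add: "hardy_fun (h + g :: 'a hardy) = (\<lambda>z. hardy_fun h z + hardy_fun g z)"
    and hardy_coeff_add: "hardy_coeff (h + g :: 'a hardy) = (\<lambda>n. hardy_coeff h n + hardy_coeff g n)"
  unfolding plus_hardy_def
proof -
  have s: "square_summable (\<lambda>n. hardy_coeff h n + hardy_coeff g n)"
    by (intro square_summable_add square_summable_hardy_coeff)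
  have e: "(\<lambda>n. z ^ n *\<^sub>C (hardy_coeff h n + hardy_coeff g n)) sums (hardy_fun h z + hardy_fun g z)"
    if "z \<in> ball 0 1" for z
    unfolding scaleC_add_right using that by (intro sums_add hardy_coeff_sums)
  have o: "hardy_fun h z + hardy_fun g z = 0" if "z \<notin> ball 0 1" for z
    using that by (simp add: hardy_fun_outside)
  show "hardy_fun (Abs_hardy (\<lambda>z. hardy_fun h z + hardy_fun g z)) = (\<lambda>z. hardy_fun h z + hardy_fun g z)"
    by (rule hardy_fun_Abs[OF s e o])
  show "hardy_coeff (Abs_hardy (\<lambda>z. hardy_fun h z + hardy_fun g z))
      = (\<lambda>n. hardy_coeff h n + hardy_coeff g n)"
    by (rule hardy_coeff_Abs[OF s e o])
qed

lemma
  shows hardy_fun_scaleC: "hardy_fun (c *\<^sub>C h :: 'a hardy) = (\<lambda>z. c *\<^sub>C hardy_fun h z)"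
    and hardy_coeff_scaleC: "hardy_coeff (c *\<^sub>C h :: 'a hardy) = (\<lambda>n. c *\<^sub>C hardy_coeff h n)"
  unfolding scaleC_hardy_def
proof -
  have s: "square_summable (\<lambda>n. c *\<^sub>C hardy_coeff h n)"
    by (intro square_summable_scaleC square_summable_hardy_coeff)
  have e: "(\<lambda>n. z ^ n *\<^sub>C c *\<^sub>C hardy_coeff h n) sums (c *\<^sub>C hardy_fun h z)"
    if "z \<in> ball 0 1" for z
    using bounded_linear.sums[OF bounded_linear_scaleC hardy_coeff_sums[OF that, of h], of c]
    by (simp add: scaleC_scaleC mult.commute)
  have o: "c *\<^sub>C hardy_fun h z = 0" if "z \<notin> ball 0 1" for z
    using that by (simp add: hardy_fun_outside)
  show "hardy_fun (Abs_hardy (\<lambda>z. c *\<^sub>C hardy_fun h z)) = (\<lambda>z. c *\<^sub>C hardy_fun h z)"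
    by (rule hardy_fun_Abs[OF s e o])
  show "hardy_coeff (Abs_hardy (\<lambda>z. c *\<^sub>C hardy_fun h z)) = (\<lambda>n. c *\<^sub>C hardy_coeff h n)"
    by (rule hardy_coeff_Abs[OF s e o])
qed

lemma hardy_coeff_uminus: "hardy_coeff (- h :: 'a hardy) = (\<lambda>n. - hardy_coeff h n)"
proof -
  have "- 1 *\<^sub>C x = - x" for x :: 'a
    using scaleC_of_real[of "-1" x] by simp
  then show ?thesis by (simp add: uminus_hardy_def hardy_coeff_scaleC)
qed

lemma hardy_coeff_diff: "hardy_coeff (h - g :: 'a hardy) = (\<lambda>n. hardy_coeff h n - hardy_coeff g n)"
  by (simp add: minus_hardy_def hardy_coeff_add hardy_coeff_uminus)

lemma hardy_coeff_scaleR: "hardy_coeff (r *\<^sub>R h :: 'a hardy) = (\<lambda>n. r *\<^sub>R hardy_coeff h n)"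
  by (simp add: scaleR_hardy_def hardy_coeff_scaleC scaleR_scaleC)

lemma summable_hardy: "summable (\<lambda>n. (norm (hardy_coeff (h :: 'a hardy) n))\<^sup>2)"
  using square_summable_hardy_coeff[of h] by (simp add: square_summable_def)

lemma norm_hardy_power2: "(norm (h :: 'a hardy))\<^sup>2 = (\<Sum>n. (norm (hardy_coeff h n))\<^sup>2)"
  unfolding norm_hardy_def by (simp add: suminf_nonneg summable_hardy)

instance
proof
  fix h g k :: "'a hardy" and c d :: complex and r s :: real
  note co = hardy_coeff_add hardy_coeff_uminus hardy_coeff_zero hardy_coeff_diff
    hardy_coeff_scaleC hardy_coeff_scaleR
  show "h + g + k = h + (g + k)" "h + g = g + h" "0 + h = h" "- h + h = 0" "h - g = h + - g"
    by (rule hardy_eqI, simp add: co ac_simps)+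
  show "r *\<^sub>R (h + g) = r *\<^sub>R h + r *\<^sub>R g" "(r + s) *\<^sub>R h = r *\<^sub>R h + s *\<^sub>R h"
    "r *\<^sub>R s *\<^sub>R h = (r * s) *\<^sub>R h" "1 *\<^sub>R h = h"
    by (rule hardy_eqI, simp add: co scaleR_add_left scaleR_add_right)+
  show "c *\<^sub>C (h + g) = c *\<^sub>C h + c *\<^sub>C g" "(c + d) *\<^sub>C h = c *\<^sub>C h + d *\<^sub>C h"
    "c *\<^sub>C d *\<^sub>C h = (c * d) *\<^sub>C h" "r *\<^sub>R h = complex_of_real r *\<^sub>C h"
    by (rule hardy_eqI, simp add: co scaleC_add_left scaleC_add_right scaleC_scaleC scaleR_scaleC)+
  show "dist h g = norm (h - g)" by (rule dist_hardy_def)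
  show "sgn h = inverse (norm h) *\<^sub>R h" by (rule sgn_hardy_def)
  show "uniformity = (INF e\<in>{0<..}. principal {(x, y :: 'a hardy). dist x y < e})"
    by (rule uniformity_hardy_def)
  show "open U = (\<forall>x\<in>U. \<forall>\<^sub>F (x', y) in uniformity. x' = x \<longrightarrow> y \<in> U)" for U :: "'a hardy set"
    by (rule open_hardy_def)
  show "norm h = 0 \<longleftrightarrow> h = 0"
  proof
    assume "norm h = 0"
    then have "(\<Sum>n. (norm (hardy_coeff h n))\<^sup>2) = 0"
      using norm_hardy_power2[of h] by simp
    then have "hardy_coeff h n = 0" for n
      by (subst (asm) suminf_eq_zero_iff) (simp_all add: summable_hardy)
    then show "h = 0" by (intro hardy_eqI) (auto simp: hardy_coeff_zero)
  qed (simp add: norm_hardy_def hardy_coeff_zero)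
  have L2le: "L2_set (\<lambda>n. norm (hardy_coeff h n)) {..<N} \<le> norm h" for h :: "'a hardy" and N
    unfolding L2_set_def norm_hardy_def
    by (intro real_sqrt_le_mono sum_le_suminf summable_hardy) auto
  show "norm (h + g) \<le> norm h + norm g"
  proof -
    have "(\<Sum>n<N. (norm (hardy_coeff (h + g) n))\<^sup>2) \<le> (norm h + norm g)\<^sup>2" for N
    proof -
      have "L2_set (\<lambda>n. norm (hardy_coeff (h + g) n)) {..<N}
          \<le> L2_set (\<lambda>n. norm (hardy_coeff h n) + norm (hardy_coeff g n)) {..<N}"
        by (rule L2_set_mono) (simp_all add: hardy_coeff_add norm_triangle_ineq)
      also have "\<dots> \<le> L2_set (\<lambda>n. norm (hardy_coeff h n)) {..<N} + L2_set (\<lambda>n. norm (hardy_coeff g n)) {..<N}"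
        by (rule L2_set_triangle_ineq)
      also have "\<dots> \<le> norm h + norm g" by (intro add_mono L2le)
      finally have "(L2_set (\<lambda>n. norm (hardy_coeff (h + g) n)) {..<N})\<^sup>2 \<le> (norm h + norm g)\<^sup>2"
        by (intro power_mono) auto
      then show ?thesis by (simp add: L2_set_def sum_nonneg)
    qed
    then have "(norm (h + g))\<^sup>2 \<le> (norm h + norm g)\<^sup>2"
      unfolding norm_hardy_power2[of "h + g"] by (intro suminf_le_const summable_hardy)
    then show ?thesis
      by (rule power2_le_imp_le)
         (simp add: norm_hardy_def suminf_nonneg summable_hardy)
  qed
  show nC: "norm (c *\<^sub>C h) = cmod c * norm h" for c and h :: "'a hardy"
    by (simp add: norm_hardy_def hardy_coeff_scaleC norm_scaleC power_mult_distrib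
        suminf_mult summable_hardy real_sqrt_mult)
  show "norm (r *\<^sub>R h) = \<bar>r\<bar> * norm h"
    by (simp add: scaleR_hardy_def nC)
  note sc = square_summable_cinner[OF square_summable_hardy_coeff square_summable_hardy_coeff]
  show "cinner (h + g) k = cinner h k + cinner g k"
    by (simp add: cinner_hardy_def hardy_coeff_add cinner_add_left suminf_add sc)
  show "cinner (c *\<^sub>C h) g = c * cinner h g"
    by (simp add: cinner_hardy_def hardy_coeff_scaleC cinner_scaleC_left suminf_mult sc)
  have "(\<lambda>n. cnj (cinner (hardy_coeff g n) (hardy_coeff h n))) sums cnj (cinner g h)"
    unfolding cinner_hardy_def sums_cnj by (intro summable_sums sc)
  moreover have "(\<lambda>n. cnj (cinner (hardy_coeff g n) (hardy_coeff h n)))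
      = (\<lambda>n. cinner (hardy_coeff h n) (hardy_coeff g n))"
    by (metis cinner_commute)
  ultimately show "cinner h g = cnj (cinner g h)"
    by (simp add: cinner_hardy_def sums_unique[symmetric])
  show "cinner h h = complex_of_real ((norm h)\<^sup>2)"
    unfolding norm_hardy_power2
    by (simp only: cinner_hardy_def cinner_self suminf_of_real[OF summable_hardy])
qed

end

instance hardy :: (complex_hilbert) complex_hilbert
proof
  fix X :: "nat \<Rightarrow> 'a hardy"
  assume C: "Cauchy X"
  have part: "(\<Sum>n<N. (norm (hardy_coeff h n))\<^sup>2) \<le> (norm h)\<^sup>2" for h :: "'a hardy" and N
    unfolding norm_hardy_power2 by (intro sum_le_suminf summable_hardy) auto
  have coeff_le: "norm (hardy_coeff h n) \<le> norm h" for h :: "'a hardy" and n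
  proof (rule power2_le_imp_le)
    have "(norm (hardy_coeff h n))\<^sup>2 \<le> (\<Sum>k<Suc n. (norm (hardy_coeff h k))\<^sup>2)"
      by (simp add: sum_nonneg)
    also have "\<dots> \<le> (norm h)\<^sup>2" by (rule part)
    finally show "(norm (hardy_coeff h n))\<^sup>2 \<le> (norm h)\<^sup>2" .
  qed simp
  have "convergent (\<lambda>k. hardy_coeff (X k) n)" for n
  proof (rule Cauchy_convergent, rule CauchyI)
    fix e :: real assume "0 < e"
    then obtain M where "\<forall>i\<ge>M. \<forall>j\<ge>M. norm (X i - X j) < e" using C CauchyD by blast
    then show "\<exists>M. \<forall>i\<ge>M. \<forall>j\<ge>M. norm (hardy_coeff (X i) n - hardy_coeff (X j) n) < e"
      using coeff_le[of "X _ - X _" n] by (metis hardy_coeff_diff order_le_less_trans)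
  qed
  then obtain a where a: "\<And>n. (\<lambda>k. hardy_coeff (X k) n) \<longlonglongrightarrow> a n"
    unfolding convergent_def by metis
  have fin: "(\<Sum>n<N. (norm (hardy_coeff (X i) n - a n))\<^sup>2) \<le> e\<^sup>2"
    if "0 < e" and M: "\<forall>i\<ge>M. \<forall>j\<ge>M. norm (X i - X j) < e" and "i \<ge> M" for e M i N
  proof (rule LIMSEQ_le_const2)
    show "(\<lambda>j. \<Sum>n<N. (norm (hardy_coeff (X i) n - hardy_coeff (X j) n))\<^sup>2)
        \<longlonglongrightarrow> (\<Sum>n<N. (norm (hardy_coeff (X i) n - a n))\<^sup>2)"
      by (intro tendsto_intros a)
    show "\<exists>M. \<forall>j\<ge>M. (\<Sum>n<N. (norm (hardy_coeff (X i) n - hardy_coeff (X j) n))\<^sup>2) \<le> e\<^sup>2"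
    proof (intro exI[of _ M] allI impI)
      fix j assume "M \<le> j"
      have "(\<Sum>n<N. (norm (hardy_coeff (X i) n - hardy_coeff (X j) n))\<^sup>2) \<le> (norm (X i - X j))\<^sup>2"
        using part[of "X i - X j" N] by (simp add: hardy_coeff_diff)
      also have "\<dots> \<le> e\<^sup>2"
        using M \<open>M \<le> j\<close> \<open>i \<ge> M\<close> by (intro power_mono) (auto intro: less_imp_le)
      finally show "(\<Sum>n<N. (norm (hardy_coeff (X i) n - hardy_coeff (X j) n))\<^sup>2) \<le> e\<^sup>2" .
    qed
  qed
  have ss: "square_summable (\<lambda>n. a n - hardy_coeff (X i) n)"
    if "0 < e" "\<forall>i\<ge>M. \<forall>j\<ge>M. norm (X i - X j) < e" "i \<ge> M" for e M i
    unfolding square_summable_def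
  proof (rule summableI_nonneg_bounded)
    show "(\<Sum>n<N. (norm (a n - hardy_coeff (X i) n))\<^sup>2) \<le> e\<^sup>2" for N
      using fin[OF that, of N] by (simp add: norm_minus_commute)
  qed simp
  obtain M1 where M1: "\<forall>i\<ge>M1. \<forall>j\<ge>M1. norm (X i - X j) < 1"
    using C CauchyD zero_less_one by blast
  have "square_summable (\<lambda>n. (a n - hardy_coeff (X M1) n) + hardy_coeff (X M1) n)"
    by (intro square_summable_add ss[OF zero_less_one M1] square_summable_hardy_coeff) simp
  then have "square_summable a" by simp
  then obtain h where h: "hardy_coeff h = a" using hardy_exists_coeff by blast
  have "X \<longlonglongrightarrow> h"
  proof (rule LIMSEQ_I)
    fix r :: real assume "0 < r"
    then have r2: "0 < r / 2" by simp
    then obtain M where M: "\<forall>i\<ge>M. \<forall>j\<ge>M. norm (X i - X j) < r / 2" using C CauchyD by blast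
    show "\<exists>M. \<forall>i\<ge>M. norm (X i - h) < r"
    proof (intro exI[of _ M] allI impI)
      fix i assume "M \<le> i"
      have "(norm (X i - h))\<^sup>2 \<le> (r / 2)\<^sup>2"
        unfolding norm_hardy_power2
      proof (rule suminf_le_const[OF summable_hardy])
        show "(\<Sum>n<N. (norm (hardy_coeff (X i - h) n))\<^sup>2) \<le> (r / 2)\<^sup>2" for N
          using fin[OF r2 M \<open>M \<le> i\<close>, of N] by (simp only: hardy_coeff_diff h)
      qed
      then have "norm (X i - h) \<le> r / 2" by (rule power2_le_imp_le) (use r2 in simp)
      then show "norm (X i - h) < r" using \<open>0 < r\<close> by simp
    qed
  qed
  then show "convergent X" by (auto simp: convergent_def)
qed


section \<open>The Schur class and the Redheffer map\<close>

definition analytic_on_disc :: "(complex \<Rightarrow> 'a::complex_normed_vector) \<Rightarrow> bool"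
  where "analytic_on_disc F \<longleftrightarrow>
    (\<forall>z\<in>ball 0 1. \<exists>D. (F has_derivative (\<lambda>h. h *\<^sub>C D)) (at z))"

text \<open>Schur functions are total functions on the complex plane whose values outside the disc
  are irrelevant.\<close>

definition schur :: "(complex \<Rightarrow> 'a::complex_hilbert \<Rightarrow>\<^sub>L 'b::complex_hilbert) set"
  where "schur = {F. analytic_on_disc F \<and> (\<forall>z\<in>ball 0 1. contraction (F z))}"

definition disc_norm :: "(complex \<Rightarrow> 'a::complex_hilbert \<Rightarrow>\<^sub>L 'b::complex_hilbert) \<Rightarrow> real"
  where "disc_norm F = (SUP z\<in>ball 0 1. norm (F z))"

definition mult_op ::
    "(complex \<Rightarrow> 'a::complex_hilbert \<Rightarrow>\<^sub>L 'b::complex_hilbert) \<Rightarrow> 'a hardy \<Rightarrow>\<^sub>L 'b hardy"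
  where "mult_op F =
    Blinfun (\<lambda>h. Abs_hardy (\<lambda>z. if z \<in> ball 0 1 then F z (hardy_fun h z) else 0))"

definition prec_schur ::
    "(complex \<Rightarrow> 'a::complex_hilbert \<Rightarrow>\<^sub>L 'b::complex_hilbert) \<Rightarrow> (complex \<Rightarrow> 'a \<Rightarrow>\<^sub>L 'b) \<Rightarrow> bool"
    (infix \<open>\<prec>\<^sub>\<infinity>\<close> 50)
  where "F \<prec>\<^sub>\<infinity> G \<longleftrightarrow> F \<in> schur \<and> G \<in> schur \<and> mult_op F \<prec> mult_op G"

lift_definition incl1 :: "'a::complex_hilbert \<Rightarrow>\<^sub>L ('a \<times> 'b::complex_hilbert)"
  is "\<lambda>x. (x, 0)"
  by (intro bounded_linear_Pair bounded_linear_ident bounded_linear_zero)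

lift_definition incl2 :: "'b::complex_hilbert \<Rightarrow>\<^sub>L ('a::complex_hilbert \<times> 'b)"
  is "\<lambda>y. (0, y)"
  by (intro bounded_linear_Pair bounded_linear_ident bounded_linear_zero)

context
  fixes \<Phi> :: "complex \<Rightarrow> ('f::complex_hilbert \<times> 'u::complex_hilbert)
                \<Rightarrow>\<^sub>L ('e::complex_hilbert \<times> 'y::complex_hilbert)"
begin

definition blk11 :: "complex \<Rightarrow> 'f \<Rightarrow>\<^sub>L 'e" where "blk11 z = fst_blinfun o\<^sub>L \<Phi> z o\<^sub>L incl1"
definition blk12 :: "complex \<Rightarrow> 'u \<Rightarrow>\<^sub>L 'e" where "blk12 z = fst_blinfun o\<^sub>L \<Phi> z o\<^sub>L incl2"
definition blk21 :: "complex \<Rightarrow> 'f \<Rightarrow>\<^sub>L 'y" where "blk21 z = snd_blinfun o\<^sub>L \<Phi> z o\<^sub>L incl1"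
definition blk22 :: "complex \<Rightarrow> 'u \<Rightarrow>\<^sub>L 'y" where "blk22 z = snd_blinfun o\<^sub>L \<Phi> z o\<^sub>L incl2"

definition redheffer :: "(complex \<Rightarrow> 'e \<Rightarrow>\<^sub>L 'f) \<Rightarrow> complex \<Rightarrow> 'u \<Rightarrow>\<^sub>L 'y"
  where "redheffer F z = blk22 z +
    (blk21 z o\<^sub>L F z o\<^sub>L inverse_op (id_blinfun - (blk11 z o\<^sub>L F z)) o\<^sub>L blk12 z)"

definition boundedly_invertible :: "(complex \<Rightarrow> 'e \<Rightarrow>\<^sub>L 'f) \<Rightarrow> bool"
  where "boundedly_invertible F \<longleftrightarrow>
    (\<forall>z\<in>ball 0 1. invertible_op (id_blinfun - (blk11 z o\<^sub>L F z))) \<and>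
    bdd_above ((\<lambda>z. norm (inverse_op (id_blinfun - (blk11 z o\<^sub>L F z)))) ` ball 0 1)"

end

end

theory Submission
  imports Defs
begin

text \<open>
  By the definition of the Redheffer map, \<open>\<RR>\<^sub>\<Phi>[F]\<close> is a closed feedback loop: for an input \<open>u\<close>, the
  internal signal \<open>a\<close> with \<open>\<Phi> (F a, u) = (a, a')\<close> produces the output \<open>a' = \<RR>\<^sub>\<Phi>[F] u\<close>. The proof
  works with this relation for the multiplication operators \<open>A\<close>, \<open>B\<close> of \<open>F\<close>, \<open>G\<close> on the Hardy space
  and a contraction \<open>P\<close>, the multiplication operator of \<open>\<Phi>\<close>, instead of with formulas for the
  inverses.

  Two facts carry the argument. First, \<open>A \<prec> B\<close> is equivalent to an estimate
  \<open>|\<langle>(A - B) x, y\<rangle>| \<le> M \<parallel>D\<^sub>B x\<parallel> \<parallel>D\<^bsub>B\<^sup>*\<^esub> y\<parallel>\<close> (lemma \<open>prec_op_iff_form_bound\<close>), in which the square roots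
  only enter through \<open>\<parallel>D\<^sub>B x\<parallel>\<^sup>2 = \<parallel>x\<parallel>\<^sup>2 - \<parallel>B x\<parallel>\<^sup>2\<close>. Second, let \<open>P (A a, u) = (a, A' u)\<close>,
  \<open>P (B x, u) = (x, B' u)\<close> and \<open>P\<^sup>* (B\<^sup>* w, v) = (w, B'\<^sup>* v)\<close>. Evaluating \<open>\<langle>P (A a, u), (B\<^sup>* w, v)\<rangle>\<close> on
  both sides gives \<open>\<langle>(A' - B') u, v\<rangle> = \<langle>(A - B) a, w\<rangle>\<close>, and since \<open>P\<close> is a contraction,
  \<open>\<parallel>D\<^sub>B x\<parallel> \<le> \<parallel>D\<^bsub>B'\<^esub> u\<parallel>\<close> and \<open>\<parallel>D\<^bsub>B\<^sup>*\<^esub> w\<parallel> \<le> \<parallel>D\<^bsub>B'\<^sup>*\<^esub> v\<parallel>\<close>. The difference \<open>a - x\<close> solves the loop equation of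
  \<open>A\<close> with right-hand side \<open>P\<^sub>1\<^sub>1 (A - B) x\<close>, so bounded invertibility of \<open>I - P\<^sub>1\<^sub>1 A\<close> bounds it by
  a multiple of \<open>\<parallel>D\<^sub>B x\<parallel>\<close>. Together these give the estimate for \<open>A' \<prec> B'\<close> (lemma
  \<open>prec_op_feedback\<close>).

  The signals \<open>x\<close> and \<open>w\<close> must exist in the Hardy space, while bounded invertibility is given for
  \<open>F\<close> only. This is what \<open>prec_op_loop_solvable\<close> provides: a unit vector almost fixed by
  \<open>P\<^sub>1\<^sub>1 B\<close> has a small defect \<open>D\<^sub>B x\<close>, hence is almost fixed by \<open>P\<^sub>1\<^sub>1 A\<close>, which is impossible. Thus
  \<open>I - P\<^sub>1\<^sub>1 B\<close>, and likewise its adjoint, is boundedly invertible.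

  Returning to functions takes two results. A bounded analytic operator function multiplies the Hardy
  space into itself with the expected norm bound (\<open>hardy_multiplication\<close>), which is Parseval's identity
  on circles, here in a discrete form. A contractive analytic function that is strict at the origin is
  strict everywhere (\<open>schur_norm_less_one\<close>, from the Schwarz-Pick inequality), so that
  \<open>I - \<Phi>\<^sub>1\<^sub>1(\<lambda>) G(\<lambda>)\<close> is invertible and the loop in the Hardy space is pointwise the Redheffer map.
\<close>

section \<open>Bounded operators on complex Hilbert spaces\<close>

lemma cinner_zero_right [simp]: "cinner x 0 = 0" for x :: "'a::complex_inner"
  using cinner_diff_right[of x 0 0] by simp

lemma cinner_scaleR_left: "cinner (r *\<^sub>R x) y = of_real r * cinner x y" for x :: "'a::complex_inner"
  by (simp add: scaleR_scaleC cinner_scaleC_left)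

lemma cinner_scaleR_right: "cinner x (r *\<^sub>R y) = of_real r * cinner x y" for x :: "'a::complex_inner"
  by (simp add: scaleR_scaleC cinner_scaleC_right)

lemma cinner_minus_right: "cinner x (- y) = - cinner x y" for x :: "'a::complex_inner"
  using cinner_diff_right[of x 0 y] by simp

lemma Re_cinner_self: "Re (cinner x x) = (norm x)\<^sup>2" for x :: "'a::complex_inner"
  by (simp add: cinner_self)

lemma Re_cinner_commute: "Re (cinner x y) = Re (cinner y x)" for x :: "'a::complex_inner"
  by (subst cinner_commute) simp

lemma norm_add_power2: "(norm (x + y))\<^sup>2 = (norm x)\<^sup>2 + (norm y)\<^sup>2 + 2 * Re (cinner x y)"
  for x y :: "'a::complex_inner"
  using Re_cinner_commute[of x y]
  by (simp add: Re_cinner_self[symmetric] cinner_add_left cinner_add_right)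

lemma cinner_ext_left:
  fixes x x' :: "'a::complex_inner"
  assumes "\<And>y. cinner x y = cinner x' y"
  shows "x = x'"
proof -
  have "cinner (x - x') (x - x') = 0" by (simp add: cinner_diff_left assms)
  then show ?thesis by (simp add: cinner_self)
qed

lemma cinner_ext_right:
  fixes y y' :: "'a::complex_inner"
  assumes "\<And>x. cinner x y = cinner x y'"
  shows "y = y'"
  by (rule cinner_ext_left) (metis assms cinner_commute)

lemma bounded_linear_cinner_right: "bounded_linear (\<lambda>y::'a::complex_inner. cinner x y)"
proof (rule bounded_linear_intro[where K = "norm x"])
  show "norm (cinner x y) \<le> norm y * norm x" for y
    using cinner_cauchy_schwarz[of x y] by (simp add: mult.commute)
qed (simp_all add: cinner_add_right cinner_scaleR_right scaleR_conv_of_real)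

lemma clinear_opD: "clinear_op T \<Longrightarrow> T (c *\<^sub>C x) = c *\<^sub>C T x"
  for T :: "'a::complex_normed_vector \<Rightarrow>\<^sub>L 'b::complex_normed_vector"
  by (simp add: clinear_op_def)

lemma clinear_op_id [simp]: "clinear_op (id_blinfun :: 'a::complex_normed_vector \<Rightarrow>\<^sub>L 'a)"
  by (simp add: clinear_op_def)

lemma clinear_op_compose: "clinear_op S \<Longrightarrow> clinear_op T \<Longrightarrow> clinear_op (S o\<^sub>L T)"
  by (simp add: clinear_op_def)

lemma clinear_op_diff: "clinear_op S \<Longrightarrow> clinear_op T \<Longrightarrow> clinear_op (S - T)"
  by (simp add: clinear_op_def minus_blinfun.rep_eq scaleC_diff_right)

lemma clinear_op_add: "clinear_op S \<Longrightarrow> clinear_op T \<Longrightarrow> clinear_op (S + T)"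
  by (simp add: clinear_op_def plus_blinfun.rep_eq scaleC_add_right)

lemma quadratic_nonneg_imp_zero:
  fixes a b :: real
  assumes "\<And>t. 0 \<le> t\<^sup>2 * a + 2 * t * b"
  shows "b = 0"
proof (rule ccontr)
  assume b: "b \<noteq> 0"
  define s where "s = \<bar>a\<bar> + 1"
  have s: "s > 0" "a \<le> s" by (auto simp: s_def)
  have "0 \<le> (- b / s)\<^sup>2 * a + 2 * (- b / s) * b" by (rule assms)
  also have "\<dots> \<le> (- b / s)\<^sup>2 * s + 2 * (- b / s) * b"
    using s by (intro add_right_mono mult_left_mono) auto
  also have "\<dots> = - (b\<^sup>2 / s)" using s by (simp add: field_simps power2_eq_square)
  also have "\<dots> < 0" using b s by simp
  finally show False by simp
qed

text \<open>A form of the Riesz representation theorem adapted to factorizations: the functional only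
  has to be bounded by \<open>\<parallel>D h\<parallel>\<close>, so it lives on the range of \<open>D\<close>, and the representing vector
  is found in the closure of that range. The vectors \<open>D h\<close> along a minimizing sequence of
  \<open>\<parallel>D h\<parallel>\<^sup>2 - 2 Re (l h)\<close> form a Cauchy sequence by the parallelogram law, and its limit
  represents \<open>l\<close>.\<close>

lemma representing_vector:
  fixes D :: "'h::complex_normed_vector \<Rightarrow>\<^sub>L 'k::complex_hilbert" and l :: "'h \<Rightarrow> complex"
  assumes cl: "clinear_op D"
    and add: "\<And>h k. l (h + k) = l h + l k" and scale: "\<And>c h. l (c *\<^sub>C h) = c * l h"
    and bound: "\<And>h. cmod (l h) \<le> C * norm (D h)" and "0 \<le> C"
  shows "\<exists>w\<in>closure (range D). (\<forall>h. l h = cinner (D h) w) \<and> norm w \<le> C"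
proof -
  define J where "J h = (norm (D h))\<^sup>2 - 2 * Re (l h)" for h
  have lR: "l (t *\<^sub>R h) = of_real t * l h" for t h by (simp add: scaleR_scaleC scale)
  have bdd: "- C\<^sup>2 \<le> J h" for h
  proof -
    have "Re (l h) \<le> C * norm (D h)" using bound[of h] complex_Re_le_cmod order_trans by blast
    moreover have "0 \<le> (norm (D h) - C)\<^sup>2" by simp
    ultimately show ?thesis by (simp add: J_def power2_eq_square algebra_simps)
  qed
  have B: "bdd_below (range J)" using bdd by (intro bdd_belowI[of _ "- C\<^sup>2"]) auto
  define m where "m = Inf (range J)"
  have m: "m \<le> J h" for h unfolding m_def by (rule cInf_lower[OF _ B]) simp
  have "\<exists>h. J h < m + 1 / real (Suc n)" for n
  proof -
    have "Inf (range J) < m + 1 / real (Suc n)" by (simp add: m_def)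
    from cInf_lessD[OF _ this] show ?thesis by auto
  qed
  then obtain s where s: "\<And>n. J (s n) < m + 1 / real (Suc n)" by metis
  have par: "(norm (D h - D k))\<^sup>2 = 2 * J h + 2 * J k - 4 * J ((1/2) *\<^sub>R (h + k))" for h k
  proof -
    have "(norm (D h - D k))\<^sup>2 + (norm (D h + D k))\<^sup>2 = 2 * (norm (D h))\<^sup>2 + 2 * (norm (D k))\<^sup>2"
      using norm_add_power2[of "D h" "D k"] norm_add_power2[of "D h" "- D k"]
      by (simp add: cinner_minus_right)
    moreover have "4 * J ((1/2) *\<^sub>R (h + k)) = (norm (D h + D k))\<^sup>2 - 4 * Re (l h) - 4 * Re (l k)"
      by (simp add: J_def lR add blinfun.scaleR_right blinfun.add_right power_divide add_divide_distrib)
    ultimately show ?thesis by (simp add: J_def)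
  qed
  have sJ: "(\<lambda>n. J (s n)) \<longlonglongrightarrow> m"
  proof (rule tendsto_sandwich[where f = "\<lambda>_. m" and h = "\<lambda>n. m + 1 / real (Suc n)"])
    show "(\<lambda>n. m + 1 / real (Suc n)) \<longlonglongrightarrow> m"
      using tendsto_add[OF tendsto_const[of m] LIMSEQ_inverse_real_of_nat]
      by (simp add: inverse_eq_divide)
  qed (use m s in \<open>auto intro!: always_eventually less_imp_le\<close>)
  have "Cauchy (\<lambda>n. D (s n))"
  proof (rule metric_CauchyI)
    fix e :: real assume e: "0 < e"
    have "\<forall>\<^sub>F n in sequentially. J (s n) < m + e\<^sup>2 / 4"
      using order_tendstoD(2)[OF sJ, of "m + e\<^sup>2 / 4"] e by simp
    then obtain N where N: "\<And>n. n \<ge> N \<Longrightarrow> J (s n) < m + e\<^sup>2 / 4"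
      by (auto simp: eventually_sequentially)
    have "dist (D (s i)) (D (s j)) < e" if "i \<ge> N" "j \<ge> N" for i j
    proof -
      have "(norm (D (s i) - D (s j)))\<^sup>2 < e\<^sup>2"
        using par[of "s i" "s j"] N[OF that(1)] N[OF that(2)] m[of "(1/2) *\<^sub>R (s i + s j)"] by linarith
      then show ?thesis using e by (simp add: dist_norm power2_less_imp_less)
    qed
    then show "\<exists>M. \<forall>i\<ge>M. \<forall>j\<ge>M. dist (D (s i)) (D (s j)) < e" by blast
  qed
  then obtain w where w: "(\<lambda>n. D (s n)) \<longlonglongrightarrow> w"
    using Cauchy_convergent convergent_def by blast
  have wc: "w \<in> closure (range D)"
    unfolding closure_sequential by (intro exI[of _ "\<lambda>n. D (s n)"] conjI allI rangeI w)
  have cont: "(\<lambda>n. cinner (D h) (D (s n))) \<longlonglongrightarrow> cinner (D h) w" for h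
    by (rule bounded_linear.tendsto[OF bounded_linear_cinner_right w])
  have re: "Re (cinner (D h) w) = Re (l h)" for h
  proof -
    have "Re (cinner (D h) w) - Re (l h) = 0"
    proof (rule quadratic_nonneg_imp_zero)
      fix t :: real
      have eq: "J (s n + t *\<^sub>R h) = J (s n) + 2 * t * Re (cinner (D h) (D (s n)))
          + t\<^sup>2 * (norm (D h))\<^sup>2 - 2 * t * Re (l h)" for n
        using norm_add_power2[of "D (s n)" "t *\<^sub>R D h"] Re_cinner_commute[of "D (s n)" "D h"]
        by (simp add: J_def blinfun.scaleR_right blinfun.add_right add lR cinner_scaleR_right
            power_mult_distrib)
      have "(\<lambda>n. J (s n) + 2 * t * Re (cinner (D h) (D (s n))) + t\<^sup>2 * (norm (D h))\<^sup>2 - 2 * t * Re (l h))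
          \<longlonglongrightarrow> m + 2 * t * Re (cinner (D h) w) + t\<^sup>2 * (norm (D h))\<^sup>2 - 2 * t * Re (l h)"
        by (intro tendsto_intros sJ cont)
      then have "m \<le> m + 2 * t * Re (cinner (D h) w) + t\<^sup>2 * (norm (D h))\<^sup>2 - 2 * t * Re (l h)"
        by (rule LIMSEQ_le_const) (metis eq m)
      then show "0 \<le> t\<^sup>2 * (norm (D h))\<^sup>2 + 2 * t * (Re (cinner (D h) w) - Re (l h))"
        by (simp add: algebra_simps)
    qed
    then show ?thesis by simp
  qed
  have rep: "l h = cinner (D h) w" for h
  proof (rule complex_eqI)
    show "Re (l h) = Re (cinner (D h) w)" by (simp add: re)
    show "Im (l h) = Im (cinner (D h) w)"
      using re[of "\<i> *\<^sub>C h"] by (simp add: clinear_opD[OF cl] cinner_scaleC_left scale)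
  qed
  have "norm w \<le> C"
  proof (cases "w = 0")
    case False
    have "(\<lambda>n. C * norm (D (s n)) - cmod (cinner (D (s n)) w)) \<longlonglongrightarrow> C * norm w - cmod (cinner w w)"
      by (intro tendsto_intros w bounded_linear.tendsto[OF bounded_linear_cinner_left w])
    then have "0 \<le> C * norm w - cmod (cinner w w)"
      by (rule LIMSEQ_le_const) (use bound rep in auto)
    then have "norm w * norm w \<le> C * norm w" by (simp add: cinner_self norm_power power2_eq_square norm_mult)
    then show ?thesis using False by simp
  next
    case True
    then show ?thesis using \<open>0 \<le> C\<close> by simp
  qed
  then show ?thesis using rep wc by blast
qed


text \<open>Consequently a sesquilinear form \<open>\<langle>E h, g\<rangle>\<close> that is dominated by \<open>\<parallel>D h\<parallel>\<close> factors through
  \<open>D\<close>: there is a bounded \<open>W\<close> with \<open>E\<^sup>* = D\<^sup>* W\<close>. This contains the existence of adjoints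
  (\<open>D\<close> the identity), right inverses (\<open>E\<close> the identity) and Douglas factorization. The bound
  \<open>c g\<close> is kept as a function of \<open>g\<close> so that the lemma can be applied a second time to \<open>W\<close>.\<close>

lemma form_factorization:
  fixes E :: "'h::complex_normed_vector \<Rightarrow>\<^sub>L 'l::complex_inner" and D :: "'h \<Rightarrow>\<^sub>L 'k::complex_hilbert"
  assumes E: "clinear_op E" and D: "clinear_op D"
    and bound: "\<And>h g. cmod (cinner (E h) g) \<le> c g * norm (D h)"
    and c: "\<And>g. 0 \<le> c g" "\<And>g. c g \<le> K * norm g"
  obtains W :: "'l \<Rightarrow>\<^sub>L 'k" where "clinear_op W" "\<And>h g. cinner (E h) g = cinner (D h) (W g)"
    "\<And>g. W g \<in> closure (range D)" "\<And>g. norm (W g) \<le> c g"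
proof -
  have "\<exists>w\<in>closure (range D). (\<forall>h. cinner (E h) g = cinner (D h) w) \<and> norm w \<le> c g" for g
    by (rule representing_vector[OF D])
       (use bound c in \<open>simp_all add: blinfun.add_right cinner_add_left clinear_opD[OF E]
         cinner_scaleC_left\<close>)
  then obtain w where w: "\<And>g. w g \<in> closure (range D)" "\<And>h g. cinner (E h) g = cinner (D h) (w g)"
    "\<And>g. norm (w g) \<le> c g" by metis
  have orth: "cinner d u = 0" if u: "\<And>h. cinner (D h) u = 0" and d: "d \<in> closure (range D)" for d u
  proof -
    obtain s where s: "\<And>n. s n \<in> range D" "s \<longlonglongrightarrow> d" using d closure_sequential by blast
    have "(\<lambda>n. cinner (s n) u) \<longlonglongrightarrow> cinner d u"
      by (rule bounded_linear.tendsto[OF bounded_linear_cinner_left s(2)])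
    moreover have "cinner (s n) u = 0" for n using s(1)[of n] u by auto
    ultimately show ?thesis by (simp add: LIMSEQ_const_iff)
  qed
  have wadd: "w (g + g') = w g + w g'" for g g'
  proof -
    let ?u = "w (g + g') - (w g + w g')"
    have "cinner (D h) ?u = 0" for h
      by (simp add: cinner_diff_right cinner_add_right flip: w(2))
    from orth[OF this w(1)] have "cinner ?u ?u = 0"
      by (simp add: cinner_diff_left cinner_add_left)
    then show ?thesis by (simp add: cinner_self)
  qed
  have wsc: "w (a *\<^sub>C g) = a *\<^sub>C w g" for a g
  proof -
    let ?u = "w (a *\<^sub>C g) - a *\<^sub>C w g"
    have "cinner (D h) ?u = 0" for h
      by (simp add: cinner_diff_right cinner_scaleC_right flip: w(2))
    from orth[OF this w(1)] have "cinner ?u ?u = 0"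
      by (simp add: cinner_diff_left cinner_scaleC_left)
    then show ?thesis by (simp add: cinner_self)
  qed
  have "bounded_linear w"
  proof (rule bounded_linear_intro[where K = K])
    show "norm (w g) \<le> norm g * K" for g using w(3) c(2) by (metis mult.commute order_trans)
  qed (simp_all add: wadd wsc scaleR_scaleC)
  then have "blinfun_apply (Blinfun w) = w" by (rule bounded_linear_Blinfun_apply)
  with w wsc show ?thesis by (intro that[of "Blinfun w"]) (simp_all add: clinear_op_def)
qed

lemma cadj_eqI:
  fixes T :: "'a::complex_hilbert \<Rightarrow>\<^sub>L 'b::complex_hilbert" and S :: "'b \<Rightarrow>\<^sub>L 'a"
  assumes "\<And>x y. cinner (T x) y = cinner x (S y)"
  shows "cadj T = S"
  unfolding cadj_def
proof (rule the_equality)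
  fix S' assume "\<forall>x y. cinner (T x) y = cinner x (blinfun_apply S' y)"
  then have "blinfun_apply S' y = blinfun_apply S y" for y
    by (intro cinner_ext_right) (simp flip: assms)
  then show "S' = S" by (rule blinfun_eqI)
qed (use assms in blast)

lemma
  fixes T :: "'a::complex_hilbert \<Rightarrow>\<^sub>L 'b::complex_hilbert"
  assumes T: "clinear_op T"
  shows cinner_cadj: "cinner (T x) y = cinner x (cadj T y)"
    and clinear_cadj: "clinear_op (cadj T)"
proof -
  have "cmod (cinner (T h) g) \<le> (norm T * norm g) * norm (id_blinfun h)" for h g
  proof -
    have "cmod (cinner (T h) g) \<le> norm (T h) * norm g" by (rule cinner_cauchy_schwarz)
    also have "\<dots> \<le> (norm T * norm h) * norm g" by (intro mult_right_mono norm_blinfun) simp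
    finally show ?thesis by (simp add: mult_ac)
  qed
  from form_factorization[OF T clinear_op_id this, of "norm T"]
  obtain W where W: "clinear_op W" "\<And>h g. cinner (T h) g = cinner h (W g)"
    by (metis blinfun_apply_id_blinfun id_apply mult_nonneg_nonneg norm_ge_zero order_refl)
  then have "cadj T = W" by (intro cadj_eqI)
  then show "cinner (T x) y = cinner x (cadj T y)" "clinear_op (cadj T)" using W by simp_all
qed

lemma cinner_cadj': "clinear_op T \<Longrightarrow> cinner y (T x) = cinner (cadj T y) x"
  for T :: "'a::complex_hilbert \<Rightarrow>\<^sub>L 'b::complex_hilbert"
  by (metis cinner_cadj cinner_commute)

lemma cadj_cadj: "clinear_op T \<Longrightarrow> cadj (cadj T) = T"
  by (rule cadj_eqI) (simp add: cinner_cadj')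

lemma norm_cadj_le:
  assumes T: "clinear_op T"
  shows "norm (cadj T) \<le> norm T"
proof (rule norm_blinfun_bound)
  fix y
  have "(norm (cadj T y))\<^sup>2 = cmod (cinner (cadj T y) (cadj T y))"
    by (simp add: cinner_self norm_power)
  also have "\<dots> = cmod (cinner y (T (cadj T y)))" by (simp add: cinner_cadj'[OF T])
  also have "\<dots> \<le> norm y * norm (T (cadj T y))" by (rule cinner_cauchy_schwarz)
  also have "\<dots> \<le> norm y * (norm T * norm (cadj T y))" by (intro mult_left_mono norm_blinfun) simp
  finally show "norm (cadj T y) \<le> norm T * norm y"
    by (cases "cadj T y = 0") (auto simp: power2_eq_square mult_ac)
qed simp

lemma contraction_clinear: "contraction C \<Longrightarrow> clinear_op C"
  by (simp add: contraction_def)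

lemma contraction_norm_le:
  fixes C :: "'a::complex_hilbert \<Rightarrow>\<^sub>L 'b::complex_hilbert"
  assumes "contraction C" shows "norm (C x) \<le> norm x"
proof -
  have "norm (C x) \<le> norm C * norm x" by (rule norm_blinfun)
  also have "\<dots> \<le> 1 * norm x" using assms by (intro mult_right_mono) (auto simp: contraction_def)
  finally show ?thesis by simp
qed

lemma contractionI:
  fixes C :: "'a::complex_hilbert \<Rightarrow>\<^sub>L 'b::complex_hilbert"
  assumes "clinear_op C" "\<And>x. norm (C x) \<le> norm x"
  shows "contraction C"
  unfolding contraction_def using assms by (auto intro!: norm_blinfun_bound)

lemma contraction_cadj: "contraction C \<Longrightarrow> contraction (cadj C)"
  using norm_cadj_le[of C] by (auto simp: contraction_def clinear_cadj)

lemma right_inverse_if_adjoint_bounded_below: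
  fixes T :: "'a::complex_hilbert \<Rightarrow>\<^sub>L 'b::complex_hilbert"
  assumes T: "clinear_op T" and M: "\<And>g. norm g \<le> M * norm (cadj T g)" "0 \<le> M"
  obtains W :: "'b \<Rightarrow>\<^sub>L 'a" where "clinear_op W" "T o\<^sub>L W = id_blinfun"
proof -
  have bound: "cmod (cinner (id_blinfun h) g) \<le> (M * norm g) * norm (cadj T h)" for h g
  proof -
    have "cmod (cinner h g) \<le> norm h * norm g" by (rule cinner_cauchy_schwarz)
    also have "\<dots> \<le> (M * norm (cadj T h)) * norm g" by (intro mult_right_mono M) simp
    finally show ?thesis by (simp add: mult_ac)
  qed
  obtain W where W: "clinear_op W" "\<And>h g. cinner (id_blinfun h) g = cinner (cadj T h) (W g)"
    by (rule form_factorization[OF clinear_op_id clinear_cadj[OF T] bound, where K = M])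
       (use M in auto)
  have "T (W g) = g" for g
    by (rule cinner_ext_right) (simp add: cinner_cadj'[OF T] flip: W(2))
  then show ?thesis by (intro that[OF W(1)] blinfun_eqI) simp
qed


section \<open>Positive square roots and defect operators\<close>

lemma selfadjoint_real:
  fixes T :: "'a::complex_hilbert \<Rightarrow>\<^sub>L 'a"
  assumes "\<And>x y. cinner (T x) y = cinner x (T y)"
  shows "cinner (T x) x \<in> \<real>"
  by (metis Reals_cnj_iff assms cinner_commute)

text \<open>On a complex space a real quadratic form comes from a Hermitian sesquilinear form, by
  polarization along \<open>x + y\<close> and \<open>x + \<i> y\<close>.\<close>

lemma positive_op_selfadjoint:
  fixes P :: "'a::complex_hilbert \<Rightarrow>\<^sub>L 'a"
  assumes "positive_op P"
  shows "cinner (P x) y = cinner x (P y)"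
proof -
  have cl: "clinear_op P" and re: "cinner (P x) x \<in> \<real>" for x
    using assms by (auto simp: positive_op_def)
  have im: "Im (cinner (P x) x) = 0" for x using re complex_is_Real_iff by blast
  have "Im (cinner (P x) y) + Im (cinner (P y) x) = 0"
    using im[of "x + y"] im[of x] im[of y]
    by (simp add: blinfun.add_right cinner_add_left cinner_add_right)
  moreover have "Re (cinner (P x) y) = Re (cinner (P y) x)"
    using im[of "x + \<i> *\<^sub>C y"] im[of x] im[of y]
    by (simp add: blinfun.add_right cinner_add_left cinner_add_right clinear_opD[OF cl]
        cinner_scaleC_left cinner_scaleC_right)
  ultimately have "cinner (P x) y = cnj (cinner (P y) x)" by (simp add: complex_eq_iff)
  then show ?thesis by (metis cinner_commute)
qed

text \<open>A vector where the nonnegative form \<open>\<langle>P y, y\<rangle>\<close> vanishes is a minimum of the form, so the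
  derivative \<open>2 Re \<langle>P y, z\<rangle>\<close> in the direction \<open>z = P y\<close> vanishes.\<close>

lemma positive_op_zero:
  fixes P :: "'a::complex_hilbert \<Rightarrow>\<^sub>L 'a"
  assumes P: "positive_op P" and "cinner (P y) y = 0"
  shows "P y = 0"
proof -
  have "Re (cinner (P y) (P y)) = 0"
  proof (rule quadratic_nonneg_imp_zero)
    fix t :: real
    let ?z = "P y"
    have "0 \<le> Re (cinner (P (y + t *\<^sub>R ?z)) (y + t *\<^sub>R ?z))"
      using P by (simp add: positive_op_def)
    also have "\<dots> = t\<^sup>2 * Re (cinner (P ?z) ?z) + 2 * t * Re (cinner ?z ?z)"
      using positive_op_selfadjoint[OF P, of ?z y] assms(2)
      by (simp add: blinfun.add_right blinfun.scaleR_right cinner_add_left cinner_add_right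
          cinner_scaleR_left cinner_scaleR_right power2_eq_square algebra_simps)
    finally show "0 \<le> t\<^sup>2 * Re (cinner (P ?z) ?z) + 2 * t * Re (cinner ?z ?z)" .
  qed
  then show ?thesis by (simp add: cinner_self)
qed

text \<open>The iteration \<open>Y \<mapsto> (Q + Y\<^sup>2) / 2\<close>, whose fixed point satisfies \<open>(I - Y)\<^sup>2 = I - Q\<close>,
  converges in norm even when \<open>\<parallel>Q\<parallel> = 1\<close>: its increments are dominated by those of the scalar
  iteration \<open>y \<mapsto> (1 + y\<^sup>2) / 2\<close>, which increases to \<open>1\<close>.\<close>

lemma positive_sqrt_exists:
  fixes Q :: "'a::complex_hilbert \<Rightarrow>\<^sub>L 'a"
  assumes cl: "clinear_op Q" and sa: "\<And>x y. cinner (Q x) y = cinner x (Q y)" and n1: "norm Q \<le> 1"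
  obtains S where "positive_op S" "S o\<^sub>L S = id_blinfun - Q"
    "\<And>R. R o\<^sub>L Q = Q o\<^sub>L R \<Longrightarrow> R o\<^sub>L S = S o\<^sub>L R"
proof -
  define y :: "nat \<Rightarrow> real" where "y = rec_nat 0 (\<lambda>_ y. (1 + y\<^sup>2) / 2)"
  define Y :: "nat \<Rightarrow> 'a \<Rightarrow>\<^sub>L 'a" where "Y = rec_nat 0 (\<lambda>_ Y. (1/2) *\<^sub>R (Q + (Y o\<^sub>L Y)))"
  have y0: "y 0 = 0" and ySuc: "y (Suc n) = (1 + (y n)\<^sup>2) / 2" for n by (simp_all add: y_def)
  have Y0: "Y 0 = 0" and YSuc: "Y (Suc n) = (1/2) *\<^sub>R (Q + (Y n o\<^sub>L Y n))" for n
    by (simp_all add: Y_def)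
  have yb: "0 \<le> y n \<and> y n \<le> 1" for n
  proof (induction n)
    case (Suc n)
    then have "(y n)\<^sup>2 \<le> 1" by (simp add: power_le_one)
    then show ?case by (simp add: ySuc)
  qed (simp add: y0)
  have ymono: "y n \<le> y (Suc n)" for n
    using zero_le_power2[of "1 - y n"] by (simp add: ySuc power2_eq_square algebra_simps)
  have YnB: "norm (Y n) \<le> y n" for n
  proof (induction n)
    case (Suc n)
    have "norm (Q + (Y n o\<^sub>L Y n)) \<le> norm Q + norm (Y n) * norm (Y n)"
      using norm_triangle_ineq[of Q "Y n o\<^sub>L Y n"] norm_blinfun_compose[of "Y n" "Y n"] by linarith
    also have "\<dots> \<le> 1 + y n * y n" using Suc n1 yb by (intro add_mono mult_mono) auto
    finally show ?case by (simp add: YSuc ySuc power2_eq_square)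
  qed (simp add: Y0 y0)
  have diff: "norm (Y (Suc n) - Y n) \<le> y (Suc n) - y n" for n
  proof (induction n)
    case 0
    show ?case using n1 by (simp add: YSuc Y0 ySuc y0)
  next
    case (Suc n)
    have "Y (Suc (Suc n)) - Y (Suc n)
        = (1/2) *\<^sub>R (Q + (Y (Suc n) o\<^sub>L Y (Suc n))) - (1/2) *\<^sub>R (Q + (Y n o\<^sub>L Y n))"
      by (rule arg_cong2[where f = "(-)"]) (rule YSuc)+
    also have "\<dots> = (1/2) *\<^sub>R ((Y (Suc n) o\<^sub>L (Y (Suc n) - Y n)) + ((Y (Suc n) - Y n) o\<^sub>L Y n))"
      by (rule blinfun_eqI) (simp add: blinfun.bilinear_simps scaleR_add_right scaleR_diff_right)
    finally have e: "Y (Suc (Suc n)) - Y (Suc n) = \<dots>" .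
    have "norm (Y (Suc (Suc n)) - Y (Suc n))
        \<le> (1/2) * (norm (Y (Suc n)) * norm (Y (Suc n) - Y n) + norm (Y (Suc n) - Y n) * norm (Y n))"
      unfolding e
      using norm_triangle_ineq[of "Y (Suc n) o\<^sub>L (Y (Suc n) - Y n)" "(Y (Suc n) - Y n) o\<^sub>L Y n"]
        norm_blinfun_compose[of "Y (Suc n)" "Y (Suc n) - Y n"]
        norm_blinfun_compose[of "Y (Suc n) - Y n" "Y n"] by simp
    also have "\<dots> \<le> (1/2) * (y (Suc n) * (y (Suc n) - y n) + (y (Suc n) - y n) * y n)"
      using Suc YnB yb ymono by (intro mult_left_mono add_mono mult_mono) auto
    also have "\<dots> = (1 + (y (Suc n))\<^sup>2) / 2 - (1 + (y n)\<^sup>2) / 2"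
      by (simp add: power2_eq_square field_simps)
    also have "\<dots> = y (Suc (Suc n)) - y (Suc n)"
      by (rule arg_cong2[where f = "(-)"]) (rule ySuc[symmetric])+
    finally show ?case .
  qed
  have "convergent y"
    by (rule Bseq_mono_convergent)
       (use yb in \<open>auto intro!: BseqI'[where K = 1] lift_Suc_mono_le[of y] ymono\<close>)
  then obtain l where "y \<longlonglongrightarrow> l" by (auto simp: convergent_def)
  then have "summable (\<lambda>n. y (Suc n) - y n)" by (rule telescope_summable)
  then have "summable (\<lambda>n. Y (Suc n) - Y n)"
    by (rule summable_comparison_test') (use diff in auto)
  then have "(\<lambda>n. \<Sum>k<n. Y (Suc k) - Y k) \<longlonglongrightarrow> (\<Sum>k. Y (Suc k) - Y k)" by (rule summable_LIMSEQ)
  then obtain L where L: "Y \<longlonglongrightarrow> L" by (simp add: sum_lessThan_telescope Y0)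
  have tA: "(\<lambda>n. Y n x) \<longlonglongrightarrow> L x" for x by (rule blinfun.tendsto[OF L tendsto_const])
  have Lfix: "L = (1/2) *\<^sub>R (Q + (L o\<^sub>L L))"
  proof (rule LIMSEQ_unique)
    show "(\<lambda>n. Y (Suc n)) \<longlonglongrightarrow> L" using L by (rule LIMSEQ_Suc)
    show "(\<lambda>n. Y (Suc n)) \<longlonglongrightarrow> (1/2) *\<^sub>R (Q + (L o\<^sub>L L))" unfolding YSuc
      by (intro tendsto_intros L bounded_bilinear.tendsto[OF bounded_bilinear_blinfun_compose])
  qed
  have clY: "clinear_op (Y n)" for n
  proof (induction n)
    case (Suc n)
    have "Y (Suc n) (c *\<^sub>C x) = c *\<^sub>C Y (Suc n) x" for c x
      by (simp add: YSuc clinear_opD[OF Suc] clinear_opD[OF cl] blinfun.add_left blinfun.scaleR_left)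
         (simp add: scaleR_scaleC scaleC_add_right scaleC_scaleC mult.commute)
    then show ?case by (simp add: clinear_op_def)
  qed (simp add: Y0 clinear_op_def)
  have saY: "cinner (Y n a) b = cinner a (Y n b)" for n a b
  proof (induction n arbitrary: a b)
    case (Suc n)
    then show ?case using sa
      by (simp add: YSuc blinfun.bilinear_simps cinner_add_left cinner_add_right
          cinner_scaleR_left cinner_scaleR_right)
  qed (simp add: Y0)
  have clL: "clinear_op L" unfolding clinear_op_def
  proof (intro allI)
    fix c x
    have "(\<lambda>n. c *\<^sub>C Y n x) \<longlonglongrightarrow> c *\<^sub>C L x"
      by (rule bounded_linear.tendsto[OF bounded_linear_scaleC tA])
    with tA[of "c *\<^sub>C x"] show "L (c *\<^sub>C x) = c *\<^sub>C L x"
      by (simp add: clinear_opD[OF clY] LIMSEQ_unique)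
  qed
  have saL: "cinner (L a) b = cinner a (L b)" for a b
  proof (rule LIMSEQ_unique)
    show "(\<lambda>n. cinner (Y n a) b) \<longlonglongrightarrow> cinner (L a) b"
      by (rule bounded_linear.tendsto[OF bounded_linear_cinner_left tA])
    show "(\<lambda>n. cinner (Y n a) b) \<longlonglongrightarrow> cinner a (L b)"
      unfolding saY by (rule bounded_linear.tendsto[OF bounded_linear_cinner_right tA])
  qed
  have nL: "norm L \<le> 1"
    by (rule LIMSEQ_le_const2[OF tendsto_norm[OF L]]) (meson YnB yb order_trans)
  define S where "S = id_blinfun - L"
  have "positive_op S" unfolding positive_op_def
  proof (intro conjI allI)
    show "clinear_op S" unfolding S_def by (intro clinear_op_diff clinear_op_id clL)
    show "cinner (S x) x \<in> \<real>" for x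
      by (rule selfadjoint_real)
         (simp add: S_def blinfun.bilinear_simps cinner_diff_left cinner_diff_right saL)
    fix x
    have "Re (cinner (L x) x) \<le> norm (L x) * norm x"
      using cinner_cauchy_schwarz[of "L x" x] complex_Re_le_cmod order_trans by blast
    also have "\<dots> \<le> (1 * norm x) * norm x"
      using norm_blinfun[of L x] mult_right_mono[OF nL, of "norm x"]
      by (intro mult_right_mono) auto
    finally show "0 \<le> Re (cinner (S x) x)"
      by (simp add: S_def blinfun.bilinear_simps cinner_diff_left Re_cinner_self power2_eq_square)
  qed
  moreover have "S o\<^sub>L S = id_blinfun - Q"
  proof (rule blinfun_eqI)
    fix x
    have "L x + L x = Q x + L (L x)"
      by (subst (1 2) Lfix) (simp add: blinfun.bilinear_simps flip: scaleR_left_distrib)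
    then show "(S o\<^sub>L S) x = (id_blinfun - Q) x"
      by (simp add: S_def blinfun.bilinear_simps algebra_simps)
  qed
  moreover have "R o\<^sub>L S = S o\<^sub>L R" if R: "R o\<^sub>L Q = Q o\<^sub>L R" for R
  proof -
    have RQ: "R (Q x) = Q (R x)" for x using arg_cong[OF R, of "\<lambda>T. blinfun_apply T x"] by simp
    have RY: "R (Y n x) = Y n (R x)" for n x
      by (induction n arbitrary: x) (simp_all add: Y0 YSuc blinfun.bilinear_simps RQ)
    have "R (L x) = L (R x)" for x
    proof (rule LIMSEQ_unique)
      show "(\<lambda>n. R (Y n x)) \<longlonglongrightarrow> R (L x)" by (rule blinfun.tendsto[OF tendsto_const tA])
      show "(\<lambda>n. R (Y n x)) \<longlonglongrightarrow> L (R x)" unfolding RY by (rule tA)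
    qed
    then show ?thesis by (intro blinfun_eqI) (simp add: S_def blinfun.bilinear_simps)
  qed
  ultimately show ?thesis by (rule that)
qed

text \<open>For commuting square roots \<open>(S + R) (S - R) = 0\<close>. On the range of \<open>S - R\<close> the forms of \<open>S\<close>
  and \<open>R\<close> therefore have sum zero, and being nonnegative they both vanish there.\<close>

lemma positive_sqrt_unique:
  fixes Q S R :: "'a::complex_hilbert \<Rightarrow>\<^sub>L 'a"
  assumes S: "positive_op S" and R: "positive_op R" and eq: "R o\<^sub>L R = S o\<^sub>L S"
    and comm: "R o\<^sub>L S = S o\<^sub>L R"
  shows "R = S"
proof (rule blinfun_eqI)
  fix x
  define y where "y = S x - R x"
  have sq: "R (R z) = S (S z)" and co: "R (S z) = S (R z)" for z
    using arg_cong[OF eq, of "\<lambda>T. blinfun_apply T z"] arg_cong[OF comm, of "\<lambda>T. blinfun_apply T z"]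
    by simp_all
  have "S y + R y = 0" by (simp add: y_def blinfun.bilinear_simps sq co)
  then have "cinner (S y) y + cinner (R y) y = 0" by (simp flip: cinner_add_left)
  moreover have "0 \<le> Re (cinner (S y) y)" "0 \<le> Re (cinner (R y) y)"
    "Im (cinner (S y) y) = 0" "Im (cinner (R y) y) = 0"
    using S R complex_is_Real_iff by (auto simp: positive_op_def)
  ultimately have "cinner (S y) y = 0" "cinner (R y) y = 0"
    by (auto simp: complex_eq_iff)
  then have "S y = 0" "R y = 0" using positive_op_zero S R by blast+
  then have "cinner x (S y - R y) = 0" by simp
  moreover have "cinner x (S y - R y) = cinner y y"
    by (simp add: y_def cinner_diff_left cinner_diff_right blinfun.diff_right
        positive_op_selfadjoint[OF S] positive_op_selfadjoint[OF R])
  ultimately show "R x = S x" by (simp add: cinner_self y_def)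
qed

lemma
  fixes C :: "'a::complex_hilbert \<Rightarrow>\<^sub>L 'b::complex_hilbert"
  assumes C: "contraction C"
  shows positive_defect_op: "positive_op (defect_op C)"
    and norm_defect_op: "(norm (defect_op C x))\<^sup>2 = (norm x)\<^sup>2 - (norm (C x))\<^sup>2"
proof -
  note cl = contraction_clinear[OF C]
  let ?Q = "cadj C o\<^sub>L C"
  have nQ: "norm ?Q \<le> 1"
  proof -
    have "norm ?Q \<le> norm (cadj C) * norm C" by (rule norm_blinfun_compose)
    also have "\<dots> \<le> 1 * 1"
      using C contraction_cadj[OF C] by (intro mult_mono) (auto simp: contraction_def)
    finally show ?thesis by simp
  qed
  have saQ: "cinner (?Q a) b = cinner a (?Q b)" for a b
    by (simp add: cinner_cadj[OF cl] flip: cinner_cadj'[OF cl])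
  obtain S where S: "positive_op S" "S o\<^sub>L S = id_blinfun - ?Q"
      "\<And>R. R o\<^sub>L ?Q = ?Q o\<^sub>L R \<Longrightarrow> R o\<^sub>L S = S o\<^sub>L R"
    using positive_sqrt_exists[OF clinear_op_compose[OF clinear_cadj[OF cl] cl] saQ nQ] by blast
  have "defect_op C = S" unfolding defect_op_def sqrt_op_def
  proof (rule the_equality)
    fix R assume R: "positive_op R \<and> R o\<^sub>L R = id_blinfun - ?Q"
    \<comment> \<open>a square root of \<open>I - Q\<close> commutes with \<open>Q\<close>, hence with \<open>S\<close>\<close>
    have RR: "R (R z) = z - ?Q z" for z
    proof -
      have "(R o\<^sub>L R) z = (id_blinfun - ?Q) z" using R by simp
      then show ?thesis by (simp add: blinfun.bilinear_simps)
    qed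
    have "R (?Q z) = ?Q (R z)" for z
    proof -
      have "R (z - ?Q z) = R z - ?Q (R z)" using RR[of "R z"] by (simp add: RR)
      then show ?thesis by (simp add: blinfun.bilinear_simps)
    qed
    then have RQ: "R o\<^sub>L ?Q = ?Q o\<^sub>L R" by (intro blinfun_eqI) simp
    show "R = S"
      by (rule positive_sqrt_unique[OF S(1) _ _ S(3)[OF RQ]]) (use R S(2) in auto)
  qed (use S(1,2) in simp)
  then show "positive_op (defect_op C)" using S(1) by simp
  have "complex_of_real ((norm (S x))\<^sup>2) = cinner ((S o\<^sub>L S) x) x"
    using positive_op_selfadjoint[OF S(1), of "S x" x] by (simp add: cinner_self del: of_real_power)
  also have "\<dots> = complex_of_real ((norm x)\<^sup>2 - (norm (C x))\<^sup>2)"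
    unfolding S(2) by (simp add: blinfun.bilinear_simps cinner_diff_left cinner_self
        flip: cinner_cadj'[OF cl])
  finally show "(norm (defect_op C x))\<^sup>2 = (norm x)\<^sup>2 - (norm (C x))\<^sup>2"
    using \<open>defect_op C = S\<close> by (simp only: of_real_eq_iff)
qed

lemma defect_op_selfadjoint:
  "contraction C \<Longrightarrow> cinner (defect_op C x) y = cinner x (defect_op C y)"
  for C :: "'a::complex_hilbert \<Rightarrow>\<^sub>L 'b::complex_hilbert"
  by (rule positive_op_selfadjoint[OF positive_defect_op])

lemma clinear_defect_op: "contraction C \<Longrightarrow> clinear_op (defect_op C)"
  using positive_defect_op by (auto simp: positive_op_def)

lemma norm_defect_op_le: "contraction C \<Longrightarrow> norm (defect_op C x) \<le> norm x"
  for C :: "'a::complex_hilbert \<Rightarrow>\<^sub>L 'b::complex_hilbert"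
  by (rule power2_le_imp_le) (simp_all add: norm_defect_op)

text \<open>The pre-order in terms of forms. The operator \<open>X\<close> of the definition is recovered from the
  estimate by factoring twice, first through \<open>D\<^sub>B\<close> and then through \<open>D\<^bsub>B\<^sup>*\<^esub>\<close>.\<close>

lemma prec_op_iff_form_bound:
  "A \<prec> B \<longleftrightarrow> contraction A \<and> contraction B \<and>
    (\<exists>M\<ge>0. \<forall>x y. cmod (cinner ((A - B) x) y) \<le> M * norm (defect_op B x) * norm (defect_op (cadj B) y))"
  (is "?L \<longleftrightarrow> ?R")
proof
  assume L: ?L
  then have A: "contraction A" and B: "contraction B" by (auto simp: prec_op_def)
  obtain X K where X: "\<And>x. x \<in> defect_space B \<Longrightarrow> norm (X x) \<le> K * norm x"
    "\<And>h. (A - B) h = defect_op (cadj B) (X (defect_op B h))"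
    using L unfolding prec_op_def bounded_op_between_def by metis
  have "cmod (cinner ((A - B) x) y) \<le> max K 0 * norm (defect_op B x) * norm (defect_op (cadj B) y)" for x y
  proof -
    have "cmod (cinner ((A - B) x) y) = cmod (cinner (X (defect_op B x)) (defect_op (cadj B) y))"
      by (simp add: X(2) defect_op_selfadjoint[OF contraction_cadj[OF B]])
    also have "\<dots> \<le> norm (X (defect_op B x)) * norm (defect_op (cadj B) y)"
      by (rule cinner_cauchy_schwarz)
    also have "\<dots> \<le> (max K 0 * norm (defect_op B x)) * norm (defect_op (cadj B) y)"
    proof (rule mult_right_mono)
      have "defect_op B x \<in> defect_space B"
        unfolding defect_space_def by (intro subsetD[OF closure_subset] rangeI)
      then have "norm (X (defect_op B x)) \<le> K * norm (defect_op B x)" by (rule X)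
      also have "\<dots> \<le> max K 0 * norm (defect_op B x)" by (intro mult_right_mono) auto
      finally show "norm (X (defect_op B x)) \<le> max K 0 * norm (defect_op B x)" .
    qed simp
    finally show ?thesis .
  qed
  with A B show ?R by (metis max.cobounded2)
next
  assume R: ?R
  then obtain M where A: "contraction A" and B: "contraction B" and M0: "0 \<le> M"
    and M: "\<And>x y. cmod (cinner ((A - B) x) y) \<le> M * norm (defect_op B x) * norm (defect_op (cadj B) y)"
    by blast
  note B' = contraction_cadj[OF B]
  let ?D = "defect_op B" and ?D' = "defect_op (cadj B)"
  have clAB: "clinear_op (A - B)" by (intro clinear_op_diff contraction_clinear A B)
  obtain W where W: "clinear_op W" "\<And>h g. cinner ((A - B) h) g = cinner (?D h) (W g)"
      "\<And>g. norm (W g) \<le> M * norm (?D' g)"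
  proof (rule form_factorization[OF clAB clinear_defect_op[OF B],
        where c = "\<lambda>g. M * norm (?D' g)" and K = M])
    show "cmod (cinner ((A - B) h) g) \<le> M * norm (?D' g) * norm (?D h)" for h g
      using M[of h g] by (simp only: mult_ac)
    show "M * norm (?D' g) \<le> M * norm g" for g
      by (intro mult_left_mono norm_defect_op_le[OF B'] M0)
  qed (use M0 in auto)
  have bW: "cmod (cinner (W h) g) \<le> (M * norm g) * norm (?D' h)" for h g
  proof -
    have "cmod (cinner (W h) g) \<le> norm (W h) * norm g" by (rule cinner_cauchy_schwarz)
    also have "\<dots> \<le> (M * norm (?D' h)) * norm g" by (intro mult_right_mono W) simp
    finally show ?thesis by (simp add: mult_ac)
  qed
  obtain X where X: "clinear_op X" "\<And>h g. cinner (W h) g = cinner (?D' h) (X g)"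
      "\<And>g. X g \<in> closure (range ?D')" "\<And>g. norm (X g) \<le> M * norm g"
    by (rule form_factorization[OF W(1) clinear_defect_op[OF B'] bW, where K = M]) (use M0 in auto)
  have "(A - B) h = ?D' (X (?D h))" for h
  proof (rule cinner_ext_left)
    fix g
    have "cinner (?D' (X (?D h))) g = cnj (cinner (?D' g) (X (?D h)))"
      by (metis cinner_commute defect_op_selfadjoint[OF B'])
    also have "\<dots> = cnj (cinner (W g) (?D h))" by (simp add: X(2))
    also have "\<dots> = cinner ((A - B) h) g" by (simp add: W(2) flip: cinner_commute)
    finally show "cinner ((A - B) h) g = cinner (?D' (X (?D h))) g" ..
  qed
  moreover have "bounded_op_between (defect_space B) (defect_space (cadj B)) X"
    unfolding bounded_op_between_def defect_space_def
    using X(1,3,4) by (auto simp: blinfun.add_right clinear_opD intro!: exI[of _ M])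
  ultimately show ?L unfolding prec_op_def using A B by blast
qed

section \<open>The pre-order under feedback\<close>

lemma cadj_id_minus_compose:
  fixes N :: "'f::complex_hilbert \<Rightarrow>\<^sub>L 'e::complex_hilbert" and A :: "'e \<Rightarrow>\<^sub>L 'f"
  assumes N: "clinear_op N" and A: "clinear_op A"
  shows "cadj (id_blinfun - (N o\<^sub>L A)) = id_blinfun - (cadj A o\<^sub>L cadj N)"
  by (rule cadj_eqI)
     (simp add: blinfun.diff_left cinner_diff_left cinner_diff_right cinner_cadj[OF N] cinner_cadj[OF A])

lemma prec_op_cadj:
  fixes A B :: "'e::complex_hilbert \<Rightarrow>\<^sub>L 'f::complex_hilbert"
  assumes "A \<prec> B" shows "cadj A \<prec> cadj B"
proof -
  from assms obtain M where A: "contraction A" and B: "contraction B" and M0: "0 \<le> M"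
    and M: "\<And>x y. cmod (cinner ((A - B) x) y) \<le> M * norm (defect_op B x) * norm (defect_op (cadj B) y)"
    unfolding prec_op_iff_form_bound by blast
  note clA = contraction_clinear[OF A] and clB = contraction_clinear[OF B]
  have "cmod (cinner ((cadj A - cadj B) y) x)
      \<le> M * norm (defect_op (cadj B) y) * norm (defect_op (cadj (cadj B)) x)" for x y
  proof -
    have "cinner ((cadj A - cadj B) y) x = cnj (cinner ((A - B) x) y)"
      by (simp add: blinfun.diff_left cinner_diff_left cinner_diff_right cinner_cadj[OF clA]
          cinner_cadj[OF clB] flip: cinner_commute)
    then have "cmod (cinner ((cadj A - cadj B) y) x) = cmod (cinner ((A - B) x) y)" by simp
    then show ?thesis using M[of x y] by (simp add: cadj_cadj[OF clB] mult_ac)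
  qed
  then show ?thesis
    unfolding prec_op_iff_form_bound using contraction_cadj[OF A] contraction_cadj[OF B] M0 by blast
qed

text \<open>The test vector is \<open>y = (A - B) x\<close>.\<close>

lemma form_bound_norm_le:
  fixes A B :: "'e::complex_hilbert \<Rightarrow>\<^sub>L 'f::complex_hilbert"
  assumes B: "contraction B" and M0: "0 \<le> M"
    and M: "\<And>x y. cmod (cinner ((A - B) x) y) \<le> M * norm (defect_op B x) * norm (defect_op (cadj B) y)"
  shows "norm ((A - B) x) \<le> M * norm (defect_op B x)"
proof -
  let ?z = "(A - B) x"
  have "norm ?z * norm ?z = cmod (cinner ?z ?z)"
    by (simp add: cinner_self norm_power power2_eq_square norm_mult)
  also have "\<dots> \<le> M * norm (defect_op B x) * norm (defect_op (cadj B) ?z)" by (rule M)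
  also have "\<dots> \<le> M * norm (defect_op B x) * norm ?z"
    by (intro mult_left_mono norm_defect_op_le contraction_cadj B mult_nonneg_nonneg M0 norm_ge_zero)
  finally show ?thesis using M0 by (cases "?z = 0") simp_all
qed

text \<open>The identity \<open>N (I - B N) = (I - N B) N\<close> controls \<open>N g\<close>, and \<open>g = (I - B N) g + B (N g)\<close>.\<close>

lemma bounded_below_swap:
  fixes N :: "'f::complex_hilbert \<Rightarrow>\<^sub>L 'e::complex_hilbert" and B :: "'e \<Rightarrow>\<^sub>L 'f"
  assumes N: "contraction N" and B: "contraction B" and c0: "0 \<le> c"
    and c: "\<And>x. norm x \<le> c * norm (x - N (B x))"
  shows "norm g \<le> (1 + c) * norm (g - B (N g))"
proof -
  let ?r = "g - B (N g)"
  have "norm (N g) \<le> c * norm (N ?r)" using c[of "N g"] by (simp add: blinfun.diff_right)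
  also have "\<dots> \<le> c * norm ?r" by (intro mult_left_mono contraction_norm_le N c0)
  finally have "norm (B (N g)) \<le> c * norm ?r" using contraction_norm_le[OF B, of "N g"] by linarith
  moreover have "norm g \<le> norm ?r + norm (B (N g))" using norm_triangle_ineq[of ?r "B (N g)"] by simp
  ultimately show ?thesis by (simp add: algebra_simps)
qed

text \<open>If \<open>x\<close> is almost fixed by the contraction \<open>N B\<close>, then \<open>B\<close> almost preserves its norm, so the
  defect \<open>D\<^sub>B x\<close> is small. There \<open>A x\<close> and \<open>B x\<close> nearly agree, and \<open>x\<close> is almost fixed by \<open>N A\<close>
  as well.\<close>

lemma prec_op_bounded_below:
  fixes N :: "'f::complex_hilbert \<Rightarrow>\<^sub>L 'e::complex_hilbert" and A B :: "'e \<Rightarrow>\<^sub>L 'f"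
  assumes AB: "A \<prec> B" and N: "contraction N" and c0: "0 \<le> c"
    and c: "\<And>x. norm x \<le> c * norm (x - N (A x))"
  obtains c' where "0 \<le> c'" "\<And>x. norm x \<le> c' * norm (x - N (B x))"
proof -
  from AB obtain M where B: "contraction B" and M0: "0 \<le> M"
    and M: "\<And>x y. cmod (cinner ((A - B) x) y) \<le> M * norm (defect_op B x) * norm (defect_op (cadj B) y)"
    unfolding prec_op_iff_form_bound by blast
  have "norm x \<le> 2 * (c + c\<^sup>2 * M\<^sup>2) * norm (x - N (B x))" for x
  proof -
    let ?r = "x - N (B x)"
    have Bx: "norm (B x) \<le> norm x" by (rule contraction_norm_le[OF B])
    have "norm x \<le> norm ?r + norm (N (B x))" using norm_triangle_ineq[of ?r "N (B x)"] by simp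
    then have r: "norm x - norm (B x) \<le> norm ?r" using contraction_norm_le[OF N, of "B x"] by linarith
    have "(norm (defect_op B x))\<^sup>2 = (norm x - norm (B x)) * (norm x + norm (B x))"
      using norm_defect_op[OF B, of x] by (simp add: power2_eq_square algebra_simps)
    also have "\<dots> \<le> norm ?r * (2 * norm x)" using r Bx by (intro mult_mono) auto
    finally have d: "(norm (defect_op B x))\<^sup>2 \<le> 2 * norm ?r * norm x" by simp
    have "norm (x - N (A x)) \<le> norm ?r + norm (N ((A - B) x))"
      using norm_triangle_ineq4[of ?r "N ((A - B) x)"] by (simp add: blinfun.diff_right blinfun.diff_left)
    also have "\<dots> \<le> norm ?r + M * norm (defect_op B x)"
      using contraction_norm_le[OF N, of "(A - B) x"] form_bound_norm_le[OF B M0 M, of x] by linarith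
    finally have "c * norm (x - N (A x)) \<le> c * (norm ?r + M * norm (defect_op B x))"
      using c0 by (intro mult_left_mono)
    then have 1: "norm x \<le> c * norm ?r + (c * M) * norm (defect_op B x)"
      using c[of x] by (simp add: distrib_left mult.assoc)
    \<comment> \<open>the arithmetic-geometric mean inequality absorbs \<open>\<parallel>x\<parallel>\<close> on the right\<close>
    have "((c * M) * norm (defect_op B x))\<^sup>2 \<le> (c * M)\<^sup>2 * (2 * norm ?r * norm x)"
      unfolding power_mult_distrib[of "c * M"] by (intro mult_left_mono d) simp
    also have "\<dots> \<le> (c\<^sup>2 * M\<^sup>2 * norm ?r + norm x / 2)\<^sup>2"
      using zero_le_power2[of "c\<^sup>2 * M\<^sup>2 * norm ?r - norm x / 2"]
      by (simp add: power2_eq_square algebra_simps)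
    finally have "(c * M) * norm (defect_op B x) \<le> c\<^sup>2 * M\<^sup>2 * norm ?r + norm x / 2"
      by (rule power2_le_imp_le) simp
    with 1 show ?thesis by (simp add: algebra_simps)
  qed
  then show ?thesis using that[of "2 * (c + c\<^sup>2 * M\<^sup>2)"] c0 by simp
qed

text \<open>Surjectivity is bounded-belowness of the adjoint, so the previous lemma, applied to
  \<open>A \<prec> B\<close> and to \<open>A\<^sup>* \<prec> B\<^sup>*\<close>, carries the invertibility of \<open>I - N A\<close> over to \<open>I - N B\<close>.\<close>

lemma prec_op_loop_solvable:
  fixes N :: "'f::complex_hilbert \<Rightarrow>\<^sub>L 'e::complex_hilbert" and A B :: "'e \<Rightarrow>\<^sub>L 'f"
  assumes AB: "A \<prec> B" and N: "contraction N" and c0: "0 \<le> c"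
    and c: "\<And>x. norm x \<le> c * norm (x - N (A x))"
    and S: "(id_blinfun - (N o\<^sub>L A)) o\<^sub>L S = id_blinfun"
  shows "\<exists>x. x - N (B x) = r" and "\<exists>w. w - cadj N (cadj B w) = s"
proof -
  have A: "contraction A" and B: "contraction B" using AB by (auto simp: prec_op_def)
  note cl = contraction_clinear[OF N] contraction_clinear[OF A] contraction_clinear[OF B]
  note ct = contraction_cadj[OF N] contraction_cadj[OF A] contraction_cadj[OF B]
  note cl' = cl ct[THEN contraction_clinear]
  have "norm g \<le> norm S * norm (g - cadj A (cadj N g))" for g
  proof -
    let ?T = "id_blinfun - (N o\<^sub>L A)"
    have cT: "clinear_op ?T" by (intro clinear_op_diff clinear_op_id clinear_op_compose cl)
    have TS: "?T (S g) = g" using arg_cong[OF S, of "\<lambda>T. blinfun_apply T g"] by simp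
    have "norm g * norm g = cmod (cinner g g)"
      by (simp add: cinner_self norm_power power2_eq_square norm_mult)
    also have "cinner g g = cinner (cadj ?T g) (S g)" by (metis TS cinner_cadj'[OF cT])
    also have "cmod \<dots> \<le> norm (cadj ?T g) * norm (S g)" by (rule cinner_cauchy_schwarz)
    also have "\<dots> \<le> norm (cadj ?T g) * (norm S * norm g)" by (intro mult_left_mono norm_blinfun) simp
    finally have "norm g \<le> norm S * norm (cadj ?T g)" by (cases "g = 0") (simp_all add: mult_ac)
    then show ?thesis by (simp add: cadj_id_minus_compose[OF cl(1,2)] blinfun.diff_left)
  qed
  then have "norm g \<le> (1 + norm S) * norm (g - cadj N (cadj A g))" for g
    by (rule bounded_below_swap[OF ct(2,1) norm_ge_zero])
  moreover have "0 \<le> 1 + norm S" by simp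
  ultimately obtain d where d: "0 \<le> d" "\<And>g. norm g \<le> d * norm (g - cadj N (cadj B g))"
    using prec_op_bounded_below[OF prec_op_cadj[OF AB] ct(1)] by metis
  obtain e where e: "0 \<le> e" "\<And>x. norm x \<le> e * norm (x - N (B x))"
    using prec_op_bounded_below[OF AB N c0 c] by metis
  show "\<exists>x. x - N (B x) = r"
  proof -
    have "norm g \<le> (1 + d) * norm (cadj (id_blinfun - (N o\<^sub>L B)) g)" for g
      using bounded_below_swap[OF ct(1,3) d]
      by (simp add: cadj_id_minus_compose[OF cl(1,3)] blinfun.diff_left)
    then obtain W where "(id_blinfun - (N o\<^sub>L B)) o\<^sub>L W = id_blinfun"
      by (rule right_inverse_if_adjoint_bounded_below[OF
            clinear_op_diff[OF clinear_op_id clinear_op_compose[OF cl(1,3)]]]) (use d in auto)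
    from arg_cong[OF this, of "\<lambda>T. blinfun_apply T r"] show ?thesis by (auto simp: blinfun.diff_left)
  qed
  show "\<exists>w. w - cadj N (cadj B w) = s"
  proof -
    have "norm g \<le> (1 + e) * norm (cadj (id_blinfun - (cadj N o\<^sub>L cadj B)) g)" for g
      using bounded_below_swap[OF N B e]
      by (simp add: cadj_id_minus_compose[OF cl'(4,6)] cadj_cadj[OF cl(1)] cadj_cadj[OF cl(3)] blinfun.diff_left)
    then obtain W where "(id_blinfun - (cadj N o\<^sub>L cadj B)) o\<^sub>L W = id_blinfun"
      by (rule right_inverse_if_adjoint_bounded_below[OF
            clinear_op_diff[OF clinear_op_id clinear_op_compose[OF cl'(4,6)]]]) (use e in auto)
    from arg_cong[OF this, of "\<lambda>T. blinfun_apply T s"] show ?thesis by (auto simp: blinfun.diff_left)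
  qed
qed

text \<open>Contractivity of \<open>P\<close> at \<open>(B x, u)\<close> reads \<open>\<parallel>x\<parallel>\<^sup>2 + \<parallel>B' u\<parallel>\<^sup>2 \<le> \<parallel>B x\<parallel>\<^sup>2 + \<parallel>u\<parallel>\<^sup>2\<close>.\<close>

lemma feedback_defect_le:
  fixes P :: "('f::complex_hilbert \<times> 'u::complex_hilbert) \<Rightarrow>\<^sub>L ('e::complex_hilbert \<times> 'y::complex_hilbert)"
    and B :: "'e \<Rightarrow>\<^sub>L 'f" and B' :: "'u \<Rightarrow>\<^sub>L 'y"
  assumes "contraction P" "contraction B" "contraction B'" and "P (B x, u) = (x, B' u)"
  shows "norm (defect_op B x) \<le> norm (defect_op B' u)"
proof (rule power2_le_imp_le)
  have "(norm (P (B x, u)))\<^sup>2 \<le> (norm (B x, u))\<^sup>2"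
    by (intro power_mono contraction_norm_le assms) simp
  then show "(norm (defect_op B x))\<^sup>2 \<le> (norm (defect_op B' u))\<^sup>2"
    using assms(2-) by (simp add: norm_defect_op norm_Pair)
qed simp

text \<open>A feedback loop is described by \<open>P (B x, u) = (x, B' u)\<close>. Pairing the loop of \<open>A\<close> with the
  loop \<open>P\<^sup>* (B\<^sup>* w, v) = (w, B'\<^sup>* v)\<close> of the adjoint of \<open>B\<close> makes every term cancel except
  \<open>\<langle>(A' - B') u, v\<rangle> = \<langle>(A - B) a, w\<rangle>\<close>, and the defects on the right are dominated by those of
  \<open>B'\<close>.\<close>

lemma prec_op_feedback:
  fixes P :: "('f::complex_hilbert \<times> 'u::complex_hilbert) \<Rightarrow>\<^sub>L ('e::complex_hilbert \<times> 'y::complex_hilbert)"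
    and A B :: "'e \<Rightarrow>\<^sub>L 'f" and S :: "'e \<Rightarrow>\<^sub>L 'e" and A' B' :: "'u \<Rightarrow>\<^sub>L 'y"
  assumes P: "contraction P" and AB: "A \<prec> B" and A': "contraction A'" and B': "contraction B'"
    and c0: "0 \<le> c" and c: "\<And>x. norm x \<le> c * norm (x - fst (P (A x, 0)))"
    and S: "\<And>x. S x - fst (P (A (S x), 0)) = x"
    and loopA: "\<And>a u. fst (P (A a, u)) = a \<Longrightarrow> snd (P (A a, u)) = A' u"
    and loopB: "\<And>x u. fst (P (B x, u)) = x \<Longrightarrow> snd (P (B x, u)) = B' u"
  shows "A' \<prec> B'"
proof -
  from AB obtain M where A: "contraction A" and B: "contraction B" and M0: "0 \<le> M"
    and M: "\<And>x y. cmod (cinner ((A - B) x) y) \<le> M * norm (defect_op B x) * norm (defect_op (cadj B) y)"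
    unfolding prec_op_iff_form_bound by blast
  note clP = contraction_clinear[OF P] and clA = contraction_clinear[OF A]
    and clB = contraction_clinear[OF B] and clB' = contraction_clinear[OF B']
  define N :: "'f \<Rightarrow>\<^sub>L 'e" where "N = fst_blinfun o\<^sub>L P o\<^sub>L incl1"
  have N: "N x = fst (P (x, 0))" for x by (simp add: N_def incl1.rep_eq)
  have cN: "contraction N"
  proof (rule contractionI)
    have "P (a *\<^sub>C x, 0) = a *\<^sub>C P (x, 0)" for a x
      using clinear_opD[OF clP, of a "(x, 0)"] by (simp add: scaleC_prod_def)
    then show "clinear_op N" by (simp add: clinear_op_def N scaleC_prod_def)
    show "norm (N x) \<le> norm x" for x
      using norm_fst_le[of "fst (P (x, 0))" "snd (P (x, 0))"] contraction_norm_le[OF P, of "(x, 0)"]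
      unfolding N by (simp add: norm_Pair)
  qed
  have Padd: "P (x, u) = P (x, 0) + P (0, u)" for x u
    using blinfun.add_right[of P "(x, 0)" "(0, u)"] by simp
  have P'add: "cadj P (x, u) = cadj P (x, 0) + cadj P (0, u)" for x u
    using blinfun.add_right[of "cadj P" "(x, 0)" "(0, u)"] by simp
  have N': "cadj N y = fst (cadj P (y, 0))" for y
  proof (rule cinner_ext_right)
    fix x
    have "cinner x (cadj N y) = cinner (P (x, 0)) (y, 0)"
      by (simp add: N cinner_prod_def flip: cinner_cadj[OF contraction_clinear[OF cN]])
    also have "\<dots> = cinner x (fst (cadj P (y, 0)))"
      using cinner_cadj[OF clP, of "(x, 0)" "(y, 0)"] by (simp add: cinner_prod_def)
    finally show "cinner x (cadj N y) = cinner x (fst (cadj P (y, 0)))" .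
  qed
  have bbA: "norm x \<le> c * norm (x - N (A x))" for x using c[of x] by (simp add: N)
  have "(id_blinfun - (N o\<^sub>L A)) o\<^sub>L S = id_blinfun"
    by (rule blinfun_eqI) (use S in \<open>simp add: blinfun.diff_left N\<close>)
  note solve = prec_op_loop_solvable[OF AB cN c0 bbA this]
  have loopB': "\<exists>x. P (B x, u) = (x, B' u)" for u
  proof -
    obtain x where "x - N (B x) = fst (P (0, u))" using solve(1) by blast
    then have "fst (P (B x, u)) = x" by (subst Padd) (simp add: N algebra_simps)
    with loopB[OF this] show ?thesis by (metis prod.collapse)
  qed
  have loopA': "\<exists>a. P (A a, u) = (a, A' u)" for u
  proof -
    let ?a = "S (fst (P (0, u)))"
    have "?a - fst (P (A ?a, 0)) = fst (P (0, u))" by (rule S)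
    then have "fst (P (A ?a, u)) = ?a" by (subst Padd) (simp add: algebra_simps)
    with loopA[OF this] show ?thesis by (metis prod.collapse)
  qed
  have loopBadj: "\<exists>w. cadj P (cadj B w, v) = (w, cadj B' v)" for v
  proof -
    obtain w where "w - cadj N (cadj B w) = fst (cadj P (0, v))" using solve(2) by blast
    then have w: "fst (cadj P (cadj B w, v)) = w" by (subst P'add) (simp add: N' algebra_simps)
    have "snd (cadj P (cadj B w, v)) = cadj B' v"
    proof (rule cinner_ext_right)
      fix u
      obtain x where x: "P (B x, u) = (x, B' u)" using loopB' by blast
      have "cinner (P (B x, u)) (cadj B w, v) = cinner (B x, u) (cadj P (cadj B w, v))"
        by (rule cinner_cadj[OF clP])
      then show "cinner u (snd (cadj P (cadj B w, v))) = cinner u (cadj B' v)"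
        by (simp add: x w cinner_prod_def cinner_cadj[OF clB] cinner_cadj[OF clB'])
    qed
    with w show ?thesis by (metis prod.collapse)
  qed
  have "cmod (cinner ((A' - B') u) v)
      \<le> (M * (1 + c * M)) * norm (defect_op B' u) * norm (defect_op (cadj B') v)" for u v
  proof -
    obtain a where a: "P (A a, u) = (a, A' u)" using loopA' by blast
    obtain x where x: "P (B x, u) = (x, B' u)" using loopB' by blast
    obtain w where w: "cadj P (cadj B w, v) = (w, cadj B' v)" using loopBadj by blast
    have "cinner (P (A a, u)) (cadj B w, v) = cinner (A a, u) (cadj P (cadj B w, v))"
      by (rule cinner_cadj[OF clP])
    then have eq: "cinner ((A' - B') u) v = cinner ((A - B) a) w"
      by (simp add: a w cinner_prod_def blinfun.diff_left cinner_diff_left cinner_cadj[OF clB]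
          cinner_cadj[OF clB'] algebra_simps)
    have loop: "a - x = N (A a - B x)"
      using blinfun.diff_right[of P "(A a, u)" "(B x, u)"] by (simp add: a x N)
    have "N (A a - B x) - N (A (a - x)) = N ((A - B) x)"
      by (simp add: blinfun.diff_right blinfun.diff_left)
    with loop have "(a - x) - N (A (a - x)) = N ((A - B) x)" by metis
    then have "norm (a - x) \<le> c * norm (N ((A - B) x))" using bbA[of "a - x"] by simp
    also have "\<dots> \<le> c * (M * norm (defect_op B x))"
      using contraction_norm_le[OF cN, of "(A - B) x"] form_bound_norm_le[OF B M0 M, of x]
      by (intro mult_left_mono c0) linarith
    finally have ax: "norm (a - x) \<le> c * M * norm (defect_op B x)" by simp
    have "norm (defect_op B a) \<le> norm (defect_op B x) + norm (defect_op B (a - x))"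
      using norm_triangle_ineq[of "defect_op B x" "defect_op B (a - x)"] by (simp add: blinfun.diff_right)
    also have "\<dots> \<le> (1 + c * M) * norm (defect_op B x)"
      using norm_defect_op_le[OF B, of "a - x"] ax by (simp add: algebra_simps)
    also have "\<dots> \<le> (1 + c * M) * norm (defect_op B' u)"
      by (intro mult_left_mono feedback_defect_le[OF P B B' x]) (use c0 M0 in simp)
    finally have Da: "norm (defect_op B a) \<le> (1 + c * M) * norm (defect_op B' u)" .
    have Dw: "norm (defect_op (cadj B) w) \<le> norm (defect_op (cadj B') v)"
      by (rule feedback_defect_le[OF contraction_cadj[OF P] contraction_cadj[OF B]
            contraction_cadj[OF B'] w])
    have "cmod (cinner ((A' - B') u) v) \<le> M * norm (defect_op B a) * norm (defect_op (cadj B) w)"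
      unfolding eq by (rule M)
    also have "\<dots> \<le> M * ((1 + c * M) * norm (defect_op B' u)) * norm (defect_op (cadj B') v)"
      using Da Dw M0 c0 by (intro mult_mono) auto
    finally show ?thesis by (simp add: mult_ac)
  qed
  moreover have "0 \<le> M * (1 + c * M)" using M0 c0 by simp
  ultimately show ?thesis unfolding prec_op_iff_form_bound using A' B' by blast
qed

section \<open>Analytic operator functions on the disc\<close>

text \<open>In terms of difference quotients, the product and inverse rules for operator functions become
  algebraic identities followed by passage to the limit.\<close>

lemma analytic_on_disc_iff_quotient:
  "analytic_on_disc F \<longleftrightarrow>
    (\<forall>z\<in>ball 0 1. \<exists>D. ((\<lambda>w. inverse (w - z) *\<^sub>C (F w - F z)) \<longlongrightarrow> D) (at z))"
proof -
  have "(F has_derivative (\<lambda>h. h *\<^sub>C D)) (at z) \<longleftrightarrow>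
      ((\<lambda>w. inverse (w - z) *\<^sub>C (F w - F z)) \<longlongrightarrow> D) (at z)" for z D
  proof -
    have "norm (F w - F z - (w - z) *\<^sub>C D) / norm (w - z)
        = norm (inverse (w - z) *\<^sub>C (F w - F z) - D)" if "w \<noteq> z" for w
    proof -
      have "D = inverse (w - z) *\<^sub>C (w - z) *\<^sub>C D" using that by (simp add: scaleC_scaleC)
      then have "inverse (w - z) *\<^sub>C (F w - F z) - D = inverse (w - z) *\<^sub>C (F w - F z - (w - z) *\<^sub>C D)"
        by (simp add: scaleC_diff_right)
      then show ?thesis by (simp add: norm_scaleC norm_inverse divide_inverse mult.commute)
    qed
    then have "((\<lambda>w. norm (F w - F z - (w - z) *\<^sub>C D) / norm (w - z)) \<longlongrightarrow> 0) (at z) \<longleftrightarrow>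
        ((\<lambda>w. norm (inverse (w - z) *\<^sub>C (F w - F z) - D)) \<longlongrightarrow> 0) (at z)"
      by (intro tendsto_cong) (auto simp: eventually_at_filter)
    also have "\<dots> \<longleftrightarrow> ((\<lambda>w. inverse (w - z) *\<^sub>C (F w - F z)) \<longlongrightarrow> D) (at z)"
      by (simp add: tendsto_norm_zero_iff LIM_zero_iff)
    finally show ?thesis
      by (simp add: has_derivative_iff_norm bounded_linear_scaleC_left)
  qed
  then show ?thesis by (simp add: analytic_on_disc_def)
qed

lemma analytic_on_disc_tendsto:
  assumes "analytic_on_disc F" "z \<in> ball 0 1"
  shows "(F \<longlongrightarrow> F z) (at z)"
proof -
  from assms obtain D where "(F has_derivative (\<lambda>h. h *\<^sub>C D)) (at z)"
    unfolding analytic_on_disc_def by blast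
  from has_derivative_continuous[OF this] show ?thesis by (simp add: continuous_at)
qed

lemma analytic_on_disc_const: "analytic_on_disc (\<lambda>_. C)"
  unfolding analytic_on_disc_iff_quotient by (auto intro!: exI[of _ 0])

lemma analytic_on_disc_add:
  assumes "analytic_on_disc F" "analytic_on_disc G"
  shows "analytic_on_disc (\<lambda>z. F z + G z)"
  unfolding analytic_on_disc_def
proof
  fix z :: complex assume "z \<in> ball 0 1"
  with assms obtain D E where "(F has_derivative (\<lambda>h. h *\<^sub>C D)) (at z)"
    "(G has_derivative (\<lambda>h. h *\<^sub>C E)) (at z)" unfolding analytic_on_disc_def by blast
  from has_derivative_add[OF this]
  show "\<exists>D. ((\<lambda>z. F z + G z) has_derivative (\<lambda>h. h *\<^sub>C D)) (at z)"
    by (auto simp flip: scaleC_add_right)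
qed

lemma analytic_on_disc_diff:
  assumes "analytic_on_disc F" "analytic_on_disc G"
  shows "analytic_on_disc (\<lambda>z. F z - G z)"
  unfolding analytic_on_disc_def
proof
  fix z :: complex assume "z \<in> ball 0 1"
  with assms obtain D E where "(F has_derivative (\<lambda>h. h *\<^sub>C D)) (at z)"
    "(G has_derivative (\<lambda>h. h *\<^sub>C E)) (at z)" unfolding analytic_on_disc_def by blast
  from has_derivative_diff[OF this]
  show "\<exists>D. ((\<lambda>z. F z - G z) has_derivative (\<lambda>h. h *\<^sub>C D)) (at z)"
    by (auto simp flip: scaleC_diff_right)
qed

lemma scaleC_blinfun_compose_left: "(c *\<^sub>C S) o\<^sub>L T = c *\<^sub>C (S o\<^sub>L T)"
  for S :: "'b::real_normed_vector \<Rightarrow>\<^sub>L 'c::complex_normed_vector" and T :: "'a::real_normed_vector \<Rightarrow>\<^sub>L 'b"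
  by (rule blinfun_eqI) (simp add: scaleC_blinfun.rep_eq)

lemma scaleC_blinfun_compose_right: "clinear_op S \<Longrightarrow> S o\<^sub>L (c *\<^sub>C T) = c *\<^sub>C (S o\<^sub>L T)"
  by (rule blinfun_eqI) (simp add: scaleC_blinfun.rep_eq clinear_opD)

lemma analytic_on_disc_compose:
  fixes F :: "complex \<Rightarrow> 'b::complex_normed_vector \<Rightarrow>\<^sub>L 'c::complex_normed_vector"
    and G :: "complex \<Rightarrow> 'a::complex_normed_vector \<Rightarrow>\<^sub>L 'b"
  assumes F: "analytic_on_disc F" and G: "analytic_on_disc G"
    and cl: "\<And>z. z \<in> ball 0 1 \<Longrightarrow> clinear_op (F z)"
  shows "analytic_on_disc (\<lambda>z. F z o\<^sub>L G z)"
  unfolding analytic_on_disc_iff_quotient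
proof
  fix z :: complex assume z: "z \<in> ball 0 1"
  with F G obtain D E where D: "((\<lambda>w. inverse (w - z) *\<^sub>C (F w - F z)) \<longlongrightarrow> D) (at z)"
    and E: "((\<lambda>w. inverse (w - z) *\<^sub>C (G w - G z)) \<longlongrightarrow> E) (at z)"
    unfolding analytic_on_disc_iff_quotient by blast
  have eq: "inverse (w - z) *\<^sub>C ((F w o\<^sub>L G w) - (F z o\<^sub>L G z))
      = ((inverse (w - z) *\<^sub>C (F w - F z)) o\<^sub>L G w) + (F z o\<^sub>L (inverse (w - z) *\<^sub>C (G w - G z)))" for w
  proof -
    have "(F w o\<^sub>L G w) - (F z o\<^sub>L G z) = ((F w - F z) o\<^sub>L G w) + (F z o\<^sub>L (G w - G z))"
      by (rule blinfun_eqI) (simp add: blinfun.bilinear_simps)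
    then show ?thesis
      by (simp add: scaleC_blinfun_compose_left scaleC_blinfun_compose_right[OF cl[OF z]] scaleC_add_right)
  qed
  have "((\<lambda>w. inverse (w - z) *\<^sub>C ((F w o\<^sub>L G w) - (F z o\<^sub>L G z))) \<longlongrightarrow> (D o\<^sub>L G z) + (F z o\<^sub>L E)) (at z)"
    unfolding eq
    by (intro tendsto_add bounded_bilinear.tendsto[OF bounded_bilinear_blinfun_compose]
        D E analytic_on_disc_tendsto[OF G z] tendsto_const)
  then show "\<exists>D. ((\<lambda>w. inverse (w - z) *\<^sub>C ((F w o\<^sub>L G w) - (F z o\<^sub>L G z))) \<longlongrightarrow> D) (at z)" ..
qed

text \<open>The resolvent identity \<open>S w - S z = - S w (K w - K z) S z\<close> gives in turn local boundedness,
  continuity and differentiability of the inverse \<open>S\<close>.\<close>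

lemma analytic_on_disc_inverse:
  fixes K :: "complex \<Rightarrow> 'a::complex_normed_vector \<Rightarrow>\<^sub>L 'b::complex_normed_vector"
  assumes K: "analytic_on_disc K"
    and cl: "\<And>z. z \<in> ball 0 1 \<Longrightarrow> clinear_op (S z)"
    and SK: "\<And>z. z \<in> ball 0 1 \<Longrightarrow> S z o\<^sub>L K z = id_blinfun"
    and KS: "\<And>z. z \<in> ball 0 1 \<Longrightarrow> K z o\<^sub>L S z = id_blinfun"
  shows "analytic_on_disc S"
  unfolding analytic_on_disc_iff_quotient
proof
  fix z :: complex assume z: "z \<in> ball 0 1"
  have ev: "\<forall>\<^sub>F w in at z. w \<in> ball 0 1"
    using z by (intro eventually_at_in_open') auto
  have res: "S w - S z = - (S w o\<^sub>L (K w - K z) o\<^sub>L S z)" if w: "w \<in> ball 0 1" for w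
  proof (rule blinfun_eqI)
    fix x
    have "S w (K w (S z x)) = S z x" "K z (S z x) = x"
      using arg_cong[OF SK[OF w], of "\<lambda>T. blinfun_apply T (S z x)"]
        arg_cong[OF KS[OF z], of "\<lambda>T. blinfun_apply T x"] by simp_all
    then show "(S w - S z) x = (- (S w o\<^sub>L (K w - K z) o\<^sub>L S z)) x"
      by (simp add: blinfun.bilinear_simps)
  qed
  have nb: "norm (S w - S z) \<le> norm (S w) * norm (K w - K z) * norm (S z)" if w: "w \<in> ball 0 1" for w
  proof -
    have "norm (S w - S z) \<le> norm (S w o\<^sub>L (K w - K z)) * norm (S z)"
      unfolding res[OF w] norm_minus_cancel by (rule norm_blinfun_compose)
    also have "\<dots> \<le> norm (S w) * norm (K w - K z) * norm (S z)"
      by (intro mult_right_mono norm_blinfun_compose) simp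
    finally show ?thesis .
  qed
  have K0: "((\<lambda>w. norm (K w - K z)) \<longlongrightarrow> 0) (at z)"
    using analytic_on_disc_tendsto[OF K z] by (simp add: tendsto_norm_zero_iff LIM_zero_iff)
  then have "((\<lambda>w. norm (K w - K z) * norm (S z)) \<longlongrightarrow> 0) (at z)" by (rule tendsto_mult_left_zero)
  then have ev2: "\<forall>\<^sub>F w in at z. norm (K w - K z) * norm (S z) < 1/2"
    by (rule order_tendstoD) simp
  have "\<forall>\<^sub>F w in at z. norm (S w - S z) \<le> 2 * norm (S z) * norm (K w - K z) * norm (S z)"
    using ev ev2
  proof eventually_elim
    case (elim w)
    have "norm (S w) \<le> norm (S z) + norm (S w - S z)" using norm_triangle_ineq[of "S z" "S w - S z"] by simp
    also have "norm (S w - S z) \<le> norm (S w) * (norm (K w - K z) * norm (S z))"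
      using nb[OF elim(1)] by (simp add: mult_ac)
    also have "\<dots> \<le> norm (S w) * (1/2)" using elim(2) by (intro mult_left_mono) auto
    finally have "norm (S w) \<le> 2 * norm (S z)" by simp
    then have "norm (S w) * norm (K w - K z) * norm (S z) \<le> 2 * norm (S z) * norm (K w - K z) * norm (S z)"
      by (intro mult_right_mono) auto
    with nb[OF elim(1)] show ?case by linarith
  qed
  moreover have "((\<lambda>w. 2 * norm (S z) * norm (K w - K z) * norm (S z)) \<longlongrightarrow> 0) (at z)"
    using K0 by (intro tendsto_mult_left_zero tendsto_mult_right_zero)
  ultimately have "((\<lambda>w. S w - S z) \<longlongrightarrow> 0) (at z)" by (rule Lim_null_comparison)
  then have S: "(S \<longlongrightarrow> S z) (at z)" by (simp add: LIM_zero_iff)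
  from K z obtain D where D: "((\<lambda>w. inverse (w - z) *\<^sub>C (K w - K z)) \<longlongrightarrow> D) (at z)"
    unfolding analytic_on_disc_iff_quotient by blast
  have lim: "((\<lambda>w. - (S w o\<^sub>L (inverse (w - z) *\<^sub>C (K w - K z)) o\<^sub>L S z)) \<longlongrightarrow> - (S z o\<^sub>L D o\<^sub>L S z)) (at z)"
    by (intro tendsto_minus bounded_bilinear.tendsto[OF bounded_bilinear_blinfun_compose] S D tendsto_const)
  have "\<forall>\<^sub>F w in at z. - (S w o\<^sub>L (inverse (w - z) *\<^sub>C (K w - K z)) o\<^sub>L S z)
      = inverse (w - z) *\<^sub>C (S w - S z)"
    using ev by eventually_elim
      (simp add: res cl scaleC_blinfun_compose_left scaleC_blinfun_compose_right scaleC_minus_right)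
  from Lim_transform_eventually[OF lim this]
  show "\<exists>D. ((\<lambda>w. inverse (w - z) *\<^sub>C (S w - S z)) \<longlongrightarrow> D) (at z)" ..
qed

text \<open>A bound other than \<open>1\<close> is kept because \<open>(I - \<Phi>\<^sub>1\<^sub>1 F)\<^sup>-\<^sup>1\<close>, which also has to act on the Hardy
  space, is in general not contractive.\<close>

definition bounded_analytic ::
    "real \<Rightarrow> (complex \<Rightarrow> 'a::complex_hilbert \<Rightarrow>\<^sub>L 'b::complex_hilbert) \<Rightarrow> bool"
  where "bounded_analytic M F \<longleftrightarrow>
    analytic_on_disc F \<and> (\<forall>z\<in>ball 0 1. clinear_op (F z) \<and> norm (F z) \<le> M)"

lemma schur_iff_bounded_analytic: "F \<in> schur \<longleftrightarrow> bounded_analytic 1 F"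
  by (auto simp: schur_def bounded_analytic_def contraction_def)

lemma bounded_analytic_nonneg: "bounded_analytic M F \<Longrightarrow> 0 \<le> M"
  unfolding bounded_analytic_def using norm_ge_zero[of "F 0"] by (meson centre_in_ball order_trans zero_less_one)

lemma bounded_analytic_norm_le:
  assumes "bounded_analytic M F" "z \<in> ball 0 1"
  shows "norm (F z x) \<le> M * norm x"
proof -
  have "norm (F z x) \<le> norm (F z) * norm x" by (rule norm_blinfun)
  also have "\<dots> \<le> M * norm x" using assms by (intro mult_right_mono) (auto simp: bounded_analytic_def)
  finally show ?thesis .
qed

lemma holomorphic_on_cinner:
  fixes F :: "complex \<Rightarrow> 'a::complex_hilbert \<Rightarrow>\<^sub>L 'b::complex_hilbert"
  assumes "analytic_on_disc F"
  shows "(\<lambda>z. cinner (F z x) y) holomorphic_on ball 0 1"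
  unfolding holomorphic_on_open[OF open_ball]
proof
  fix z :: complex assume "z \<in> ball 0 1"
  with assms obtain D where D: "(F has_derivative (\<lambda>h. h *\<^sub>C D)) (at z)"
    unfolding analytic_on_disc_def by blast
  have "bounded_linear (\<lambda>T::'a \<Rightarrow>\<^sub>L 'b. cinner (T x) y)"
    by (rule bounded_linear_compose[OF bounded_linear_cinner_left blinfun.bounded_linear_left])
  from bounded_linear.has_derivative[OF this D]
  have "((\<lambda>z. cinner (F z x) y) has_field_derivative cinner (D x) y) (at z)"
    unfolding has_field_derivative_def
    by (simp add: scaleC_blinfun.rep_eq cinner_scaleC_left mult_commute_abs)
  then show "\<exists>D. ((\<lambda>z. cinner (F z x) y) has_field_derivative D) (at z)" ..
qed


section \<open>Multiplication operators on the Hardy space\<close>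

text \<open>A weakly holomorphic, locally bounded function has a norm convergent Taylor series: the
  Taylor coefficients of \<open>\<langle>f z, y\<rangle>\<close> are bounded antilinear in \<open>y\<close> by the Cauchy inequality, hence
  given by vectors.\<close>

lemma weakly_holomorphic_taylor:
  fixes f :: "complex \<Rightarrow> 'a::complex_hilbert"
  assumes hol: "\<And>y. (\<lambda>z. cinner (f z) y) holomorphic_on ball 0 1"
    and bdd: "\<And>r. 0 < r \<Longrightarrow> r < 1 \<Longrightarrow> \<exists>B. \<forall>z. cmod z \<le> r \<longrightarrow> norm (f z) \<le> B"
  obtains a :: "nat \<Rightarrow> 'a" where "\<And>r. 0 \<le> r \<Longrightarrow> r < 1 \<Longrightarrow> summable (\<lambda>n. r ^ n * norm (a n))"
    "\<And>z. z \<in> ball 0 1 \<Longrightarrow> (\<lambda>n. z ^ n *\<^sub>C a n) sums f z"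
proof -
  define c where "c n y = (deriv ^^ n) (\<lambda>z. cinner (f z) y) 0 / fact n" for n y
  have cadd: "c n (x + y) = c n x + c n y" for n x y
  proof -
    have "(deriv ^^ n) (\<lambda>z. cinner (f z) x + cinner (f z) y) 0
        = (deriv ^^ n) (\<lambda>z. cinner (f z) x) 0 + (deriv ^^ n) (\<lambda>z. cinner (f z) y) 0"
      by (rule higher_deriv_add[OF hol hol]) auto
    then show ?thesis by (simp add: c_def cinner_add_right add_divide_distrib)
  qed
  have csc: "c n (t *\<^sub>C y) = cnj t * c n y" for n t y
  proof -
    have "(deriv ^^ n) (\<lambda>z. cnj t * cinner (f z) y) 0 = cnj t * (deriv ^^ n) (\<lambda>z. cinner (f z) y) 0"
      by (rule higher_deriv_cmult[OF hol]) auto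
    then show ?thesis by (simp add: c_def cinner_scaleC_right)
  qed
  have cb: "cmod (c n y) \<le> (B / r ^ n) * norm y"
    if r: "0 < r" "r < 1" and B: "\<And>z. cmod z \<le> r \<Longrightarrow> norm (f z) \<le> B" for n y r B
  proof -
    have "cmod ((deriv ^^ n) (\<lambda>z. cinner (f z) y) 0) \<le> fact n * (B * norm y) / r ^ n"
    proof (rule Cauchy_inequality)
      show "(\<lambda>z. cinner (f z) y) holomorphic_on ball 0 r"
        by (rule holomorphic_on_subset[OF hol]) (use r in auto)
      show "continuous_on (cball 0 r) (\<lambda>z. cinner (f z) y)"
        by (rule continuous_on_subset[OF holomorphic_on_imp_continuous_on[OF hol]]) (use r in auto)
      fix x :: complex assume "cmod (0 - x) = r"
      then have "norm (f x) \<le> B" by (intro B) simp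
      then show "cmod (cinner (f x) y) \<le> B * norm y"
        using cinner_cauchy_schwarz[of "f x" y] mult_right_mono[of "norm (f x)" B "norm y"] by simp
    qed (use r in auto)
    then show ?thesis by (simp add: c_def norm_divide field_simps)
  qed
  have "\<exists>w. \<forall>y. c n y = cinner w y" for n
  proof -
    obtain B where B: "\<And>z. cmod z \<le> 1/2 \<Longrightarrow> norm (f z) \<le> B" using bdd[of "1/2"] by auto
    have B0: "0 \<le> B" using B[of 0] norm_ge_zero[of "f 0"] by (simp del: norm_ge_zero)
    have "\<exists>w\<in>closure (range id_blinfun). (\<forall>y. cnj (c n y) = cinner (id_blinfun y) w) \<and> norm w \<le> B / (1/2) ^ n"
      by (rule representing_vector[OF clinear_op_id])
         (use cb[OF _ _ B, where n = n] B0 in \<open>simp_all add: cadd csc\<close>)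
    then show ?thesis by (metis blinfun_apply_id_blinfun cinner_commute complex_cnj_cnj id_apply)
  qed
  then obtain a where a: "\<And>n y. c n y = cinner (a n) y" by metis
  have ab: "norm (a n) \<le> B / r ^ n"
    if r: "0 < r" "r < 1" and B: "\<And>z. cmod z \<le> r \<Longrightarrow> norm (f z) \<le> B" for n r B
  proof (cases "a n = 0")
    case False
    have "norm (a n) * norm (a n) = cmod (c n (a n))"
      by (simp add: a cinner_self norm_power power2_eq_square norm_mult)
    also have "\<dots> \<le> (B / r ^ n) * norm (a n)" by (rule cb[OF r B])
    finally show ?thesis by (rule mult_right_le_imp_le) (use False in simp)
  next
    case True
    have "0 \<le> B" using order_trans[OF norm_ge_zero B[of 0]] r by simp
    with True r show ?thesis by simp
  qed
  have sm: "summable (\<lambda>n. r ^ n * norm (a n))" if r: "0 \<le> r" "r < 1" for r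
  proof -
    define s where "s = (1 + r) / 2"
    have s: "0 < s" "s < 1" "r < s" using r by (auto simp: s_def)
    obtain B where B: "\<And>z. cmod z \<le> s \<Longrightarrow> norm (f z) \<le> B" using bdd s by blast
    show ?thesis
    proof (rule summable_comparison_test')
      show "summable (\<lambda>n. B * (r / s) ^ n)"
        using s r by (intro summable_mult summable_geometric) auto
      fix n
      have "norm (r ^ n * norm (a n)) = r ^ n * norm (a n)" using r by simp
      also have "\<dots> \<le> r ^ n * (B / s ^ n)" by (intro mult_left_mono ab[OF s(1,2) B]) (use r in auto)
      finally show "norm (r ^ n * norm (a n)) \<le> B * (r / s) ^ n" by (simp add: power_divide mult_ac)
    qed
  qed
  have "(\<lambda>n. z ^ n *\<^sub>C a n) sums f z" if z: "z \<in> ball 0 1" for z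
  proof -
    have "summable (\<lambda>n. z ^ n *\<^sub>C a n)"
      by (rule summable_norm_cancel) (use sm[of "cmod z"] z in \<open>simp add: norm_scaleC norm_power\<close>)
    then obtain s where s: "(\<lambda>n. z ^ n *\<^sub>C a n) sums s" by (auto simp: summable_def)
    have "s = f z"
    proof (rule cinner_ext_left)
      fix y
      have "(\<lambda>n. cinner (z ^ n *\<^sub>C a n) y) sums cinner s y"
        by (rule bounded_linear.sums[OF bounded_linear_cinner_left s])
      then have "(\<lambda>n. c n y * z ^ n) sums cinner s y" by (simp add: cinner_scaleC_left a mult.commute)
      moreover have "(\<lambda>n. c n y * z ^ n) sums cinner (f z) y"
        using holomorphic_power_series[OF hol z] by (simp add: c_def)
      ultimately show "cinner s y = cinner (f z) y" by (rule sums_unique2)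
    qed
    with s show ?thesis by simp
  qed
  with sm show ?thesis by (rule that)
qed

lemma sum_roots_of_unity_orthogonal:
  fixes m n N :: nat
  assumes "m < N" "n < N"
  defines "w \<equiv> cis (2 * pi / real N)"
  shows "(\<Sum>j<N. (w ^ j) ^ m * cnj ((w ^ j) ^ n)) = (if m = n then of_nat N else 0)"
proof -
  define q where "q = w ^ m * cnj (w ^ n)"
  have N: "N > 0" using assms by simp
  have cw: "w * cnj w = 1" by (simp add: w_def cis_cnj cis_mult)
  have wp: "w ^ k = cis (2 * pi * real k / real N)" for k
    unfolding w_def Complex.DeMoivre by (simp add: mult_ac)
  have wN: "w ^ N = 1" using N by (simp add: wp)
  have qj: "(w ^ j) ^ m * cnj ((w ^ j) ^ n) = q ^ j" for j
    by (simp add: q_def power_mult_distrib flip: power_mult complex_cnj_power) (simp add: mult.commute)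
  have cn: "w ^ n * cnj (w ^ n) = 1" by (simp add: cw flip: power_mult_distrib)
  show ?thesis
  proof (cases "m = n")
    case True
    then have "q = 1" using cn by (simp add: q_def)
    then show ?thesis unfolding qj using True by simp
  next
    case False
    have "q \<noteq> 1"
    proof
      assume "q = 1"
      have "w ^ m = w ^ m * (w ^ n * cnj (w ^ n))" by (simp only: cn mult_1_right)
      also have "\<dots> = w ^ n * q" by (simp only: q_def mult_ac)
      finally have "w ^ m = w ^ n" using \<open>q = 1\<close> by simp
      then have "cis (2 * pi * real m / real N) = cis (2 * pi * real n / real N)"
        by (simp add: wp)
      with bij_betw_imp_inj_on[OF Complex.bij_betw_roots_unity[OF N]] assms(1,2) have "m = n"
        by (auto dest!: inj_onD)
      with False show False by simp
    qed
    moreover have "q ^ N = 1"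
    proof -
      have "(w ^ k) ^ N = 1" for k by (metis wN power_mult mult.commute power_one)
      moreover have "q ^ N = (w ^ m) ^ N * cnj ((w ^ n) ^ N)"
        by (simp only: q_def power_mult_distrib complex_cnj_power)
      ultimately show ?thesis by (simp del: complex_cnj_power)
    qed
    ultimately show ?thesis unfolding qj using False by (simp add: geometric_sum)
  qed
qed

text \<open>Parseval's identity for a polynomial, with the circle replaced by sufficiently many equally
  spaced points.\<close>

lemma discrete_parseval:
  fixes a :: "nat \<Rightarrow> 'a::complex_inner" and r :: real and N :: nat
  defines "p \<equiv> \<lambda>j. of_real r * cis (2 * pi / real N) ^ j"
  shows "(\<Sum>j<N. (norm (\<Sum>m<N. p j ^ m *\<^sub>C a m))\<^sup>2) = real N * (\<Sum>m<N. (r ^ m * norm (a m))\<^sup>2)"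
proof -
  let ?w = "cis (2 * pi / real N)"
  have suml: "cinner (\<Sum>m<N. g m) y = (\<Sum>m<N. cinner (g m) y)" for g and y :: 'a
    by (rule linear_sum[OF bounded_linear.linear[OF bounded_linear_cinner_left]])
  have sumr: "cinner y (\<Sum>m<N. g m) = (\<Sum>m<N. cinner y (g m))" for g and y :: 'a
    by (rule linear_sum[OF bounded_linear.linear[OF bounded_linear_cinner_right]])
  have "complex_of_real (\<Sum>j<N. (norm (\<Sum>m<N. p j ^ m *\<^sub>C a m))\<^sup>2)
      = (\<Sum>j<N. cinner (\<Sum>m<N. p j ^ m *\<^sub>C a m) (\<Sum>n<N. p j ^ n *\<^sub>C a n))"
    by (simp add: cinner_self)
  also have "\<dots> = (\<Sum>j<N. \<Sum>m<N. \<Sum>n<N. (of_real (r ^ m * r ^ n) * cinner (a m) (a n)) *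
      ((?w ^ j) ^ m * cnj ((?w ^ j) ^ n)))"
    unfolding suml unfolding sumr
    by (intro sum.cong refl)
       (simp add: cinner_scaleC_left cinner_scaleC_right p_def power_mult_distrib mult_ac)
  also have "\<dots> = (\<Sum>m<N. \<Sum>n<N. \<Sum>j<N. (of_real (r ^ m * r ^ n) * cinner (a m) (a n)) *
      ((?w ^ j) ^ m * cnj ((?w ^ j) ^ n)))"
    by (subst sum.swap) (intro sum.cong refl sum.swap)
  also have "\<dots> = (\<Sum>m<N. \<Sum>n<N. (of_real (r ^ m * r ^ n) * cinner (a m) (a n)) *
      (if m = n then of_nat N else 0))"
    by (intro sum.cong refl) (simp only: sum_roots_of_unity_orthogonal lessThan_iff flip: sum_distrib_left)
  also have "\<dots> = (\<Sum>m<N. of_real (r ^ m * r ^ m) * cinner (a m) (a m) * of_nat N)"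
    by (intro sum.cong refl) (simp add: if_distrib cong: if_cong)
  also have "\<dots> = complex_of_real (real N * (\<Sum>m<N. (r ^ m * norm (a m))\<^sup>2))"
    by (simp add: cinner_self sum_distrib_left power_mult_distrib power2_eq_square mult_ac)
  finally show ?thesis by (simp only: of_real_eq_iff)
qed

lemma powser_tail_norm_le:
  fixes a :: "nat \<Rightarrow> 'a::complex_hilbert"
  assumes "(\<lambda>n. z ^ n *\<^sub>C a n) sums s" and "summable (\<lambda>n. r ^ n * norm (a n))" and "cmod z \<le> r"
  shows "norm (s - (\<Sum>m<N. z ^ m *\<^sub>C a m)) \<le> (\<Sum>n. r ^ n * norm (a n)) - (\<Sum>m<N. r ^ m * norm (a m))"
proof (rule norm_sums_le)
  show "(\<lambda>n. z ^ (n + N) *\<^sub>C a (n + N)) sums (s - (\<Sum>m<N. z ^ m *\<^sub>C a m))"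
    by (rule sums_split_initial_segment[OF assms(1)])
  show "(\<lambda>n. r ^ (n + N) * norm (a (n + N))) sums ((\<Sum>n. r ^ n * norm (a n)) - (\<Sum>m<N. r ^ m * norm (a m)))"
    by (rule sums_split_initial_segment[OF summable_sums[OF assms(2)]])
  show "norm (z ^ (n + N) *\<^sub>C a (n + N)) \<le> r ^ (n + N) * norm (a (n + N))" for n
    unfolding norm_scaleC norm_power
    by (intro mult_right_mono power_mono assms(3)) auto
qed

lemma summable_power_norm_hardy_coeff:
  assumes "0 \<le> r" "r < 1"
  shows "summable (\<lambda>n. r ^ n * norm (hardy_coeff h n))"
proof (rule summable_comparison_test')
  have "norm (r\<^sup>2) < 1" using assms by (simp add: abs_square_less_1)
  then show "summable (\<lambda>n. (r\<^sup>2) ^ n + (norm (hardy_coeff h n))\<^sup>2)"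
    by (intro summable_add summable_geometric summable_hardy)
  fix n
  have "r ^ n * norm (hardy_coeff h n) \<le> (r ^ n)\<^sup>2 + (norm (hardy_coeff h n))\<^sup>2"
    using assms by (intro mult_le_sum_power2) auto
  then show "norm (r ^ n * norm (hardy_coeff h n)) \<le> (r\<^sup>2) ^ n + (norm (hardy_coeff h n))\<^sup>2"
    using assms by (simp add: power_mult[symmetric] mult.commute)
qed

lemma norm_hardy_fun_le:
  assumes "cmod z \<le> r" "r < 1"
  shows "norm (hardy_fun h z) \<le> (\<Sum>n. r ^ n * norm (hardy_coeff h n))"
proof -
  have r: "0 \<le> r" using assms norm_ge_zero[of z] by linarith
  show ?thesis
    using powser_tail_norm_le[OF hardy_coeff_sums summable_power_norm_hardy_coeff[OF r assms(2)] assms(1),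
        where N = 0 and h1 = h] assms by simp
qed

text \<open>The function is the locally uniform limit of the sums of \<open>z\<^sup>k \<langle>F z h\<^sub>k, y\<rangle>\<close> over the Taylor
  coefficients \<open>h\<^sub>k\<close> of \<open>h\<close>.\<close>

lemma holomorphic_on_mult_hardy:
  assumes F: "bounded_analytic M F"
  shows "(\<lambda>z. cinner (F z (hardy_fun h z)) y) holomorphic_on ball 0 1"
proof (rule holomorphic_uniform_sequence[OF open_ball])
  let ?b = "hardy_coeff h"
  have aF: "analytic_on_disc F" and cF: "\<And>z. z \<in> ball 0 1 \<Longrightarrow> clinear_op (F z)"
    using F by (auto simp: bounded_analytic_def)
  let ?f = "\<lambda>k z. z ^ k * cinner (F z (?b k)) y"
  show "(\<lambda>z. \<Sum>k<n. ?f k z) holomorphic_on ball 0 1" for n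
    by (intro holomorphic_intros holomorphic_on_cinner aF)
  fix x :: complex assume x: "x \<in> ball 0 1"
  then obtain d where d: "0 < d" "cball x d \<subseteq> ball 0 1"
    using open_contains_cball_eq[OF open_ball] by blast
  have cp: "compact (cmod ` cball x d)"
    by (intro compact_continuous_image continuous_intros) simp
  have ne: "cmod ` cball x d \<noteq> {}" using d by auto
  obtain r where r: "r \<in> cmod ` cball x d" "\<And>z. z \<in> cball x d \<Longrightarrow> cmod z \<le> r"
    using compact_attains_sup[OF cp ne] by blast
  have r1: "0 \<le> r" "r < 1" using r(1) d(2) by auto
  have "uniform_limit (cball x d) (\<lambda>n z. \<Sum>k<n. ?f k z) (\<lambda>z. \<Sum>k. ?f k z) sequentially"
  proof (rule Weierstrass_m_test)
    show "summable (\<lambda>k. M * norm y * (r ^ k * norm (?b k)))"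
      by (intro summable_mult summable_power_norm_hardy_coeff r1)
    fix k z assume z: "z \<in> cball x d"
    then have zb: "z \<in> ball 0 1" using d by auto
    have "cmod (cinner (F z (?b k)) y) \<le> norm (F z (?b k)) * norm y" by (rule cinner_cauchy_schwarz)
    also have "\<dots> \<le> (M * norm (?b k)) * norm y"
      by (intro mult_right_mono bounded_analytic_norm_le[OF F zb]) simp
    finally have "cmod z ^ k * cmod (cinner (F z (?b k)) y) \<le> r ^ k * ((M * norm (?b k)) * norm y)"
      using r(2)[OF z] by (intro mult_mono power_mono) (auto simp: r1)
    then show "cmod (?f k z) \<le> M * norm y * (r ^ k * norm (?b k))"
      by (simp add: norm_mult norm_power mult_ac)
  qed
  moreover have "(\<Sum>k. ?f k z) = cinner (F z (hardy_fun h z)) y" if z: "z \<in> cball x d" for z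
  proof -
    have zb: "z \<in> ball 0 1" using d z by auto
    have "bounded_linear (\<lambda>v. cinner (F z v) y)"
      by (rule bounded_linear_compose[OF bounded_linear_cinner_left blinfun.bounded_linear_right])
    from bounded_linear.sums[OF this hardy_coeff_sums[OF zb]]
    have "(\<lambda>k. ?f k z) sums cinner (F z (hardy_fun h z)) y"
      by (simp add: clinear_opD[OF cF[OF zb]] cinner_scaleC_left)
    then show ?thesis by (rule sums_unique[symmetric])
  qed
  ultimately have "uniform_limit (cball x d) (\<lambda>n z. \<Sum>k<n. ?f k z)
      (\<lambda>z. cinner (F z (hardy_fun h z)) y) sequentially"
    by (subst uniform_limit_cong'[where g = "\<lambda>n z. \<Sum>k<n. ?f k z" and i = "\<lambda>z. \<Sum>k. ?f k z"]) auto
  with d show "\<exists>d. 0 < d \<and> cball x d \<subseteq> ball 0 1 \<and> uniform_limit (cball x d)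
      (\<lambda>n z. \<Sum>k<n. ?f k z) (\<lambda>z. cinner (F z (hardy_fun h z)) y) sequentially" by blast
qed

text \<open>Pointwise \<open>\<parallel>F h\<parallel> \<le> M \<parallel>h\<parallel>\<close> is summed over \<open>N\<close> equally spaced points of a circle of radius
  \<open>r\<close>; after replacing both functions by their Taylor polynomials of degree less than \<open>N\<close>, at the
  cost of tails that vanish as \<open>N\<close> grows, the discrete Parseval identity turns this into an
  inequality between the coefficients.\<close>

lemma hardy_multiplication_coeff_bound:
  assumes F: "bounded_analytic M F" and r: "0 < r" "r < 1"
    and a: "summable (\<lambda>n. r ^ n * norm (a n))"
    and sm: "\<And>z. z \<in> ball 0 1 \<Longrightarrow> (\<lambda>n. z ^ n *\<^sub>C a n) sums F z (hardy_fun h z)"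
  shows "(\<Sum>m<K. (r ^ m * norm (a m))\<^sup>2) \<le> (M * norm h)\<^sup>2"
proof -
  let ?b = "hardy_coeff h"
  note M0 = bounded_analytic_nonneg[OF F]
  note b = summable_power_norm_hardy_coeff[OF less_imp_le[OF r(1)] r(2), of h]
  define \<epsilon> where "\<epsilon> N = (\<Sum>n. r ^ n * norm (a n)) - (\<Sum>m<N. r ^ m * norm (a m))" for N
  define \<delta> where "\<delta> N = (\<Sum>n. r ^ n * norm (?b n)) - (\<Sum>m<N. r ^ m * norm (?b m))" for N
  have "sqrt (\<Sum>m<K. (r ^ m * norm (a m))\<^sup>2) \<le> M * norm h + (M * \<delta> N + \<epsilon> N)"
    if N: "K \<le> N" "0 < N" for N
  proof -
    define p where "p j = complex_of_real r * cis (2 * pi / real N) ^ j" for j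
    have cp: "cmod (p j) = r" for j using r by (simp add: p_def norm_mult norm_power)
    then have pb: "p j \<in> ball 0 1" for j using r by simp
    let ?a = "\<lambda>j. \<Sum>m<N. p j ^ m *\<^sub>C a m" and ?h = "\<lambda>j. \<Sum>m<N. p j ^ m *\<^sub>C ?b m"
    have pt: "norm (?a j) \<le> M * norm (?h j) + (M * \<delta> N + \<epsilon> N)" for j
    proof -
      let ?v = "F (p j) (hardy_fun h (p j))"
      have "norm (?a j) \<le> norm ?v + norm (?v - ?a j)"
        using norm_triangle_ineq4[of ?v "?v - ?a j"] by simp
      moreover have "norm (?v - ?a j) \<le> \<epsilon> N"
        unfolding \<epsilon>_def by (rule powser_tail_norm_le[OF sm[OF pb] a]) (simp add: cp)
      moreover have "norm ?v \<le> M * norm (hardy_fun h (p j))"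
        by (rule bounded_analytic_norm_le[OF F pb])
      moreover have "M * norm (hardy_fun h (p j)) \<le> M * (norm (?h j) + \<delta> N)"
      proof (rule mult_left_mono[OF _ M0])
        have "norm (hardy_fun h (p j) - ?h j) \<le> \<delta> N"
          unfolding \<delta>_def by (rule powser_tail_norm_le[OF hardy_coeff_sums[OF pb] b]) (simp add: cp)
        then show "norm (hardy_fun h (p j)) \<le> norm (?h j) + \<delta> N"
          using norm_triangle_ineq[of "?h j" "hardy_fun h (p j) - ?h j"] by simp
      qed
      ultimately show ?thesis by (simp add: distrib_left)
    qed
    have "sqrt (real N) * sqrt (\<Sum>m<N. (r ^ m * norm (a m))\<^sup>2) = L2_set (\<lambda>j. norm (?a j)) {..<N}"
      unfolding L2_set_def p_def discrete_parseval by (rule real_sqrt_mult[symmetric])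
    also have "\<dots> \<le> L2_set (\<lambda>j. M * norm (?h j) + (M * \<delta> N + \<epsilon> N)) {..<N}"
      by (rule L2_set_mono) (use pt in auto)
    also have "\<dots> \<le> L2_set (\<lambda>j. M * norm (?h j)) {..<N} + L2_set (\<lambda>j. M * \<delta> N + \<epsilon> N) {..<N}"
      by (rule L2_set_triangle_ineq)
    also have "L2_set (\<lambda>j. M * norm (?h j)) {..<N} = M * L2_set (\<lambda>j. norm (?h j)) {..<N}"
      by (rule L2_set_right_distrib[OF M0, symmetric])
    also have "L2_set (\<lambda>j. norm (?h j)) {..<N} = sqrt (real N) * sqrt (\<Sum>m<N. (r ^ m * norm (?b m))\<^sup>2)"
      unfolding L2_set_def p_def discrete_parseval by (rule real_sqrt_mult)
    also have "M * (sqrt (real N) * sqrt (\<Sum>m<N. (r ^ m * norm (?b m))\<^sup>2)) \<le> M * (sqrt (real N) * norm h)"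
    proof (intro mult_left_mono real_le_lsqrt M0)
      have "(\<Sum>m<N. (r ^ m * norm (?b m))\<^sup>2) \<le> (\<Sum>m<N. (norm (?b m))\<^sup>2)"
        using r by (intro sum_mono power_mono mult_left_le_one_le) (auto simp: power_le_one)
      also have "\<dots> \<le> (norm h)\<^sup>2"
        unfolding norm_hardy_power2 by (intro sum_le_suminf summable_hardy) auto
      finally show "(\<Sum>m<N. (r ^ m * norm (?b m))\<^sup>2) \<le> (norm h)\<^sup>2" .
    qed (auto simp: sum_nonneg)
    also have "L2_set (\<lambda>j. M * \<delta> N + \<epsilon> N) {..<N} = sqrt (real N) * (M * \<delta> N + \<epsilon> N)"
    proof -
      have "0 \<le> \<delta> N" "0 \<le> \<epsilon> N"
        unfolding \<delta>_def \<epsilon>_def using r by (auto intro!: sum_le_suminf a b)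
      then show ?thesis using M0 by (simp add: L2_set_constant)
    qed
    finally have "sqrt (real N) * sqrt (\<Sum>m<N. (r ^ m * norm (a m))\<^sup>2)
        \<le> sqrt (real N) * (M * norm h + (M * \<delta> N + \<epsilon> N))"
      by (simp add: algebra_simps)
    then have "sqrt (\<Sum>m<N. (r ^ m * norm (a m))\<^sup>2) \<le> M * norm h + (M * \<delta> N + \<epsilon> N)"
      using N by simp
    moreover have "(\<Sum>m<K. (r ^ m * norm (a m))\<^sup>2) \<le> (\<Sum>m<N. (r ^ m * norm (a m))\<^sup>2)"
      using N by (intro sum_mono2) auto
    ultimately show ?thesis using real_sqrt_le_mono order_trans by blast
  qed
  then have "\<exists>N0. \<forall>N\<ge>N0. sqrt (\<Sum>m<K. (r ^ m * norm (a m))\<^sup>2) \<le> M * norm h + (M * \<delta> N + \<epsilon> N)"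
    by (intro exI[of _ "Suc K"]) auto
  moreover have "(\<lambda>N. M * norm h + (M * \<delta> N + \<epsilon> N)) \<longlonglongrightarrow> M * norm h + (M * (S - S) + (T - T))"
    if "S = (\<Sum>n. r ^ n * norm (?b n))" "T = (\<Sum>n. r ^ n * norm (a n))" for S T
    unfolding \<delta>_def \<epsilon>_def that by (intro tendsto_intros summable_LIMSEQ a b)
  ultimately have "sqrt (\<Sum>m<K. (r ^ m * norm (a m))\<^sup>2) \<le> M * norm h"
    using LIMSEQ_le_const by (metis (no_types, lifting) diff_self mult_zero_right add_0_right)
  then have "(sqrt (\<Sum>m<K. (r ^ m * norm (a m))\<^sup>2))\<^sup>2 \<le> (M * norm h)\<^sup>2"
    by (intro power_mono) (auto simp: sum_nonneg)
  then show ?thesis by (simp add: sum_nonneg)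
qed

text \<open>The coefficient bound is uniform in \<open>r\<close>, so it survives \<open>r \<rightarrow> 1\<close>.\<close>

lemma hardy_multiplication:
  assumes F: "bounded_analytic M F"
  obtains g where "hardy_fun g = (\<lambda>z. if z \<in> ball 0 1 then F z (hardy_fun h z) else 0)"
    "norm g \<le> M * norm h"
proof -
  let ?f = "\<lambda>z. F z (hardy_fun h z)"
  note M0 = bounded_analytic_nonneg[OF F]
  have bdd: "\<exists>B. \<forall>z. cmod z \<le> r \<longrightarrow> norm (?f z) \<le> B" if r: "0 < r" "r < 1" for r
  proof (intro exI allI impI)
    fix z assume z: "cmod z \<le> r"
    then have "norm (?f z) \<le> M * norm (hardy_fun h z)"
      using r by (intro bounded_analytic_norm_le[OF F]) auto
    also have "\<dots> \<le> M * (\<Sum>n. r ^ n * norm (hardy_coeff h n))"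
      by (intro mult_left_mono norm_hardy_fun_le z r M0)
    finally show "norm (?f z) \<le> M * (\<Sum>n. r ^ n * norm (hardy_coeff h n))" .
  qed
  obtain a where a: "\<And>r. 0 \<le> r \<Longrightarrow> r < 1 \<Longrightarrow> summable (\<lambda>n. r ^ n * norm (a n))"
    "\<And>z. z \<in> ball 0 1 \<Longrightarrow> (\<lambda>n. z ^ n *\<^sub>C a n) sums ?f z"
    by (rule weakly_holomorphic_taylor[OF holomorphic_on_mult_hardy[OF F] bdd]) (blast intro: that)+
  have fin: "(\<Sum>m<K. (norm (a m))\<^sup>2) \<le> (M * norm h)\<^sup>2" for K
  proof (rule LIMSEQ_le_const2)
    define \<rho> where "\<rho> n = 1 - inverse (real (Suc (Suc n)))" for n
    have "\<rho> \<longlonglongrightarrow> 1 - 0"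
      unfolding \<rho>_def by (intro tendsto_intros LIMSEQ_Suc[OF LIMSEQ_inverse_real_of_nat])
    then have "\<rho> \<longlonglongrightarrow> 1" by simp
    then have "(\<lambda>n. \<Sum>m<K. (\<rho> n ^ m * norm (a m))\<^sup>2) \<longlonglongrightarrow> (\<Sum>m<K. (1 ^ m * norm (a m))\<^sup>2)"
      by (intro tendsto_intros)
    then show "(\<lambda>n. \<Sum>m<K. (\<rho> n ^ m * norm (a m))\<^sup>2) \<longlonglongrightarrow> (\<Sum>m<K. (norm (a m))\<^sup>2)" by simp
    have "0 < \<rho> n" "\<rho> n < 1" for n by (simp_all add: \<rho>_def field_simps)
    then show "\<exists>N. \<forall>n\<ge>N. (\<Sum>m<K. (\<rho> n ^ m * norm (a m))\<^sup>2) \<le> (M * norm h)\<^sup>2"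
      using hardy_multiplication_coeff_bound[OF F _ _ a] less_imp_le by blast
  qed
  have ss: "square_summable a" unfolding square_summable_def
    by (rule summableI_nonneg_bounded[OF _ fin]) simp
  let ?g = "Abs_hardy (\<lambda>z. if z \<in> ball 0 1 then ?f z else 0)"
  note Abs = hardy_fun_Abs[OF ss, of "\<lambda>z. if z \<in> ball 0 1 then ?f z else 0"]
    hardy_coeff_Abs[OF ss, of "\<lambda>z. if z \<in> ball 0 1 then ?f z else 0"]
  have 1: "hardy_fun ?g = (\<lambda>z. if z \<in> ball 0 1 then ?f z else 0)" by (rule Abs(1)) (use a in auto)
  have 2: "hardy_coeff ?g = a" by (rule Abs(2)) (use a in auto)
  have "(norm ?g)\<^sup>2 \<le> (M * norm h)\<^sup>2"
    unfolding norm_hardy_power2 2 by (intro suminf_le_const fin) (use ss in \<open>simp add: square_summable_def\<close>)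
  then have "norm ?g \<le> M * norm h" by (rule power2_le_imp_le) (use M0 in simp)
  with 1 show ?thesis by (rule that)
qed

lemma hardy_fun_eqI:
  assumes "\<And>z. z \<in> ball 0 1 \<Longrightarrow> hardy_fun g z = hardy_fun h z"
  shows "g = h"
proof -
  have "hardy_fun g = hardy_fun h" using assms hardy_fun_outside by (metis ext)
  then show ?thesis by (simp add: hardy_fun_inject)
qed

lemma
  assumes F: "bounded_analytic M F"
  shows hardy_fun_mult_op: "z \<in> ball 0 1 \<Longrightarrow> hardy_fun (mult_op F h) z = F z (hardy_fun h z)"
    and norm_mult_op_le: "norm (mult_op F h) \<le> M * norm h"
    and clinear_mult_op: "clinear_op (mult_op F)"
proof -
  define T where "T h = Abs_hardy (\<lambda>z. if z \<in> ball 0 1 then F z (hardy_fun h z) else 0)" for h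
  have T: "hardy_fun (T h) = (\<lambda>z. if z \<in> ball 0 1 then F z (hardy_fun h z) else 0)"
    and nT: "norm (T h) \<le> M * norm h" for h
  proof -
    obtain g where g: "hardy_fun g = (\<lambda>z. if z \<in> ball 0 1 then F z (hardy_fun h z) else 0)"
      "norm g \<le> M * norm h" by (rule hardy_multiplication[OF F])
    then have "T h = g" unfolding T_def by (metis hardy_fun_inverse)
    with g show "hardy_fun (T h) = (\<lambda>z. if z \<in> ball 0 1 then F z (hardy_fun h z) else 0)"
      "norm (T h) \<le> M * norm h" by simp_all
  qed
  have sc: "T (c *\<^sub>C h) = c *\<^sub>C T h" for c h
  proof (rule hardy_fun_eqI)
    fix z :: complex assume z: "z \<in> ball 0 1"
    then have "clinear_op (F z)" using F by (simp add: bounded_analytic_def)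
    then show "hardy_fun (T (c *\<^sub>C h)) z = hardy_fun (c *\<^sub>C T h) z"
      by (simp add: T hardy_fun_scaleC clinear_opD)
  qed
  have ad: "T (h + g) = T h + T g" for h g
    by (rule hardy_fun_eqI) (simp add: T hardy_fun_add blinfun.add_right)
  have "bounded_linear T"
  proof (rule bounded_linear_intro[where K = M])
    show "norm (T h) \<le> norm h * M" for h using nT[of h] by (simp add: mult.commute)
  qed (simp_all only: ad sc scaleR_scaleC)
  then have eq: "mult_op F h = T h" for h
    unfolding mult_op_def T_def[symmetric] by (simp add: bounded_linear_Blinfun_apply)
  show "z \<in> ball 0 1 \<Longrightarrow> hardy_fun (mult_op F h) z = F z (hardy_fun h z)" by (simp add: eq T)
  show "norm (mult_op F h) \<le> M * norm h" by (simp add: eq nT)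
  show "clinear_op (mult_op F)" unfolding clinear_op_def eq using sc by blast
qed

lemma contraction_mult_op: "F \<in> schur \<Longrightarrow> contraction (mult_op F)"
  unfolding schur_iff_bounded_analytic
  by (rule contractionI) (use clinear_mult_op norm_mult_op_le[of 1] in auto)

section \<open>Invertibility of the loop operator\<close>

lemma inverse_op_eqI:
  assumes "S o\<^sub>L T = id_blinfun" "T o\<^sub>L S = id_blinfun"
  shows "inverse_op T = S"
  unfolding inverse_op_def
proof (rule the_equality)
  fix R assume R: "R o\<^sub>L T = id_blinfun \<and> T o\<^sub>L R = id_blinfun"
  have "R x = S x" for x
  proof -
    have "(R o\<^sub>L T) (S x) = S x" using R by simp
    then show ?thesis using arg_cong[OF assms(2), of "\<lambda>A. blinfun_apply A x"] by simp
  qed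
  then show "R = S" by (rule blinfun_eqI)
qed (use assms in simp)

lemma
  assumes "invertible_op T"
  shows inverse_op_left: "inverse_op T o\<^sub>L T = id_blinfun"
    and inverse_op_right: "T o\<^sub>L inverse_op T = id_blinfun"
proof -
  obtain S where "S o\<^sub>L T = id_blinfun" "T o\<^sub>L S = id_blinfun"
    using assms unfolding invertible_op_def by blast
  moreover from this have "inverse_op T = S" by (rule inverse_op_eqI)
  ultimately show "inverse_op T o\<^sub>L T = id_blinfun" "T o\<^sub>L inverse_op T = id_blinfun" by simp_all
qed

lemma
  assumes "invertible_op T"
  shows inverse_op_apply_left: "inverse_op T (T x) = x"
    and inverse_op_apply_right: "T (inverse_op T y) = y"
  using arg_cong[OF inverse_op_left[OF assms], of "\<lambda>A. blinfun_apply A x"]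
    arg_cong[OF inverse_op_right[OF assms], of "\<lambda>A. blinfun_apply A y"] by simp_all

lemma clinear_inverse_op:
  fixes T :: "'a::complex_normed_vector \<Rightarrow>\<^sub>L 'b::complex_normed_vector"
  assumes "invertible_op T" "clinear_op T"
  shows "clinear_op (inverse_op T)"
  unfolding clinear_op_def
proof (intro allI)
  fix c y
  have "inverse_op T (c *\<^sub>C y) = inverse_op T (T (c *\<^sub>C inverse_op T y))"
    by (simp add: clinear_opD[OF assms(2)] inverse_op_apply_right[OF assms(1)])
  then show "inverse_op T (c *\<^sub>C y) = c *\<^sub>C inverse_op T y"
    by (simp add: inverse_op_apply_left[OF assms(1)])
qed

text \<open>Both \<open>I - K\<close> and its adjoint are bounded below by \<open>1 - \<rho>\<close>.\<close>

lemma
  fixes K :: "'a::complex_hilbert \<Rightarrow>\<^sub>L 'a"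
  assumes K: "clinear_op K" and n: "norm K \<le> \<rho>" and \<rho>: "\<rho> < 1"
  shows invertible_id_minus: "invertible_op (id_blinfun - K)"
    and norm_inverse_id_minus: "norm (inverse_op (id_blinfun - K)) \<le> 1 / (1 - \<rho>)"
proof -
  let ?T = "id_blinfun - K"
  have cT: "clinear_op ?T" by (intro clinear_op_diff clinear_op_id K)
  have bb: "norm x \<le> (1 / (1 - \<rho>)) * norm ((id_blinfun - L) x)" if L: "norm L \<le> \<rho>" for L :: "'a \<Rightarrow>\<^sub>L 'a" and x
  proof -
    have "norm x \<le> norm (x - L x) + norm (L x)" using norm_triangle_ineq[of "x - L x" "L x"] by simp
    also have "norm (L x) \<le> \<rho> * norm x"
      using norm_blinfun[of L x] mult_right_mono[OF L, of "norm x"] by simp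
    finally show ?thesis using \<rho> by (simp add: blinfun.diff_left field_simps)
  qed
  have adj: "cadj ?T = id_blinfun - cadj K"
    by (rule cadj_eqI) (simp add: blinfun.diff_left cinner_diff_left cinner_diff_right cinner_cadj[OF K])
  have "norm (cadj K) \<le> \<rho>" using norm_cadj_le[OF K] n by linarith
  then have "norm g \<le> (1 / (1 - \<rho>)) * norm (cadj ?T g)" for g unfolding adj by (rule bb)
  then obtain W where W: "?T o\<^sub>L W = id_blinfun"
    by (rule right_inverse_if_adjoint_bounded_below[OF cT]) (use \<rho> in auto)
  have TW: "?T (W y) = y" for y using arg_cong[OF W, of "\<lambda>A. blinfun_apply A y"] by simp
  have "W (?T x) = x" for x
  proof -
    have "?T (W (?T x) - x) = 0" by (simp only: blinfun.diff_right TW) simp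
    with bb[OF n, of "W (?T x) - x"] show ?thesis by simp
  qed
  then have W': "W o\<^sub>L ?T = id_blinfun" by (intro blinfun_eqI) simp
  with W show "invertible_op ?T" unfolding invertible_op_def by blast
  have "norm W \<le> 1 / (1 - \<rho>)"
    by (rule norm_blinfun_bound) (use bb[OF n, of "W _"] TW \<rho> in auto)
  then show "norm (inverse_op ?T) \<le> 1 / (1 - \<rho>)" by (simp add: inverse_op_eqI[OF W' W])
qed

text \<open>The Schwarz lemma for \<open>(\<phi> - a) / (1 - cnj a \<phi>)\<close> with \<open>a = \<phi> 0\<close>.\<close>

lemma schwarz_pick_bound:
  assumes hol: "\<phi> holomorphic_on ball 0 1" and lt: "\<And>z. cmod z < 1 \<Longrightarrow> cmod (\<phi> z) < 1"
    and r: "cmod (\<phi> 0) \<le> r" "r < 1" and z: "cmod z < 1"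
  shows "(cmod (\<phi> z))\<^sup>2 \<le> 1 - (1 - (cmod z)\<^sup>2) * (1 - r)\<^sup>2"
proof -
  define a where "a = \<phi> 0"
  define \<psi> where "\<psi> z = (\<phi> z - a) / (1 - cnj a * \<phi> z)" for z
  have a: "cmod a < 1" "cmod a \<le> r" using r by (auto simp: a_def)
  have lower: "1 - cmod a \<le> cmod (1 - cnj a * \<phi> z)" if "cmod z < 1" for z
  proof -
    have "cmod (cnj a * \<phi> z) \<le> cmod a * 1"
      unfolding norm_mult complex_mod_cnj using lt[OF that] by (intro mult_left_mono) auto
    then show ?thesis using norm_triangle_ineq2[of 1 "cnj a * \<phi> z"] by simp
  qed
  then have nz: "1 - cnj a * \<phi> z \<noteq> 0" if "cmod z < 1" for z using that a by fastforce
  have id: "(cmod (1 - cnj a * w))\<^sup>2 - (cmod (w - a))\<^sup>2 = (1 - (cmod a)\<^sup>2) * (1 - (cmod w)\<^sup>2)" for w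
    unfolding cmod_power2 by (simp add: power2_eq_square algebra_simps)
  have "cmod (\<psi> z) \<le> cmod z"
  proof (rule Schwarz_Lemma(1)[OF _ _ _ z])
    show "\<psi> holomorphic_on ball 0 1"
      unfolding \<psi>_def by (intro holomorphic_intros hol) (use nz in auto)
    show "\<psi> 0 = 0" by (simp add: \<psi>_def a_def)
    fix w :: complex assume w: "cmod w < 1"
    have "0 < (1 - (cmod a)\<^sup>2) * (1 - (cmod (\<phi> w))\<^sup>2)"
      using a lt[OF w] by (simp add: abs_square_less_1)
    then have "(cmod (\<phi> w - a))\<^sup>2 < (cmod (1 - cnj a * \<phi> w))\<^sup>2" using id[of "\<phi> w"] by linarith
    then have "cmod (\<phi> w - a) < cmod (1 - cnj a * \<phi> w)" by (rule power2_less_imp_less) simp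
    then show "cmod (\<psi> w) < 1" using nz[OF w] by (simp add: \<psi>_def norm_divide)
  qed
  then have "cmod (\<phi> z - a) \<le> cmod z * cmod (1 - cnj a * \<phi> z)"
    using nz[OF z] by (simp add: \<psi>_def norm_divide divide_le_eq)
  then have "(cmod (\<phi> z - a))\<^sup>2 \<le> (cmod z)\<^sup>2 * (cmod (1 - cnj a * \<phi> z))\<^sup>2"
    by (metis norm_ge_zero power_mono power_mult_distrib)
  then have "(1 - (cmod z)\<^sup>2) * (cmod (1 - cnj a * \<phi> z))\<^sup>2 \<le> (1 - (cmod a)\<^sup>2) * (1 - (cmod (\<phi> z))\<^sup>2)"
    using id[of "\<phi> z"] by (simp add: algebra_simps)
  also have "\<dots> \<le> 1 * (1 - (cmod (\<phi> z))\<^sup>2)"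
    using lt[OF z] by (intro mult_right_mono) (auto simp: power_le_one)
  finally have 1: "(1 - (cmod z)\<^sup>2) * (cmod (1 - cnj a * \<phi> z))\<^sup>2 \<le> 1 - (cmod (\<phi> z))\<^sup>2" by simp
  have "(1 - (cmod z)\<^sup>2) * (1 - r)\<^sup>2 \<le> (1 - (cmod z)\<^sup>2) * (cmod (1 - cnj a * \<phi> z))\<^sup>2"
  proof (intro mult_left_mono power_mono)
    show "1 - r \<le> cmod (1 - cnj a * \<phi> z)" using lower[OF z] a by linarith
    show "0 \<le> 1 - (cmod z)\<^sup>2" using z by (simp add: power_le_one)
  qed (use r in auto)
  with 1 show ?thesis by linarith
qed

text \<open>A contractive analytic function that is strict at the origin is strict on the disc, since the
  bound of \<open>schwarz_pick_bound\<close> is the same for all \<open>\<phi> z = \<langle>K z x, y\<rangle>\<close>. The vectors \<open>x\<close> are taken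
  in the open unit ball to keep \<open>\<phi>\<close> strictly below \<open>1\<close>.\<close>

lemma schur_norm_less_one:
  fixes K :: "complex \<Rightarrow> 'a::complex_hilbert \<Rightarrow>\<^sub>L 'b::complex_hilbert"
  assumes K: "K \<in> schur" and r: "norm (K 0) < 1" and z: "z \<in> ball 0 1"
  shows "norm (K z) < 1"
proof -
  define s where "s = sqrt (1 - (1 - (cmod z)\<^sup>2) * (1 - norm (K 0))\<^sup>2)"
  have zz: "cmod z < 1" using z by simp
  have aK: "analytic_on_disc K" and cK: "\<And>w. w \<in> ball 0 1 \<Longrightarrow> contraction (K w)"
    using K by (auto simp: schur_def)
  have pos: "0 < (1 - (cmod z)\<^sup>2) * (1 - norm (K 0))\<^sup>2"
    using zz r by (simp add: abs_square_less_1)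
  have le1: "(1 - (cmod z)\<^sup>2) * (1 - norm (K 0))\<^sup>2 \<le> 1"
    using r zz by (intro mult_le_one) (auto simp: power_le_one)
  have s1: "0 \<le> s" "s < 1" using pos le1 by (auto simp: s_def)
  have 1: "norm (K z x) \<le> s" if x: "norm x < 1" for x
  proof (cases "K z x = 0")
    case False
    define y where "y = inverse (norm (K z x)) *\<^sub>R K z x"
    have y: "norm y = 1" using False by (simp add: y_def)
    have bd: "cmod (cinner (K w x) y) \<le> norm (K w) * norm x" for w
      using cinner_cauchy_schwarz[of "K w x" y] norm_blinfun[of "K w" x] by (simp add: y)
    have "(cmod (cinner (K z x) y))\<^sup>2 \<le> 1 - (1 - (cmod z)\<^sup>2) * (1 - norm (K 0))\<^sup>2"
    proof (rule schwarz_pick_bound[OF holomorphic_on_cinner[OF aK] _ _ r zz])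
      fix w :: complex assume "cmod w < 1"
      then have "norm (K w x) \<le> norm x" by (intro contraction_norm_le cK) simp
      then show "cmod (cinner (K w x) y) < 1"
        using cinner_cauchy_schwarz[of "K w x" y] x by (simp add: y)
    next
      show "cmod (cinner (K 0 x) y) \<le> norm (K 0)"
        using bd[of 0] mult_left_mono[of "norm x" 1 "norm (K 0)"] x by simp
    qed
    then have "cmod (cinner (K z x) y) \<le> s" unfolding s_def by (rule real_le_rsqrt)
    moreover have "cinner (K z x) y = of_real (norm (K z x))"
      using False by (simp add: y_def cinner_scaleR_right cinner_self power2_eq_square)
    ultimately show ?thesis by simp
  qed (simp add: s1)
  have "norm (K z) \<le> s"
  proof (rule norm_blinfun_bound[OF s1(1)])
    fix x :: 'a
    show "norm (K z x) \<le> s * norm x"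
    proof (cases "x = 0")
      case False
      show ?thesis
      proof (rule field_le_mult_one_interval)
        fix t :: real assume t: "0 < t" "t < 1"
        have "norm (K z ((t / norm x) *\<^sub>R x)) \<le> s" by (rule 1) (use t False in simp)
        then show "t * norm (K z x) \<le> s * norm x"
          using t False by (simp add: blinfun.scaleR_right field_simps)
      qed
    qed simp
  qed
  with s1 show ?thesis by simp
qed


section \<open>The Redheffer map\<close>

lemma clinear_projections_inclusions:
  "clinear_op (fst_blinfun :: ('a::complex_hilbert \<times> 'b::complex_hilbert) \<Rightarrow>\<^sub>L 'a)"
  "clinear_op (snd_blinfun :: ('a \<times> 'b) \<Rightarrow>\<^sub>L 'b)"
  "clinear_op (incl1 :: 'a \<Rightarrow>\<^sub>L ('a \<times> 'b))"
  "clinear_op (incl2 :: 'b \<Rightarrow>\<^sub>L ('a \<times> 'b))"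
  by (simp_all add: clinear_op_def scaleC_prod_def incl1.rep_eq incl2.rep_eq)

lemma blk_apply:
  fixes \<Phi> :: "complex \<Rightarrow> ('f::complex_hilbert \<times> 'u::complex_hilbert)
                \<Rightarrow>\<^sub>L ('e::complex_hilbert \<times> 'y::complex_hilbert)"
  shows "blk11 \<Phi> z x = fst (\<Phi> z (x, 0))" "blk12 \<Phi> z u = fst (\<Phi> z (0, u))"
    "blk21 \<Phi> z x = snd (\<Phi> z (x, 0))" "blk22 \<Phi> z u = snd (\<Phi> z (0, u))"
  by (simp_all add: blk11_def blk12_def blk21_def blk22_def incl1.rep_eq incl2.rep_eq)

lemma fst_snd_system:
  fixes \<Phi> :: "complex \<Rightarrow> ('f::complex_hilbert \<times> 'u::complex_hilbert)
                \<Rightarrow>\<^sub>L ('e::complex_hilbert \<times> 'y::complex_hilbert)"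
  shows "fst (\<Phi> z (x, u)) = blk11 \<Phi> z x + blk12 \<Phi> z u"
    "snd (\<Phi> z (x, u)) = blk21 \<Phi> z x + blk22 \<Phi> z u"
  using blinfun.add_right[of "\<Phi> z" "(x, 0)" "(0, u)"] by (simp_all add: blk_apply)

lemma clinear_blk:
  assumes "clinear_op (\<Phi> z)"
  shows "clinear_op (blk11 \<Phi> z)" "clinear_op (blk12 \<Phi> z)" "clinear_op (blk21 \<Phi> z)" "clinear_op (blk22 \<Phi> z)"
  unfolding blk11_def blk12_def blk21_def blk22_def
  by (intro clinear_op_compose clinear_projections_inclusions assms)+

lemma analytic_blk:
  assumes "\<Phi> \<in> schur"
  shows "analytic_on_disc (blk11 \<Phi>)" "analytic_on_disc (blk12 \<Phi>)"
    "analytic_on_disc (blk21 \<Phi>)" "analytic_on_disc (blk22 \<Phi>)"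
  unfolding blk11_def[abs_def] blk12_def[abs_def] blk21_def[abs_def] blk22_def[abs_def]
  using assms
  by (intro analytic_on_disc_compose analytic_on_disc_const clinear_op_compose
      clinear_projections_inclusions; simp add: schur_def contraction_def)+

lemma blk11_schur:
  assumes "\<Phi> \<in> schur" shows "blk11 \<Phi> \<in> schur"
  unfolding schur_def
proof (intro CollectI conjI ballI)
  show "analytic_on_disc (blk11 \<Phi>)" by (rule analytic_blk[OF assms])
  fix z :: complex assume z: "z \<in> ball 0 1"
  then have \<Phi>: "contraction (\<Phi> z)" using assms by (simp add: schur_def)
  show "contraction (blk11 \<Phi> z)"
  proof (rule contractionI)
    show "norm (blk11 \<Phi> z x) \<le> norm x" for x
      using norm_fst_le[of "fst (\<Phi> z (x, 0))" "snd (\<Phi> z (x, 0))"] contraction_norm_le[OF \<Phi>, of "(x, 0)"]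
      by (simp add: blk_apply norm_Pair)
  qed (intro clinear_blk contraction_clinear \<Phi>)
qed

lemma compose_schur:
  assumes F: "F \<in> schur" and G: "G \<in> schur"
  shows "(\<lambda>z. F z o\<^sub>L G z) \<in> schur"
  unfolding schur_def
proof (intro CollectI conjI ballI)
  show "analytic_on_disc (\<lambda>z. F z o\<^sub>L G z)"
    using F G by (intro analytic_on_disc_compose) (auto simp: schur_def contraction_def)
  fix z :: complex assume "z \<in> ball 0 1"
  then have F: "contraction (F z)" and G: "contraction (G z)" using F G by (auto simp: schur_def)
  show "contraction (F z o\<^sub>L G z)"
  proof (rule contractionI)
    show "norm ((F z o\<^sub>L G z) x) \<le> norm x" for x
      using contraction_norm_le[OF F, of "G z x"] contraction_norm_le[OF G, of x] by simp
  qed (intro clinear_op_compose contraction_clinear F G)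
qed

text \<open>The value of the Redheffer map is the closed loop of the system \<open>\<Phi> z\<close> with \<open>F z\<close> in the
  feedback path; invertibility of \<open>I - \<Phi>\<^sub>1\<^sub>1 F\<close> determines the internal signal \<open>x\<close>.\<close>

lemma redheffer_loop:
  fixes \<Phi> :: "complex \<Rightarrow> ('f::complex_hilbert \<times> 'u::complex_hilbert)
                \<Rightarrow>\<^sub>L ('e::complex_hilbert \<times> 'y::complex_hilbert)" and F :: "complex \<Rightarrow> 'e \<Rightarrow>\<^sub>L 'f"
  assumes inv: "invertible_op (id_blinfun - (blk11 \<Phi> z o\<^sub>L F z))"
  shows "fst (\<Phi> z (F z x, u)) = x \<longleftrightarrow>
      x = inverse_op (id_blinfun - (blk11 \<Phi> z o\<^sub>L F z)) (blk12 \<Phi> z u)" (is "?loop \<longleftrightarrow> x = ?S (blk12 \<Phi> z u)")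
    and "fst (\<Phi> z (F z x, u)) = x \<Longrightarrow> snd (\<Phi> z (F z x, u)) = redheffer \<Phi> F z u"
proof -
  let ?T = "id_blinfun - (blk11 \<Phi> z o\<^sub>L F z)"
  have "?loop \<longleftrightarrow> ?T x = blk12 \<Phi> z u"
    by (auto simp: fst_snd_system blinfun.diff_left algebra_simps)
  also have "\<dots> \<longleftrightarrow> x = ?S (blk12 \<Phi> z u)"
    using inverse_op_apply_left[OF inv] inverse_op_apply_right[OF inv] by metis
  finally show *: "?loop \<longleftrightarrow> x = ?S (blk12 \<Phi> z u)" .
  assume ?loop
  with * have "x = ?S (blk12 \<Phi> z u)" by blast
  then show "snd (\<Phi> z (F z x, u)) = redheffer \<Phi> F z u"
    by (simp add: fst_snd_system redheffer_def blinfun.add_left add.commute)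
qed

lemma analytic_inverse_loop:
  assumes \<Phi>: "\<Phi> \<in> schur" and F: "F \<in> schur"
    and inv: "\<And>z. z \<in> ball 0 1 \<Longrightarrow> invertible_op (id_blinfun - (blk11 \<Phi> z o\<^sub>L F z))"
  shows "analytic_on_disc (\<lambda>z. inverse_op (id_blinfun - (blk11 \<Phi> z o\<^sub>L F z)))"
    and "\<And>z. z \<in> ball 0 1 \<Longrightarrow> clinear_op (inverse_op (id_blinfun - (blk11 \<Phi> z o\<^sub>L F z)))"
proof -
  have K: "(\<lambda>z. blk11 \<Phi> z o\<^sub>L F z) \<in> schur" by (intro compose_schur blk11_schur \<Phi> F)
  show cl: "clinear_op (inverse_op (id_blinfun - (blk11 \<Phi> z o\<^sub>L F z)))" if z: "z \<in> ball 0 1" for z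
    using K z by (intro clinear_inverse_op inv clinear_op_diff clinear_op_id)
      (auto simp: schur_def contraction_def)
  show "analytic_on_disc (\<lambda>z. inverse_op (id_blinfun - (blk11 \<Phi> z o\<^sub>L F z)))"
  proof (rule analytic_on_disc_inverse[OF _ cl inverse_op_left[OF inv] inverse_op_right[OF inv]])
    show "analytic_on_disc (\<lambda>z. id_blinfun - (blk11 \<Phi> z o\<^sub>L F z))"
      using K by (intro analytic_on_disc_diff analytic_on_disc_const) (simp add: schur_def)
  qed
qed

lemma redheffer_schur:
  assumes \<Phi>: "\<Phi> \<in> schur" and F: "F \<in> schur"
    and inv: "\<And>z. z \<in> ball 0 1 \<Longrightarrow> invertible_op (id_blinfun - (blk11 \<Phi> z o\<^sub>L F z))"
  shows "redheffer \<Phi> F \<in> schur"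
  unfolding schur_def
proof (intro CollectI conjI ballI)
  note S = analytic_inverse_loop[OF \<Phi> F inv]
  have cl: "clinear_op (\<Phi> z)" "clinear_op (F z)" if "z \<in> ball 0 1" for z
    using \<Phi> F that by (auto simp: schur_def contraction_def)
  have aF: "analytic_on_disc F" using F by (simp add: schur_def)
  show "analytic_on_disc (redheffer \<Phi> F)"
    unfolding redheffer_def[abs_def]
    by (intro analytic_on_disc_add analytic_on_disc_compose analytic_blk \<Phi> aF S
        clinear_op_compose clinear_blk cl)
  fix z :: complex assume z: "z \<in> ball 0 1"
  have cz: "contraction (\<Phi> z)" "contraction (F z)" using \<Phi> F z by (auto simp: schur_def)
  show "contraction (redheffer \<Phi> F z)"
  proof (rule contractionI)
    show "clinear_op (redheffer \<Phi> F z)"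
      unfolding redheffer_def by (intro clinear_op_add clinear_op_compose clinear_blk cl S z)
    fix u
    obtain x where "fst (\<Phi> z (F z x, u)) = x" using redheffer_loop(1)[of \<Phi> z F, OF inv[OF z]] by blast
    with redheffer_loop(2)[of \<Phi> z F, OF inv[OF z]]
    have eq: "\<Phi> z (F z x, u) = (x, redheffer \<Phi> F z u)" by (metis prod.collapse)
    have "(norm (\<Phi> z (F z x, u)))\<^sup>2 \<le> (norm (F z x, u))\<^sup>2"
      by (intro power_mono contraction_norm_le cz) simp
    moreover have "(norm (F z x))\<^sup>2 \<le> (norm x)\<^sup>2" by (intro power_mono contraction_norm_le cz) simp
    ultimately have "(norm (redheffer \<Phi> F z u))\<^sup>2 \<le> (norm u)\<^sup>2"
      unfolding eq norm_Pair by (simp only: real_sqrt_pow2 add_nonneg_nonneg zero_le_power2)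
    then show "norm (redheffer \<Phi> F z u) \<le> norm u" by (rule power2_le_imp_le) simp
  qed
qed

lemma hardy_fun_diff: "hardy_fun (g - h) z = hardy_fun g z - hardy_fun h z"
  using fun_cong[OF hardy_fun_add[of "g - h" h], of z] by simp

lemma const_schur: "contraction C \<Longrightarrow> (\<lambda>_. C) \<in> schur"
  by (simp add: schur_def analytic_on_disc_const)

lemma contraction_projections_inclusions:
  "contraction (fst_blinfun :: ('a::complex_hilbert \<times> 'b::complex_hilbert) \<Rightarrow>\<^sub>L 'a)"
  "contraction (snd_blinfun :: ('a \<times> 'b) \<Rightarrow>\<^sub>L 'b)"
  "contraction (incl1 :: 'a \<Rightarrow>\<^sub>L ('a \<times> 'b))"
  "contraction (incl2 :: 'b \<Rightarrow>\<^sub>L ('a \<times> 'b))"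
  by (rule contractionI;
      auto simp: clinear_projections_inclusions norm_fst_le norm_snd_le norm_Pair incl1.rep_eq incl2.rep_eq)+

text \<open>The unitary identification of \<open>H\<^sup>2 \<oplus> H\<^sup>2\<close> with the Hardy space of the direct sum, and its
  inverse. It turns the multiplication operator of \<open>\<Phi>\<close> into a system with two separate inputs and
  outputs.\<close>

definition hardy_pair :: "('a::complex_hilbert hardy \<times> 'b::complex_hilbert hardy) \<Rightarrow>\<^sub>L ('a \<times> 'b) hardy"
  where "hardy_pair = (mult_op (\<lambda>_. incl1) o\<^sub>L fst_blinfun) + (mult_op (\<lambda>_. incl2) o\<^sub>L snd_blinfun)"

definition hardy_split :: "('a::complex_hilbert \<times> 'b::complex_hilbert) hardy \<Rightarrow>\<^sub>L ('a hardy \<times> 'b hardy)"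
  where "hardy_split = (incl1 o\<^sub>L mult_op (\<lambda>_. fst_blinfun)) + (incl2 o\<^sub>L mult_op (\<lambda>_. snd_blinfun))"

lemmas mult_op_schur =
  hardy_fun_mult_op[OF schur_iff_bounded_analytic[THEN iffD1]]
  clinear_mult_op[OF schur_iff_bounded_analytic[THEN iffD1]]

lemmas const_projections_inclusions_schur = contraction_projections_inclusions[THEN const_schur]

lemma hardy_fun_pair:
  assumes z: "z \<in> ball 0 1"
  shows "hardy_fun (hardy_pair (f, u)) z = (hardy_fun f z, hardy_fun u z)"
  by (simp add: hardy_pair_def blinfun.add_left hardy_fun_add incl1.rep_eq incl2.rep_eq
      mult_op_schur(1)[OF const_projections_inclusions_schur(3) z]
      mult_op_schur(1)[OF const_projections_inclusions_schur(4) z])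

lemma hardy_fun_split:
  assumes z: "z \<in> ball 0 1"
  shows "hardy_fun (fst (hardy_split g)) z = fst (hardy_fun g z)"
    and "hardy_fun (snd (hardy_split g)) z = snd (hardy_fun g z)"
  by (simp_all add: hardy_split_def blinfun.add_left incl1.rep_eq incl2.rep_eq
      mult_op_schur(1)[OF const_projections_inclusions_schur(1) z]
      mult_op_schur(1)[OF const_projections_inclusions_schur(2) z])

lemma hardy_pair_split: "hardy_pair (hardy_split g) = g"
proof (rule hardy_fun_eqI)
  fix z :: complex assume z: "z \<in> ball 0 1"
  show "hardy_fun (hardy_pair (hardy_split g)) z = hardy_fun g z"
    using hardy_fun_pair[OF z, of "fst (hardy_split g)" "snd (hardy_split g)"]
    by (simp add: hardy_fun_split[OF z])
qed

lemma norm_hardy_pair: "norm (hardy_pair p) = norm p"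
proof -
  obtain f u where p: "p = (f, u)" by fastforce
  have co: "hardy_coeff (hardy_pair (f, u)) = (\<lambda>n. (hardy_coeff f n, hardy_coeff u n))"
  proof (rule hardy_coeff_eqI)
    fix z :: complex assume z: "z \<in> ball 0 1"
    have "(\<lambda>n. incl1 (z ^ n *\<^sub>C hardy_coeff f n) + incl2 (z ^ n *\<^sub>C hardy_coeff u n))
        sums (incl1 (hardy_fun f z) + incl2 (hardy_fun u z))"
      by (intro sums_add bounded_linear.sums[OF blinfun.bounded_linear_right] hardy_coeff_sums z)
    then show "(\<lambda>n. z ^ n *\<^sub>C (hardy_coeff f n, hardy_coeff u n)) sums hardy_fun (hardy_pair (f, u)) z"
      by (simp add: hardy_fun_pair[OF z] incl1.rep_eq incl2.rep_eq scaleC_prod_def)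
  qed
  have "(norm (hardy_pair (f, u)))\<^sup>2 = (norm f)\<^sup>2 + (norm u)\<^sup>2"
    unfolding norm_hardy_power2 co by (simp add: norm_Pair suminf_add summable_hardy)
  then have "(norm (hardy_pair p))\<^sup>2 = (norm p)\<^sup>2" by (simp add: p norm_Pair)
  then show ?thesis by simp
qed

lemma contraction_hardy_system:
  assumes \<Phi>: "\<Phi> \<in> schur"
  shows "contraction (hardy_split o\<^sub>L mult_op \<Phi> o\<^sub>L hardy_pair)"
proof (rule contractionI)
  show "clinear_op (hardy_split o\<^sub>L mult_op \<Phi> o\<^sub>L hardy_pair)"
    unfolding hardy_split_def hardy_pair_def
    by (intro clinear_op_compose clinear_op_add clinear_projections_inclusions mult_op_schur(2) \<Phi>
        const_projections_inclusions_schur)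
  fix p
  have "norm (hardy_split (mult_op \<Phi> (hardy_pair p))) = norm (mult_op \<Phi> (hardy_pair p))"
    by (metis norm_hardy_pair hardy_pair_split)
  also have "\<dots> \<le> norm (hardy_pair p)" by (rule contraction_norm_le[OF contraction_mult_op[OF \<Phi>]])
  finally show "norm ((hardy_split o\<^sub>L mult_op \<Phi> o\<^sub>L hardy_pair) p) \<le> norm p"
    by (simp add: norm_hardy_pair)
qed

lemma redheffer_prec:
  fixes \<Phi> :: "complex \<Rightarrow> ('f::complex_hilbert \<times> 'u::complex_hilbert)
                \<Rightarrow>\<^sub>L ('e::complex_hilbert \<times> 'y::complex_hilbert)"
  assumes \<Phi>: "\<Phi> \<in> schur" and FG: "F \<prec>\<^sub>\<infinity> G" and bi: "boundedly_invertible \<Phi> F"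
    and invG: "\<And>z. z \<in> ball 0 1 \<Longrightarrow> invertible_op (id_blinfun - (blk11 \<Phi> z o\<^sub>L G z))"
  shows "redheffer \<Phi> F \<prec>\<^sub>\<infinity> redheffer \<Phi> G"
proof -
  have F: "F \<in> schur" and G: "G \<in> schur" and prec: "mult_op F \<prec> mult_op G"
    using FG by (auto simp: prec_schur_def)
  have invF: "invertible_op (id_blinfun - (blk11 \<Phi> z o\<^sub>L F z))" if "z \<in> ball 0 1" for z
    using bi that by (auto simp: boundedly_invertible_def)
  note RF = redheffer_schur[OF \<Phi> F invF] and RG = redheffer_schur[OF \<Phi> G invG]
  define S where "S z = inverse_op (id_blinfun - (blk11 \<Phi> z o\<^sub>L F z))" for z
  obtain M where M: "\<And>z. z \<in> ball 0 1 \<Longrightarrow> norm (S z) \<le> M"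
    using bi unfolding boundedly_invertible_def bdd_above_def S_def by blast
  have S: "bounded_analytic M S"
    using analytic_inverse_loop[OF \<Phi> F invF] M by (simp add: bounded_analytic_def S_def[abs_def])
  have Sl: "S z (x - blk11 \<Phi> z (F z x)) = x" and Sr: "S z x - blk11 \<Phi> z (F z (S z x)) = x"
    if "z \<in> ball 0 1" for z x
    using inverse_op_apply_left[OF invF[OF that], of x] inverse_op_apply_right[OF invF[OF that], of x]
    by (simp_all add: S_def blinfun.diff_left)
  let ?P = "hardy_split o\<^sub>L mult_op \<Phi> o\<^sub>L hardy_pair"
  have P: "hardy_fun (fst (?P (f, u))) z = fst (\<Phi> z (hardy_fun f z, hardy_fun u z))"
    "hardy_fun (snd (?P (f, u))) z = snd (\<Phi> z (hardy_fun f z, hardy_fun u z))"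
    if z: "z \<in> ball 0 1" for f u z
    by (simp_all add: hardy_fun_split[OF z] mult_op_schur(1)[OF \<Phi> z] hardy_fun_pair[OF z])
  have h0: "hardy_fun (0::'u hardy) z = 0" for z
    using hardy_fun_diff[of "0::'u hardy" 0 z] by simp
  have N: "hardy_fun (fst (?P (f, 0))) z = blk11 \<Phi> z (hardy_fun f z)" if z: "z \<in> ball 0 1" for f z
    by (simp only: P[OF z] h0 blk_apply)
  have loop: "snd (?P (mult_op H a, u)) = mult_op (redheffer \<Phi> H) u"
    if H: "H \<in> schur" "\<And>z. z \<in> ball 0 1 \<Longrightarrow> invertible_op (id_blinfun - (blk11 \<Phi> z o\<^sub>L H z))"
      "redheffer \<Phi> H \<in> schur" and fp: "fst (?P (mult_op H a, u)) = a" for H a u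
  proof (rule hardy_fun_eqI)
    fix z :: complex assume z: "z \<in> ball 0 1"
    have "fst (\<Phi> z (H z (hardy_fun a z), hardy_fun u z)) = hardy_fun a z"
      using arg_cong[OF fp, of "\<lambda>g. hardy_fun g z"] by (simp only: P[OF z] mult_op_schur(1)[OF H(1) z])
    from redheffer_loop(2)[of \<Phi> z H, OF H(2)[OF z] this]
    show "hardy_fun (snd (?P (mult_op H a, u))) z = hardy_fun (mult_op (redheffer \<Phi> H) u) z"
      by (simp only: P[OF z] mult_op_schur(1)[OF H(1) z] mult_op_schur(1)[OF H(3) z])
  qed
  have "mult_op (redheffer \<Phi> F) \<prec> mult_op (redheffer \<Phi> G)"
  proof (rule prec_op_feedback[OF contraction_hardy_system[OF \<Phi>] prec contraction_mult_op[OF RF]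
        contraction_mult_op[OF RG] bounded_analytic_nonneg[OF S]])
    show "norm x \<le> M * norm (x - fst (?P (mult_op F x, 0)))" for x
    proof -
      have "mult_op S (x - fst (?P (mult_op F x, 0))) = x"
        by (rule hardy_fun_eqI)
           (simp only: hardy_fun_mult_op[OF S] hardy_fun_diff N mult_op_schur(1)[OF F] Sl)
      then show ?thesis using norm_mult_op_le[OF S] by metis
    qed
    show "mult_op S x - fst (?P (mult_op F (mult_op S x), 0)) = x" for x
      by (rule hardy_fun_eqI)
         (simp only: hardy_fun_mult_op[OF S] hardy_fun_diff N mult_op_schur(1)[OF F] Sr)
    show "snd (?P (mult_op F a, u)) = mult_op (redheffer \<Phi> F) u"
      if "fst (?P (mult_op F a, u)) = a" for a u
      by (rule loop[OF F invF RF that])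
    show "snd (?P (mult_op G a, u)) = mult_op (redheffer \<Phi> G) u"
      if "fst (?P (mult_op G a, u)) = a" for a u
      by (rule loop[OF G invG RG that])
  qed
  with RF RG show ?thesis by (simp add: prec_schur_def)
qed

lemma strict_feedback_boundedly_invertible:
  assumes \<Phi>: "\<Phi> \<in> schur" and F: "F \<in> schur" and strict: "disc_norm (blk11 \<Phi>) < 1"
  shows "boundedly_invertible \<Phi> F"
proof -
  let ?\<rho> = "disc_norm (blk11 \<Phi>)"
  have c11: "contraction (blk11 \<Phi> z)" and cF: "contraction (F z)" if "z \<in> ball 0 1" for z
    using blk11_schur[OF \<Phi>] F that by (auto simp: schur_def)
  have le: "norm (blk11 \<Phi> z) \<le> ?\<rho>" if "z \<in> ball 0 1" for z
    unfolding disc_norm_def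
    by (rule cSUP_upper[OF that]) (use c11 in \<open>auto simp: contraction_def intro!: bdd_aboveI[of _ 1]\<close>)
  have K: "clinear_op (blk11 \<Phi> z o\<^sub>L F z)" "norm (blk11 \<Phi> z o\<^sub>L F z) \<le> ?\<rho>" if z: "z \<in> ball 0 1" for z
  proof -
    show "clinear_op (blk11 \<Phi> z o\<^sub>L F z)"
      by (intro clinear_op_compose contraction_clinear c11 cF z)
    have "norm (blk11 \<Phi> z o\<^sub>L F z) \<le> norm (blk11 \<Phi> z) * norm (F z)" by (rule norm_blinfun_compose)
    also have "\<dots> \<le> norm (blk11 \<Phi> z) * 1"
      using cF[OF z] by (intro mult_left_mono) (auto simp: contraction_def)
    finally show "norm (blk11 \<Phi> z o\<^sub>L F z) \<le> ?\<rho>" using le[OF z] by simp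
  qed
  show ?thesis
    unfolding boundedly_invertible_def
    by (intro conjI ballI invertible_id_minus[OF K strict] bdd_aboveI2[where M = "1 / (1 - ?\<rho>)"]
        norm_inverse_id_minus[OF K strict])
qed

lemma invertible_loop_of_strict_at_zero:
  assumes \<Phi>: "\<Phi> \<in> schur" and G: "G \<in> schur" and "norm (blk11 \<Phi> 0 o\<^sub>L G 0) < 1" and z: "z \<in> ball 0 1"
  shows "invertible_op (id_blinfun - (blk11 \<Phi> z o\<^sub>L G z))"
proof (rule invertible_id_minus[OF _ order_refl])
  have K: "(\<lambda>z. blk11 \<Phi> z o\<^sub>L G z) \<in> schur" by (intro compose_schur blk11_schur \<Phi> G)
  then show "clinear_op (blk11 \<Phi> z o\<^sub>L G z)" using z by (auto simp: schur_def contraction_def)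
  show "norm (blk11 \<Phi> z o\<^sub>L G z) < 1" using schur_norm_less_one[OF K _ z] assms(3) by simp
qed

theorem theorem0p4:
  fixes \<Phi> :: "complex \<Rightarrow> ('f::complex_hilbert \<times> 'u::complex_hilbert)
                \<Rightarrow>\<^sub>L ('e::complex_hilbert \<times> 'y::complex_hilbert)"
  assumes "separable_space (euclidean :: 'u topology)"
    and "separable_space (euclidean :: 'y topology)"
    and "separable_space (euclidean :: 'e topology)"
    and "separable_space (euclidean :: 'f topology)"
    and "\<Phi> \<in> schur"
  shows "(\<forall>F\<in>schur. \<forall>G\<in>schur.
            F \<prec>\<^sub>\<infinity> G
            \<and> norm (blk11 \<Phi> 0 o\<^sub>L F 0) < 1 \<and> norm (blk11 \<Phi> 0 o\<^sub>L G 0) < 1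
            \<and> boundedly_invertible \<Phi> F
            \<longrightarrow> redheffer \<Phi> F \<prec>\<^sub>\<infinity> redheffer \<Phi> G)
       \<and> (disc_norm (blk11 \<Phi>) < 1 \<longrightarrow>
            (\<forall>F\<in>schur. redheffer \<Phi> F \<in> schur)
            \<and> (\<forall>F\<in>schur. \<forall>G\<in>schur. F \<prec>\<^sub>\<infinity> G \<longrightarrow> redheffer \<Phi> F \<prec>\<^sub>\<infinity> redheffer \<Phi> G))"
proof (intro conjI ballI impI; (elim conjE)?)
  note \<Phi> = \<open>\<Phi> \<in> schur\<close>
  fix F G :: "complex \<Rightarrow> 'e \<Rightarrow>\<^sub>L 'f"
  assume G: "G \<in> schur" and "F \<prec>\<^sub>\<infinity> G" "boundedly_invertible \<Phi> F"
    and "norm (blk11 \<Phi> 0 o\<^sub>L G 0) < 1"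
  then show "redheffer \<Phi> F \<prec>\<^sub>\<infinity> redheffer \<Phi> G"
    by (intro redheffer_prec \<Phi> invertible_loop_of_strict_at_zero)
next
  note \<Phi> = \<open>\<Phi> \<in> schur\<close>
  assume "disc_norm (blk11 \<Phi>) < 1"
  note bi = strict_feedback_boundedly_invertible[OF \<Phi> _ this]
  have inv: "invertible_op (id_blinfun - (blk11 \<Phi> z o\<^sub>L F z))"
    if "F \<in> schur" "z \<in> ball 0 1" for F :: "complex \<Rightarrow> 'e \<Rightarrow>\<^sub>L 'f" and z
    using bi[OF that(1)] that(2) by (simp add: boundedly_invertible_def)
  fix F :: "complex \<Rightarrow> 'e \<Rightarrow>\<^sub>L 'f" assume F: "F \<in> schur"
  show "redheffer \<Phi> F \<in> schur" by (intro redheffer_schur \<Phi> F inv)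
  fix G :: "complex \<Rightarrow> 'e \<Rightarrow>\<^sub>L 'f" assume "G \<in> schur" "F \<prec>\<^sub>\<infinity> G"
  then show "redheffer \<Phi> F \<prec>\<^sub>\<infinity> redheffer \<Phi> G" by (intro redheffer_prec \<Phi> bi inv F)
qed

end
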